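(* Let $T=(T_1,\ldots,T_d)$ be a pure commuting row contraction on some Hilbert space $\mathfrak{H}$. Let $\mathcal{J}\subset\mathcal{M}_d$ be a weak-$*$ closed ideal and let $X\in\mathcal{Q}(M_{\mathcal{J}}^*,T)$. Let $\mathfrak{M},\mathfrak{N}\subset\mathfrak{H}$ be closed invariant subspaces for $T$ such that $\mathrm{Ann}_{\mathrm{c}}(T|_{\mathfrak{M}})=\mathrm{Ann}_{\mathrm{c}}(T|_{\mathfrak{N}})$. If $\mathfrak{M}$ and $\mathfrak{N}$ are contained in the range of $X$, then $\mathfrak{M}=\mathfrak{N}$.
   Context: Fix a positive integer $d$. The Drury--Arveson space $H^2_d$ is the Hilbert space of analytic functions $f=\sum_{\alpha\in\mathbb{N}^d}c_\alpha x^\alpha$ on the open unit ball $\mathbb{B}_d\subset\mathbb{C}^d$ with $\|f\|^2=\sum_{\alpha}\frac{\alpha!}{|\alpha|!}|c_\alpha|^2<\infty$; $x_1,\dots,x_d$ are the coordinate functions. $\mathcal{M}_d$ is its multiplier algebra, viewed as a weak-$*$ closed unital subalgebra of $B(H^2_d)$ via $\phi\mapsto M_\phi$, $M_\phi f=\phi f$. A $d$-tuple $T=(T_1,\dots,T_d)$ of bounded operators on $\mathfrak{H}$ is a row contraction if $\sum_{k=1}^d T_kT_k^*\le I$; it is commuting if the $T_k$ commute with each other; it is pure if $\lim_{n\to\infty}\sum_{|w|=n}\|T_w^*\xi\|^2=0$ for all $\xi\in\mathfrak{H}$, where $w=i_1\cdots i_n$ ranges over words of length $n$ in $\{1,\dots,d\}$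 and $T_w=T_{i_1}\cdots T_{i_n}$. For a pure commuting row contraction $T$ there is a unique unital completely contractive weak-$*$ continuous homomorphism $\mathcal{M}_d\to B(\mathfrak{H})$ sending $M_{x_k}$ to $T_k$ for each $k$; the image of $\phi$ is written $\phi(T)$. $\mathrm{Ann}_{\mathrm{c}}(T)=\{\phi\in\mathcal{M}_d:\phi(T)=0\}$. For a closed subspace $\mathfrak{M}$ invariant for $T$ (i.e. $T_k\mathfrak{M}\subset\mathfrak{M}$ for all $k$), $T|_{\mathfrak{M}}=(T_1|_{\mathfrak{M}},\ldots,T_d|_{\mathfrak{M}})$, which is again a pure commuting row contraction. For a weak-$*$ closed ideal $\mathcal{J}\subset\mathcal{M}_d$, let $[\mathcal{J}H^2_d]$ be the closed linear span of $\{\theta f:\theta\in\mathcal{J},f\in H^2_d\}$, $H_{\mathcal{J}}=H^2_d\ominus[\mathcal{J}H^2_d]$, and $M_{\mathcal{J}}=(P_{H_{\mathcal{J}}}M_{x_1}|_{H_{\mathcal{J}}},\ldots,P_{H_{\mathcal{J}}}M_{x_d}|_{H_{\mathcal{J}}})$; $M_{\mathcal{J}}^*$ is the $d$-tuple of adjoints, $(M_{x_1}^*|_{H_{\mathcal{J}}},\ldots,M_{x_d}^*|_{H_{\mathcal{J}}})$. For $d$-tuples $S$ on $\mathfrak{H}$ and $S'$ on $\mathfrak{H}'$, $\mathcal{Q}(S',S)$ denotes the collection of injective bounded linear operators $X:\mathfrak{H}'\to\mathfrak{H}$ with dense range such that $XS'_k=S_kX$ for every $k=1,\dots,d$. *)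

theory Defs
  imports "HOL-Analysis.Analysis" "HOL-Library.FuncSet" "HOL-Library.Nonpos_Ints"
begin

section \<open>Complex Hilbert spaces\<close>

text \<open>The inner product is linear in its first argument; its real part is the inner product of
  \<^class>\<open>real_inner\<close>, so norm, topology and completeness are those of the library.\<close>

class complex_hilbert = real_inner + complete_space +
  fixes scaleC :: "complex \<Rightarrow> 'a \<Rightarrow> 'a" (infixr \<open>*\<^sub>C\<close> 75)
    and cinner :: "'a \<Rightarrow> 'a \<Rightarrow> complex"
  assumes scaleC_add_right: "c *\<^sub>C (x + y) = c *\<^sub>C x + c *\<^sub>C y"
    and scaleC_add_left: "(b + c) *\<^sub>C x = b *\<^sub>C x + c *\<^sub>C x"
    and scaleC_scaleC: "b *\<^sub>C c *\<^sub>C x = (b * c) *\<^sub>C x"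
    and scaleC_one: "1 *\<^sub>C x = x"
    and scaleR_scaleC: "r *\<^sub>R x = complex_of_real r *\<^sub>C x"
    and cinner_commute: "cinner x y = cnj (cinner y x)"
    and cinner_add_left: "cinner (x + y) z = cinner x z + cinner y z"
    and cinner_scaleC_left: "cinner (c *\<^sub>C x) y = c * cinner x y"
    and inner_eq_Re_cinner: "inner x y = Re (cinner x y)"

global_interpretation cvec: vector_space "scaleC :: complex \<Rightarrow> 'a \<Rightarrow> 'a::complex_hilbert"
  by unfold_locales (simp_all add: scaleC_add_right scaleC_add_left scaleC_scaleC scaleC_one)

definition orth :: "'a::complex_hilbert set \<Rightarrow> 'a set" where
  "orth S = {x. \<forall>y\<in>S. cinner x y = 0}"

definition orth_proj :: "'a::complex_hilbert set \<Rightarrow> 'a \<Rightarrow> 'a" where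
  "orth_proj S x = (THE y. y \<in> S \<and> x - y \<in> orth S)"


section \<open>Operators on closed subspaces\<close>

text \<open>A Hilbert space is rendered as a closed subspace of a type of class
  \<^class>\<open>complex_hilbert\<close>. An operator on \<open>S\<close> is a function that is extensional on \<open>S\<close>
  (\<^const>\<open>undefined\<close> outside \<open>S\<close>), so that equality of operators is equality of functions and
  \<^term>\<open>restrict A M\<close> is the restriction of an operator \<open>A\<close> to \<open>M\<close>.\<close>

definition bounded_ops ::
    "'a::complex_hilbert set \<Rightarrow> 'b::complex_hilbert set \<Rightarrow> ('a \<Rightarrow> 'b) set" where
  "bounded_ops S R = {A \<in> S \<rightarrow>\<^sub>E R.
     (\<forall>x\<in>S. \<forall>y\<in>S. A (x + y) = A x + A y) \<and>
     (\<forall>c. \<forall>x\<in>S. A (c *\<^sub>C x) = c *\<^sub>C A x) \<and>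
     (\<exists>K. \<forall>x\<in>S. norm (A x) \<le> K * norm x)}"

definition adj :: "'a::complex_hilbert set \<Rightarrow> ('a \<Rightarrow> 'a) \<Rightarrow> 'a \<Rightarrow> 'a" where
  "adj S A = (\<lambda>y\<in>S. THE z. z \<in> S \<and> (\<forall>x\<in>S. cinner (A x) y = cinner x z))"

definition op_le :: "'a::complex_hilbert set \<Rightarrow> ('a \<Rightarrow> 'a) \<Rightarrow> ('a \<Rightarrow> 'a) \<Rightarrow> bool" where
  "op_le S A B \<longleftrightarrow> (\<forall>x\<in>S. cinner (B x - A x) x \<in> \<real>\<^sub>\<ge>\<^sub>0)"

text \<open>The norm of the operator on the \<open>n\<close>-fold direct sum of \<open>S\<close> with operator entries \<open>A i j\<close>.\<close>

definition matrix_op_norm ::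
    "'a::complex_hilbert set \<Rightarrow> nat \<Rightarrow> (nat \<Rightarrow> nat \<Rightarrow> 'a \<Rightarrow> 'a) \<Rightarrow> real" where
  "matrix_op_norm S n A =
     Sup {sqrt (\<Sum>i<n. (norm (\<Sum>j<n. A i j (x j)))\<^sup>2) | x.
            (\<forall>j<n. x j \<in> S) \<and> (\<Sum>j<n. (norm (x j))\<^sup>2) \<le> 1}"

text \<open>The weak-* topology of the bounded operators as the dual of the trace class: trace class
  operators are the sums of rank one operators below, with square summable \<open>\<xi>\<close> and \<open>\<eta>\<close>.\<close>

definition weak_star :: "'a::complex_hilbert set \<Rightarrow> ('a \<Rightarrow> 'a) topology" where
  "weak_star S = topology_generated_by
     {{A \<in> bounded_ops S S. (\<Sum>n. cinner (A (\<xi> n)) (\<eta> n)) \<in> U} | \<xi> \<eta> U.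
        range \<xi> \<subseteq> S \<and> range \<eta> \<subseteq> S \<and>
        summable (\<lambda>n. (norm (\<xi> n))\<^sup>2) \<and> summable (\<lambda>n. (norm (\<eta> n))\<^sup>2) \<and> open U}"


section \<open>Tuples of operators\<close>

text \<open>A \<open>d\<close>-tuple is indexed by a finite type \<open>'d\<close>.\<close>

primrec word_op ::
    "'a::complex_hilbert set \<Rightarrow> ('d \<Rightarrow> 'a \<Rightarrow> 'a) \<Rightarrow> 'd list \<Rightarrow> 'a \<Rightarrow> 'a" where
  "word_op S T [] = (\<lambda>x\<in>S. x)"
| "word_op S T (k # w) = compose S (T k) (word_op S T w)"

definition commuting :: "'a::complex_hilbert set \<Rightarrow> ('d \<Rightarrow> 'a \<Rightarrow> 'a) \<Rightarrow> bool" where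
  "commuting S T \<longleftrightarrow> (\<forall>i j. compose S (T i) (T j) = compose S (T j) (T i))"

definition row_contraction :: "'a::complex_hilbert set \<Rightarrow> ('d::finite \<Rightarrow> 'a \<Rightarrow> 'a) \<Rightarrow> bool" where
  "row_contraction S T \<longleftrightarrow> (\<forall>k. T k \<in> bounded_ops S S) \<and>
     op_le S (\<lambda>x\<in>S. \<Sum>k\<in>UNIV. T k (adj S (T k) x)) (\<lambda>x\<in>S. x)"

definition pure :: "'a::complex_hilbert set \<Rightarrow> ('d::finite \<Rightarrow> 'a \<Rightarrow> 'a) \<Rightarrow> bool" where
  "pure S T \<longleftrightarrow> (\<forall>x\<in>S.
     (\<lambda>n. \<Sum>w | length w = n. (norm (adj S (word_op S T w) x))\<^sup>2) \<longlonglongrightarrow> 0)"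

definition closed_invariant_subspace ::
    "('d \<Rightarrow> 'a \<Rightarrow> 'a) \<Rightarrow> 'a::complex_hilbert set \<Rightarrow> bool" where
  "closed_invariant_subspace T M \<longleftrightarrow> cvec.subspace M \<and> closed M \<and> (\<forall>k. T k ` M \<subseteq> M)"

definition restrict_tuple :: "('d \<Rightarrow> 'a \<Rightarrow> 'a) \<Rightarrow> 'a set \<Rightarrow> 'd \<Rightarrow> 'a \<Rightarrow> 'a" where
  "restrict_tuple T M = (\<lambda>k. restrict (T k) M)"

text \<open>The collection \<open>\<Q>(A, B)\<close> for tuples \<open>A\<close> on \<open>R\<close> and \<open>B\<close> on \<open>S\<close>.\<close>

definition quasi_intertwiners ::
    "'b::complex_hilbert set \<Rightarrow> ('d \<Rightarrow> 'b \<Rightarrow> 'b) \<Rightarrow>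
     'a::complex_hilbert set \<Rightarrow> ('d \<Rightarrow> 'a \<Rightarrow> 'a) \<Rightarrow> ('b \<Rightarrow> 'a) set" where
  "quasi_intertwiners R A S B = {X \<in> bounded_ops R S.
     inj_on X R \<and> closure (X ` R) = S \<and> (\<forall>k. compose R X (A k) = compose R (B k) X)}"


section \<open>The Drury--Arveson space\<close>

definition da_weight :: "('d::finite \<Rightarrow> nat) \<Rightarrow> real" where
  "da_weight \<alpha> = (\<Prod>i\<in>UNIV. fact (\<alpha> i)) / fact (\<Sum>i\<in>UNIV. \<alpha> i)"

text \<open>An element is given by its coefficient family; \<open>da_eval\<close> below is the analytic function on
  the unit ball that it represents.\<close>

typedef 'd drury_arveson =
  "{c :: ('d::finite \<Rightarrow> nat) \<Rightarrow> complex. (\<lambda>\<alpha>. da_weight \<alpha> * (norm (c \<alpha>))\<^sup>2) summable_on UNIV}"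
  morphisms da_coeff Abs_da
  by (rule exI[of _ "\<lambda>_. 0"]) simp

setup_lifting type_definition_drury_arveson

definition da_eval :: "'d::finite drury_arveson \<Rightarrow> complex^'d \<Rightarrow> complex" where
  "da_eval f z = (\<Sum>\<^sub>\<infinity>\<alpha>. da_coeff f \<alpha> * (\<Prod>i\<in>UNIV. (z $ i) ^ \<alpha> i))"

lemma da_weight_pos: "da_weight \<alpha> > 0"
  by (simp add: da_weight_def prod_pos)

lemma da_weight_nonneg: "da_weight \<alpha> \<ge> 0"
  using da_weight_pos[of \<alpha>] by simp

lemma da_summable_add:
  fixes c e :: "('d::finite \<Rightarrow> nat) \<Rightarrow> complex"
  assumes "(\<lambda>\<alpha>. da_weight \<alpha> * (norm (c \<alpha>))\<^sup>2) summable_on UNIV"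
    and "(\<lambda>\<alpha>. da_weight \<alpha> * (norm (e \<alpha>))\<^sup>2) summable_on UNIV"
  shows "(\<lambda>\<alpha>. da_weight \<alpha> * (norm (c \<alpha> + e \<alpha>))\<^sup>2) summable_on UNIV"
proof (rule summable_on_comparison_test)
  show "(\<lambda>\<alpha>. 2 * (da_weight \<alpha> * (norm (c \<alpha>))\<^sup>2 + da_weight \<alpha> * (norm (e \<alpha>))\<^sup>2)) summable_on UNIV"
    by (intro summable_on_cmult_right summable_on_add assms)
  fix \<alpha>
  have "(norm (c \<alpha> + e \<alpha>))\<^sup>2 \<le> (norm (c \<alpha>) + norm (e \<alpha>))\<^sup>2"
    by (intro power_mono norm_triangle_ineq) simp
  also have "\<dots> \<le> 2 * ((norm (c \<alpha>))\<^sup>2 + (norm (e \<alpha>))\<^sup>2)"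
    using sum_squares_bound[of "norm (c \<alpha>)" "norm (e \<alpha>)"] by (simp add: power2_sum)
  finally have "(norm (c \<alpha> + e \<alpha>))\<^sup>2 \<le> 2 * ((norm (c \<alpha>))\<^sup>2 + (norm (e \<alpha>))\<^sup>2)" .
  from mult_left_mono[OF this da_weight_nonneg[of \<alpha>]]
  show "da_weight \<alpha> * (norm (c \<alpha> + e \<alpha>))\<^sup>2
      \<le> 2 * (da_weight \<alpha> * (norm (c \<alpha>))\<^sup>2 + da_weight \<alpha> * (norm (e \<alpha>))\<^sup>2)"
    by (simp add: algebra_simps)
qed (simp add: da_weight_nonneg)

lemma da_summable_scale:
  fixes c :: "('d::finite \<Rightarrow> nat) \<Rightarrow> complex"
  assumes "(\<lambda>\<alpha>. da_weight \<alpha> * (norm (c \<alpha>))\<^sup>2) summable_on UNIV"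
  shows "(\<lambda>\<alpha>. da_weight \<alpha> * (norm (a * c \<alpha>))\<^sup>2) summable_on UNIV"
proof -
  have "da_weight \<alpha> * (norm (a * c \<alpha>))\<^sup>2 = (norm a)\<^sup>2 * (da_weight \<alpha> * (norm (c \<alpha>))\<^sup>2)" for \<alpha>
    by (simp add: norm_mult power_mult_distrib)
  then show ?thesis using summable_on_cmult_right[OF assms, of "(norm a)\<^sup>2"] by presburger
qed

lemma da_summable_product:
  fixes c e :: "('d::finite \<Rightarrow> nat) \<Rightarrow> complex"
  assumes "(\<lambda>\<alpha>. da_weight \<alpha> * (norm (c \<alpha>))\<^sup>2) summable_on UNIV"
    and "(\<lambda>\<alpha>. da_weight \<alpha> * (norm (e \<alpha>))\<^sup>2) summable_on UNIV"
  shows "(\<lambda>\<alpha>. complex_of_real (da_weight \<alpha>) * (c \<alpha> * cnj (e \<alpha>))) summable_on UNIV"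
proof (rule abs_summable_summable)
  have "norm (complex_of_real (da_weight \<alpha>) * (c \<alpha> * cnj (e \<alpha>)))
      \<le> da_weight \<alpha> * (norm (c \<alpha>))\<^sup>2 + da_weight \<alpha> * (norm (e \<alpha>))\<^sup>2" for \<alpha>
  proof -
    have "norm (c \<alpha>) * norm (e \<alpha>) \<le> (norm (c \<alpha>))\<^sup>2 + (norm (e \<alpha>))\<^sup>2"
      using sum_squares_bound[of "norm (c \<alpha>)" "norm (e \<alpha>)"]
        mult_nonneg_nonneg[OF norm_ge_zero[of "c \<alpha>"] norm_ge_zero[of "e \<alpha>"]] by linarith
    from mult_left_mono[OF this da_weight_nonneg[of \<alpha>]]
    show ?thesis by (simp add: norm_mult da_weight_nonneg algebra_simps)
  qed
  then show "(\<lambda>\<alpha>. norm (complex_of_real (da_weight \<alpha>) * (c \<alpha> * cnj (e \<alpha>)))) summable_on UNIV"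
    by (rule Infinite_Sum.abs_summable_on_comparison_test'[OF summable_on_add[OF assms]])
qed

instantiation drury_arveson :: (finite) real_vector
begin

lift_definition zero_drury_arveson :: "'a drury_arveson" is "\<lambda>_. 0"
  by simp

lift_definition plus_drury_arveson :: "'a drury_arveson \<Rightarrow> 'a drury_arveson \<Rightarrow> 'a drury_arveson"
  is "\<lambda>c e \<alpha>. c \<alpha> + e \<alpha>"
  by (rule da_summable_add)

lift_definition uminus_drury_arveson :: "'a drury_arveson \<Rightarrow> 'a drury_arveson"
  is "\<lambda>c \<alpha>. - c \<alpha>"
  by simp

lift_definition scaleR_drury_arveson :: "real \<Rightarrow> 'a drury_arveson \<Rightarrow> 'a drury_arveson"
  is "\<lambda>r c \<alpha>. complex_of_real r * c \<alpha>"
  by (rule da_summable_scale)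

definition minus_drury_arveson :: "'a drury_arveson \<Rightarrow> 'a drury_arveson \<Rightarrow> 'a drury_arveson" where
  "minus_drury_arveson f g = f + - g"

instance
proof
  fix f g h :: "'a drury_arveson" and r s :: real
  show "f + g + h = f + (g + h)" "f + g = g + f" "0 + f = f" "- f + f = 0"
    by (transfer; simp add: algebra_simps)+
  show "f - g = f + - g" by (simp add: minus_drury_arveson_def)
  show "r *\<^sub>R (f + g) = r *\<^sub>R f + r *\<^sub>R g" "(r + s) *\<^sub>R f = r *\<^sub>R f + s *\<^sub>R f"
    "r *\<^sub>R s *\<^sub>R f = (r * s) *\<^sub>R f" "1 *\<^sub>R f = f"
    by (transfer; simp add: algebra_simps)+
qed

end

lemma da_coeff_summable: "(\<lambda>\<alpha>. da_weight \<alpha> * (norm (da_coeff f \<alpha>))\<^sup>2) summable_on UNIV"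
  using da_coeff[of f] by simp

instantiation drury_arveson :: (finite) real_inner
begin

definition inner_drury_arveson :: "'a drury_arveson \<Rightarrow> 'a drury_arveson \<Rightarrow> real" where
  "inner_drury_arveson f g =
     Re (\<Sum>\<^sub>\<infinity>\<alpha>. complex_of_real (da_weight \<alpha>) * (da_coeff f \<alpha> * cnj (da_coeff g \<alpha>)))"

definition norm_drury_arveson :: "'a drury_arveson \<Rightarrow> real" where
  "norm_drury_arveson f = sqrt (inner f f)"

definition sgn_drury_arveson :: "'a drury_arveson \<Rightarrow> 'a drury_arveson" where
  "sgn_drury_arveson f = f /\<^sub>R norm f"

definition dist_drury_arveson :: "'a drury_arveson \<Rightarrow> 'a drury_arveson \<Rightarrow> real" where
  "dist_drury_arveson f g = norm (f - g)"

definition uniformity_drury_arveson :: "('a drury_arveson \<times> 'a drury_arveson) filter" where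
  "uniformity_drury_arveson = (INF e\<in>{0<..}. principal {(f, g). dist f g < e})"

definition open_drury_arveson :: "'a drury_arveson set \<Rightarrow> bool" where
  "open_drury_arveson U \<longleftrightarrow> (\<forall>f\<in>U. \<forall>\<^sub>F (f', g) in uniformity. f' = f \<longrightarrow> g \<in> U)"

lemma da_inner_self:
  "inner f f = (\<Sum>\<^sub>\<infinity>\<alpha>. da_weight \<alpha> * (norm (da_coeff f \<alpha>))\<^sup>2)" for f :: "'a drury_arveson"
proof -
  have eq: "complex_of_real (da_weight \<alpha>) * (da_coeff f \<alpha> * cnj (da_coeff f \<alpha>)) =
      complex_of_real (da_weight \<alpha> * (norm (da_coeff f \<alpha>))\<^sup>2)" for \<alpha>
    unfolding complex_norm_square[symmetric] by simp
  have "inner f f = (\<Sum>\<^sub>\<infinity>\<alpha>. Re (complex_of_real (da_weight \<alpha>) * (da_coeff f \<alpha> * cnj (da_coeff f \<alpha>))))"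
    unfolding inner_drury_arveson_def
    by (rule infsum_Re[symmetric]) (rule da_summable_product[OF da_coeff_summable da_coeff_summable])
  then show ?thesis by (simp only: eq Re_complex_of_real)
qed

instance
proof
  fix f g h :: "'a drury_arveson" and r :: real
  note summ = da_summable_product[OF da_coeff_summable da_coeff_summable]
  show "sgn f = f /\<^sub>R norm f" by (simp add: sgn_drury_arveson_def)
  show "dist f g = norm (f - g)" by (simp add: dist_drury_arveson_def)
  show "uniformity = (INF e\<in>{0<..}. principal {(f, g :: 'a drury_arveson). dist f g < e})"
    by (simp add: uniformity_drury_arveson_def)
  show "open U \<longleftrightarrow> (\<forall>f\<in>U. \<forall>\<^sub>F (f', g) in uniformity. f' = f \<longrightarrow> g \<in> U)"
    for U :: "'a drury_arveson set"
    by (simp add: open_drury_arveson_def)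
  show "norm f = sqrt (inner f f)" by (simp add: norm_drury_arveson_def)
  have "inner f g = Re (cnj (\<Sum>\<^sub>\<infinity>\<alpha>. complex_of_real (da_weight \<alpha>) * (da_coeff g \<alpha> * cnj (da_coeff f \<alpha>))))"
    unfolding inner_drury_arveson_def infsum_cnj[symmetric] by (simp add: mult.commute)
  then show "inner f g = inner g f" by (simp add: inner_drury_arveson_def)
  show "inner (f + g) h = inner f h + inner g h"
    unfolding inner_drury_arveson_def plus_drury_arveson.rep_eq
    by (simp add: distrib_left distrib_right infsum_add[OF summ summ])
  show "inner (r *\<^sub>R f) h = r * inner f h"
    unfolding inner_drury_arveson_def scaleR_drury_arveson.rep_eq
    by (simp add: mult.assoc mult.left_commute[of _ "complex_of_real r"] infsum_cmult_right')
  show "0 \<le> inner f f"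
    unfolding da_inner_self by (intro infsum_nonneg mult_nonneg_nonneg da_weight_nonneg) simp
  show "inner f f = 0 \<longleftrightarrow> f = 0"
  proof
    assume "inner f f = 0"
    then have "(\<Sum>\<^sub>\<infinity>\<alpha>. da_weight \<alpha> * (norm (da_coeff f \<alpha>))\<^sup>2) \<le> 0"
      by (simp only: da_inner_self order_refl)
    then have "da_weight \<alpha> * (norm (da_coeff f \<alpha>))\<^sup>2 = 0" for \<alpha>
      by (rule nonneg_infsum_le_0D[OF _ da_coeff_summable])
        (intro mult_nonneg_nonneg da_weight_nonneg zero_le_power2 UNIV_I)+
    then have "da_coeff f \<alpha> = 0" for \<alpha>
      using da_weight_pos[of \<alpha>] by (metis less_irrefl mult_eq_0_iff norm_eq_zero zero_eq_power2)
    then show "f = 0" by transfer auto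
  qed (simp add: da_inner_self zero_drury_arveson.rep_eq)
qed

end

lemma da_norm_sq: "(norm f)\<^sup>2 = (\<Sum>\<^sub>\<infinity>\<alpha>. da_weight \<alpha> * (norm (da_coeff f \<alpha>))\<^sup>2)"
  unfolding power2_norm_eq_inner da_inner_self ..

lemma da_coeff_diff: "da_coeff (f - g) \<alpha> = da_coeff f \<alpha> - da_coeff g \<alpha>"
  unfolding minus_drury_arveson_def plus_drury_arveson.rep_eq uminus_drury_arveson.rep_eq by simp

lemma da_finite_sum_le:
  "finite F \<Longrightarrow> (\<Sum>\<alpha>\<in>F. da_weight \<alpha> * (norm (da_coeff f \<alpha>))\<^sup>2) \<le> (norm f)\<^sup>2"
  unfolding da_norm_sq
  by (rule finite_sum_le_infsum[OF da_coeff_summable]) (auto simp: da_weight_nonneg)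

instance drury_arveson :: (finite) complete_space
proof
  fix X :: "nat \<Rightarrow> 'a drury_arveson"
  assume X: "Cauchy X"
  have le: "sqrt (da_weight \<alpha>) * norm (da_coeff f \<alpha>) \<le> norm f" for \<alpha> and f :: "'a drury_arveson"
  proof (rule power2_le_imp_le)
    have "(sqrt (da_weight \<alpha>) * norm (da_coeff f \<alpha>))\<^sup>2 = da_weight \<alpha> * (norm (da_coeff f \<alpha>))\<^sup>2"
      unfolding power_mult_distrib real_sqrt_pow2[OF da_weight_nonneg] ..
    also have "\<dots> = (\<Sum>\<beta>\<in>{\<alpha>}. da_weight \<beta> * (norm (da_coeff f \<beta>))\<^sup>2)"
      by simp
    also have "\<dots> \<le> (norm f)\<^sup>2"
      by (rule da_finite_sum_le) simp
    finally show "(sqrt (da_weight \<alpha>) * norm (da_coeff f \<alpha>))\<^sup>2 \<le> (norm f)\<^sup>2" .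
  qed (rule norm_ge_zero)
  have "Cauchy (\<lambda>n. da_coeff (X n) \<alpha>)" for \<alpha>
  proof (rule metric_CauchyI)
    fix e :: real assume "e > 0"
    then have "sqrt (da_weight \<alpha>) * e > 0" by (simp add: da_weight_pos)
    from metric_CauchyD[OF X this] obtain N where
      N: "\<And>m n. m \<ge> N \<Longrightarrow> n \<ge> N \<Longrightarrow> norm (X m - X n) < sqrt (da_weight \<alpha>) * e"
      unfolding dist_norm by blast
    have "norm (da_coeff (X m) \<alpha> - da_coeff (X n) \<alpha>) < e" if "m \<ge> N" "n \<ge> N" for m n
    proof -
      have "sqrt (da_weight \<alpha>) * norm (da_coeff (X m) \<alpha> - da_coeff (X n) \<alpha>) < sqrt (da_weight \<alpha>) * e"
        using le[of \<alpha> "X m - X n"] N[OF that] by (simp add: da_coeff_diff)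
      then show ?thesis by (simp add: da_weight_pos)
    qed
    then show "\<exists>N. \<forall>m\<ge>N. \<forall>n\<ge>N. dist (da_coeff (X m) \<alpha>) (da_coeff (X n) \<alpha>) < e"
      unfolding dist_norm by blast
  qed
  then have "\<forall>\<alpha>. \<exists>l. (\<lambda>n. da_coeff (X n) \<alpha>) \<longlonglongrightarrow> l"
    by (simp add: Cauchy_convergent_iff convergent_def)
  then obtain L where L: "\<And>\<alpha>. (\<lambda>n. da_coeff (X n) \<alpha>) \<longlonglongrightarrow> L \<alpha>" by metis
  have tail: "\<exists>N. \<forall>m\<ge>N. \<forall>F. finite F \<longrightarrow>
      (\<Sum>\<alpha>\<in>F. da_weight \<alpha> * (norm (da_coeff (X m) \<alpha> - L \<alpha>))\<^sup>2) \<le> e\<^sup>2" if "e > 0" for e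
  proof -
    from metric_CauchyD[OF X that] obtain N where
      N: "\<And>m n. m \<ge> N \<Longrightarrow> n \<ge> N \<Longrightarrow> norm (X m - X n) < e"
      unfolding dist_norm by blast
    have "(\<Sum>\<alpha>\<in>F. da_weight \<alpha> * (norm (da_coeff (X m) \<alpha> - L \<alpha>))\<^sup>2) \<le> e\<^sup>2"
      if "m \<ge> N" "finite F" for m F
    proof (rule LIMSEQ_le_const2)
      show "(\<lambda>n. \<Sum>\<alpha>\<in>F. da_weight \<alpha> * (norm (da_coeff (X m) \<alpha> - da_coeff (X n) \<alpha>))\<^sup>2)
          \<longlonglongrightarrow> (\<Sum>\<alpha>\<in>F. da_weight \<alpha> * (norm (da_coeff (X m) \<alpha> - L \<alpha>))\<^sup>2)"
        by (intro tendsto_intros L)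
      have "(\<Sum>\<alpha>\<in>F. da_weight \<alpha> * (norm (da_coeff (X m) \<alpha> - da_coeff (X n) \<alpha>))\<^sup>2) \<le> e\<^sup>2"
        if "n \<ge> N" for n
      proof -
        have "(norm (X m - X n))\<^sup>2 \<le> e\<^sup>2"
          using N[OF \<open>m \<ge> N\<close> that] by (intro power_mono) auto
        then show ?thesis
          using da_finite_sum_le[OF \<open>finite F\<close>, of "X m - X n"] by (simp add: da_coeff_diff)
      qed
      then show "\<exists>N. \<forall>n\<ge>N.
          (\<Sum>\<alpha>\<in>F. da_weight \<alpha> * (norm (da_coeff (X m) \<alpha> - da_coeff (X n) \<alpha>))\<^sup>2) \<le> e\<^sup>2"
        by blast
    qed
    then show ?thesis by blast
  qed
  have summ: "(\<lambda>\<alpha>. da_weight \<alpha> * (norm (da_coeff (X m) \<alpha> - L \<alpha>))\<^sup>2) summable_on UNIV"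
    if "\<And>F. finite F \<Longrightarrow> (\<Sum>\<alpha>\<in>F. da_weight \<alpha> * (norm (da_coeff (X m) \<alpha> - L \<alpha>))\<^sup>2) \<le> e\<^sup>2" for m e
  proof (rule nonneg_bdd_above_summable_on)
    show "bdd_above (sum (\<lambda>\<alpha>. da_weight \<alpha> * (norm (da_coeff (X m) \<alpha> - L \<alpha>))\<^sup>2) ` {F. F \<subseteq> UNIV \<and> finite F})"
      using that by (intro bdd_aboveI2) blast
  qed (simp add: da_weight_nonneg)
  from tail[OF zero_less_one] obtain m where
    "\<And>F. finite F \<Longrightarrow> (\<Sum>\<alpha>\<in>F. da_weight \<alpha> * (norm (da_coeff (X m) \<alpha> - L \<alpha>))\<^sup>2) \<le> 1\<^sup>2"
    by blast
  from da_summable_add[OF da_coeff_summable[of "X m"] da_summable_scale[OF summ[OF this], of "-1"]]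
  have "(\<lambda>\<alpha>. da_weight \<alpha> * (norm (L \<alpha>))\<^sup>2) summable_on UNIV" by simp
  then have coeff: "da_coeff (Abs_da L) = L" by (simp add: Abs_da_inverse)
  have "X \<longlonglongrightarrow> Abs_da L"
  proof (rule metric_LIMSEQ_I)
    fix e :: real assume "e > 0"
    from tail[OF half_gt_zero[OF this]] obtain N where N: "\<And>m F. m \<ge> N \<Longrightarrow> finite F \<Longrightarrow>
        (\<Sum>\<alpha>\<in>F. da_weight \<alpha> * (norm (da_coeff (X m) \<alpha> - L \<alpha>))\<^sup>2) \<le> (e / 2)\<^sup>2"
      by blast
    have "dist (X m) (Abs_da L) < e" if "m \<ge> N" for m
    proof -
      have "(norm (X m - Abs_da L))\<^sup>2 \<le> (e / 2)\<^sup>2"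
        unfolding da_norm_sq da_coeff_diff coeff
        by (rule infsum_le_finite_sums[OF summ]) (use N[OF that] in auto)
      then have "norm (X m - Abs_da L) \<le> e / 2"
        using \<open>e > 0\<close> by (simp add: power2_le_iff_abs_le)
      then show ?thesis using \<open>e > 0\<close> by (simp add: dist_norm)
    qed
    then show "\<exists>N. \<forall>m\<ge>N. dist (X m) (Abs_da L) < e" by blast
  qed
  then show "convergent X" by (auto simp: convergent_def)
qed

instantiation drury_arveson :: (finite) complex_hilbert
begin

lift_definition scaleC_drury_arveson :: "complex \<Rightarrow> 'a drury_arveson \<Rightarrow> 'a drury_arveson"
  is "\<lambda>a c \<alpha>. a * c \<alpha>"
  by (rule da_summable_scale)

definition cinner_drury_arveson :: "'a drury_arveson \<Rightarrow> 'a drury_arveson \<Rightarrow> complex" where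
  "cinner_drury_arveson f g =
     (\<Sum>\<^sub>\<infinity>\<alpha>. complex_of_real (da_weight \<alpha>) * (da_coeff f \<alpha> * cnj (da_coeff g \<alpha>)))"

instance
proof
  fix f g h :: "'a drury_arveson" and a b :: complex and r :: real
  note summ = da_summable_product[OF da_coeff_summable da_coeff_summable]
  show "a *\<^sub>C (f + g) = a *\<^sub>C f + a *\<^sub>C g" "(a + b) *\<^sub>C f = a *\<^sub>C f + b *\<^sub>C f"
    "a *\<^sub>C b *\<^sub>C f = (a * b) *\<^sub>C f" "1 *\<^sub>C f = f" "r *\<^sub>R f = complex_of_real r *\<^sub>C f"
    by (transfer; simp add: algebra_simps)+
  show "cinner f g = cnj (cinner g f)"
    unfolding cinner_drury_arveson_def infsum_cnj[symmetric] by (simp add: mult.commute)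
  show "cinner (f + g) h = cinner f h + cinner g h"
    unfolding cinner_drury_arveson_def plus_drury_arveson.rep_eq
    by (simp add: distrib_left distrib_right infsum_add[OF summ summ])
  show "cinner (a *\<^sub>C f) g = a * cinner f g"
    unfolding cinner_drury_arveson_def scaleC_drury_arveson.rep_eq
    by (simp add: mult.assoc mult.left_commute[of _ a] infsum_cmult_right')
  show "inner f g = Re (cinner f g)"
    by (simp add: inner_drury_arveson_def cinner_drury_arveson_def)
qed

end


section \<open>Multipliers and the functional calculus\<close>

text \<open>Multipliers are functions on the open unit ball, extensional (\<^const>\<open>undefined\<close>) outside.
  The description in \<open>mult_op\<close> is unique since a power series vanishing on the ball has zero
  coefficients.\<close>

definition multipliers :: "(complex^'d::finite \<Rightarrow> complex) set" where
  "multipliers = {\<phi> \<in> extensional (ball 0 1).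
     \<forall>f. \<exists>g. \<forall>z\<in>ball 0 1. da_eval g z = \<phi> z * da_eval f z}"

definition mult_op ::
    "(complex^'d::finite \<Rightarrow> complex) \<Rightarrow> 'd drury_arveson \<Rightarrow> 'd drury_arveson" where
  "mult_op \<phi> f = (THE g. \<forall>z\<in>ball 0 1. da_eval g z = \<phi> z * da_eval f z)"

definition coord :: "'d::finite \<Rightarrow> complex^'d \<Rightarrow> complex" where
  "coord k = (\<lambda>z\<in>ball 0 1. z $ k)"

definition mult_weak_star :: "(complex^'d::finite \<Rightarrow> complex) topology" where
  "mult_weak_star = pullback_topology multipliers mult_op (weak_star UNIV)"

definition is_calculus :: "'a::complex_hilbert set \<Rightarrow> ('d::finite \<Rightarrow> 'a \<Rightarrow> 'a) \<Rightarrow>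
    ((complex^'d \<Rightarrow> complex) \<Rightarrow> 'a \<Rightarrow> 'a) \<Rightarrow> bool" where
  "is_calculus S T \<Phi> \<longleftrightarrow>
     \<Phi> \<in> multipliers \<rightarrow>\<^sub>E bounded_ops S S \<and>
     \<Phi> (\<lambda>z\<in>ball 0 1. 1) = (\<lambda>x\<in>S. x) \<and>
     (\<forall>\<phi>\<in>multipliers. \<forall>\<psi>\<in>multipliers.
        \<Phi> (\<lambda>z\<in>ball 0 1. \<phi> z + \<psi> z) = (\<lambda>x\<in>S. \<Phi> \<phi> x + \<Phi> \<psi> x) \<and>
        \<Phi> (\<lambda>z\<in>ball 0 1. \<phi> z * \<psi> z) = compose S (\<Phi> \<phi>) (\<Phi> \<psi>)) \<and>
     (\<forall>c. \<forall>\<phi>\<in>multipliers. \<Phi> (\<lambda>z\<in>ball 0 1. c * \<phi> z) = (\<lambda>x\<in>S. c *\<^sub>C \<Phi> \<phi> x)) \<and>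
     (\<forall>n \<phi>. (\<forall>i<n. \<forall>j<n. \<phi> i j \<in> multipliers) \<longrightarrow>
        matrix_op_norm S n (\<lambda>i j. \<Phi> (\<phi> i j)) \<le> matrix_op_norm UNIV n (\<lambda>i j. mult_op (\<phi> i j))) \<and>
     continuous_map mult_weak_star (weak_star S) \<Phi> \<and>
     (\<forall>k. \<Phi> (coord k) = T k)"

text \<open>For a pure commuting row contraction \<open>T\<close> on \<open>S\<close>, \<open>calculus S T \<phi>\<close> is the operator usually
  written \<open>\<phi>(T)\<close>.\<close>

definition calculus :: "'a::complex_hilbert set \<Rightarrow> ('d::finite \<Rightarrow> 'a \<Rightarrow> 'a) \<Rightarrow>
    (complex^'d \<Rightarrow> complex) \<Rightarrow> 'a \<Rightarrow> 'a" where
  "calculus S T = (THE \<Phi>. is_calculus S T \<Phi>)"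

definition Ann\<^sub>c ::
    "'a::complex_hilbert set \<Rightarrow> ('d::finite \<Rightarrow> 'a \<Rightarrow> 'a) \<Rightarrow> (complex^'d \<Rightarrow> complex) set" where
  "Ann\<^sub>c S T = {\<phi> \<in> multipliers. calculus S T \<phi> = (\<lambda>x\<in>S. 0)}"


section \<open>Model spaces of weak-* closed ideals\<close>

text \<open>Closure under scalars is included, since constant functions are multipliers.\<close>

definition weak_star_closed_ideal :: "(complex^'d::finite \<Rightarrow> complex) set \<Rightarrow> bool" where
  "weak_star_closed_ideal J \<longleftrightarrow>
     (\<lambda>z\<in>ball 0 1. 0) \<in> J \<and>
     (\<forall>\<theta>\<in>J. \<forall>\<psi>\<in>J. (\<lambda>z\<in>ball 0 1. \<theta> z + \<psi> z) \<in> J) \<and>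
     (\<forall>\<phi>\<in>multipliers. \<forall>\<theta>\<in>J. (\<lambda>z\<in>ball 0 1. \<phi> z * \<theta> z) \<in> J) \<and>
     closedin mult_weak_star J"

definition ideal_space :: "(complex^'d::finite \<Rightarrow> complex) set \<Rightarrow> 'd drury_arveson set" where
  "ideal_space J = closure (cvec.span {mult_op \<theta> f | \<theta> f. \<theta> \<in> J})"

definition model_space :: "(complex^'d::finite \<Rightarrow> complex) set \<Rightarrow> 'd drury_arveson set" where
  "model_space J = orth (ideal_space J)"

definition model_tuple ::
    "(complex^'d::finite \<Rightarrow> complex) set \<Rightarrow> 'd \<Rightarrow> 'd drury_arveson \<Rightarrow> 'd drury_arveson" where
  "model_tuple J k = (\<lambda>f\<in>model_space J. orth_proj (model_space J) (mult_op (coord k) f))"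

definition model_tuple_adj ::
    "(complex^'d::finite \<Rightarrow> complex) set \<Rightarrow> 'd \<Rightarrow> 'd drury_arveson \<Rightarrow> 'd drury_arveson" where
  "model_tuple_adj J k = adj (model_space J) (model_tuple J k)"

end

theory Submission
  imports Defs "HOL-Combinatorics.Multiset_Permutations"
begin

text \<open>Let \<open>\<phi>*\<close> denote the multiplier whose Taylor coefficients are conjugate to those of \<open>\<phi>\<close>.
  The intertwining relation extends from polynomials to \<open>\<phi>(T) X f = X g\<close>, where \<open>g\<close> is the image of
  \<open>f\<close> under the adjoint of multiplication by \<open>\<phi>*\<close>. So the annihilator of \<open>T|M\<close> determines which
  multipliers lie in the orthogonal complement of \<open>X\<inverse>(M)\<close>. That complement is a closed subspace
  of the Drury--Arveson space invariant under the coordinate multiplications; in such a subspace the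
  multipliers are dense (McCullough--Trent), so the annihilator determines \<open>X\<inverse>(M)\<close> and \<open>M\<close>.

  Both the functional calculus and the density rest on the Poisson kernel of a pure commuting row
  contraction. Instead of taking the square root of the defect operator, the defect form is expanded
  into countably many rank one forms on the orbit of a countable set. This yields bounded maps
  \<open>K\<^sub>0, K\<^sub>1, \<dots>\<close> into the Drury--Arveson space which intertwine the adjoints of the \<open>T\<^sub>k\<close> with the
  backward shifts. Polynomials are weak-* dense in the multipliers by Fejer summation.\<close>

section \<open>Hilbert space\<close>

text \<open>The star in \<phi>* has its origin in adjoints: \<open>X\<close> intertwines the
  backward shifts with \<open>T\<close>, and a polynomial in the backward shifts is the adjoint of
  multiplication by the polynomial with conjugate coefficients. Injectivity of \<open>X\<close>
  turns \<phi>(T) X f = 0 into g = 0, and \<open>M\<close>, \<open>N\<close> are recovered as images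
  of their preimages because they lie in the range of \<open>X\<close>. The main obstacle is that
  the space of \<open>T\<close> may be nonseparable. A sequence of functionals then need not
  reproduce the defect form everywhere: the components K_i obey a Bessel inequality at all vectors,
  with equality guaranteed on a countable set chosen beforehand. Each identity of the calculus
  concerns finitely many vectors or one sequence, so a suitable family exists for each; the price is
  to show \<phi>(T) x independent of the family. Families exact at x agree on polynomials, and the
  Fejer sums carry this over to all multipliers. They also make the weak-* continuous calculus
  unique, which is needed for the \<open>THE\<close> in \<open>calculus\<close> to denote the
  operators constructed here.\<close>

lemma scaleC_zero_left [simp]: "0 *\<^sub>C (x::'a::complex_hilbert) = 0"
  by (rule cvec.scale_zero_left)

lemma scaleC_zero_right [simp]: "c *\<^sub>C (0::'a::complex_hilbert) = 0"
  by (rule cvec.scale_zero_right)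

lemma cinner_zero_left [simp]: "cinner 0 (x::'a::complex_hilbert) = 0"
  using cinner_scaleC_left[of 0 x x] by simp

lemma cinner_zero_right [simp]: "cinner (x::'a::complex_hilbert) 0 = 0"
  using cinner_commute[of x 0] by simp

lemma cinner_add_right: "cinner (x::'a::complex_hilbert) (y + z) = cinner x y + cinner x z"
  by (metis cinner_commute cinner_add_left complex_cnj_add)

lemma cinner_scaleC_right: "cinner (x::'a::complex_hilbert) (c *\<^sub>C y) = cnj c * cinner x y"
  by (metis cinner_commute cinner_scaleC_left complex_cnj_mult)

lemma scaleC_minus_one: "(- 1) *\<^sub>C (x::'a::complex_hilbert) = - x"
  using scaleR_scaleC[of "-1" x] by simp

lemma cinner_minus_left: "cinner (- x) (y::'a::complex_hilbert) = - cinner x y"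
  by (metis cinner_scaleC_left mult_minus1 scaleC_minus_one)

lemma cinner_minus_right: "cinner x (- y::'a::complex_hilbert) = - cinner x y"
  by (metis cinner_commute cinner_minus_left complex_cnj_minus)

lemma cinner_diff_left: "cinner (x - y) (z::'a::complex_hilbert) = cinner x z - cinner y z"
  using cinner_add_left[of x "- y" z] by (simp add: cinner_minus_left)

lemma cinner_diff_right: "cinner z (x - y::'a::complex_hilbert) = cinner z x - cinner z y"
  using cinner_add_right[of z x "- y"] by (simp add: cinner_minus_right)

lemma cinner_sum_left: "cinner (sum f A) (z::'a::complex_hilbert) = (\<Sum>i\<in>A. cinner (f i) z)"
  by (induction A rule: infinite_finite_induct) (simp_all add: cinner_add_left)

lemma cinner_sum_right: "cinner z (sum f A::'a::complex_hilbert) = (\<Sum>i\<in>A. cinner z (f i))"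
  by (induction A rule: infinite_finite_induct) (simp_all add: cinner_add_right)

lemma cinner_self: "cinner x (x::'a::complex_hilbert) = complex_of_real ((norm x)\<^sup>2)"
proof -
  have "Im (cinner x x) = 0"
    using cinner_commute[of x x] by (metis add.inverse_neutral complex_cnj eq_neg_iff_add_eq_0
        complex.sel(2) double_zero neg_equal_iff_equal complex_surj)
  then show ?thesis
    by (simp add: complex_eq_iff power2_norm_eq_inner inner_eq_Re_cinner)
qed

lemma cinner_self_eq_zero [simp]: "cinner x (x::'a::complex_hilbert) = 0 \<longleftrightarrow> x = 0"
  by (simp add: cinner_self)

lemma norm_scaleC: "norm (c *\<^sub>C (x::'a::complex_hilbert)) = cmod c * norm x"
proof -
  have "complex_of_real ((norm (c *\<^sub>C x))\<^sup>2) = complex_of_real ((cmod c * norm x)\<^sup>2)"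
    unfolding cinner_self[symmetric] cinner_scaleC_left cinner_scaleC_right power_mult_distrib
      of_real_mult complex_norm_square[of c] by (simp add: cinner_self mult.assoc[symmetric])
  then show ?thesis
    by (simp only: of_real_eq_iff) (simp add: power2_eq_iff_nonneg)
qed

lemma cinner_cauchy_schwarz: "cmod (cinner x (y::'a::complex_hilbert)) \<le> norm x * norm y"
proof -
  \<comment> \<open>A unimodular factor turning \<open>cinner x y\<close> into its modulus, so that
    the real Cauchy-Schwarz inequality applies.\<close>
  define c where "c = (if cinner x y = 0 then 1 else cnj (cinner x y) / cmod (cinner x y))"
  have c: "cmod c = 1" by (simp add: c_def norm_divide)
  have "c * cinner x y = cmod (cinner x y)"
    by (simp add: c_def mult.commute[of _ "cinner x y"] complex_norm_square[symmetric]
        power2_eq_square)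
  then have "cmod (cinner x y) = inner (c *\<^sub>C x) y"
    by (simp add: inner_eq_Re_cinner cinner_scaleC_left)
  also have "\<dots> \<le> norm (c *\<^sub>C x) * norm y" by (rule norm_cauchy_schwarz)
  finally show ?thesis by (simp add: norm_scaleC c)
qed

lemma cinner_eqI:
  fixes x y :: "'a::complex_hilbert"
  assumes "\<And>z. cinner x z = cinner y z"
  shows "x = y"
  using assms[of "x - y"] cinner_self_eq_zero[of "x - y"] by (simp add: cinner_diff_left)

lemma bounded_bilinear_cinner: "bounded_bilinear (cinner :: 'a::complex_hilbert \<Rightarrow> 'a \<Rightarrow> complex)"
  by (rule bounded_bilinear.intro)
    (auto simp: cinner_add_left cinner_add_right scaleR_scaleC cinner_scaleC_left
        cinner_scaleC_right
      scaleR_conv_of_real intro!: exI[of _ 1] cinner_cauchy_schwarz)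

lemmas bounded_linear_cinner_left = bounded_bilinear.bounded_linear_left[OF bounded_bilinear_cinner]
  and bounded_linear_cinner_right =
      bounded_bilinear.bounded_linear_right[OF bounded_bilinear_cinner]
  and tendsto_cinner = bounded_bilinear.tendsto[OF bounded_bilinear_cinner]

lemma bounded_linear_scaleC: "bounded_linear ((*\<^sub>C) c :: 'a::complex_hilbert \<Rightarrow> 'a)"
  by (rule bounded_linear_intro[where K="cmod c"])
    (simp_all add: scaleC_add_right scaleR_scaleC scaleC_scaleC norm_scaleC mult.commute)

text \<open>Total functions on whole types, so that facts about \<open>bounded_linear\<close> apply
  directly; on \<open>UNIV\<close> this is membership in \<open>bounded_ops\<close>.\<close>

definition cblinear :: "('a::complex_hilbert \<Rightarrow> 'b::complex_hilbert) \<Rightarrow> bool" where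
  "cblinear A \<longleftrightarrow> bounded_linear A \<and> (\<forall>c x. A (c *\<^sub>C x) = c *\<^sub>C A x)"

lemma cblinearI:
  assumes "\<And>x y. A (x + y) = A x + A y" "\<And>c x. A (c *\<^sub>C x) = c *\<^sub>C A x"
    "\<And>x. norm (A x) \<le> K * norm x"
  shows "cblinear A"
  unfolding cblinear_def using assms
  by (auto simp: scaleR_scaleC mult.commute intro!: bounded_linear_intro[where K=K])

lemma cblinear_add: "cblinear A \<Longrightarrow> A (x + y) = A x + A y"
  and cblinear_scaleC: "cblinear A \<Longrightarrow> A (c *\<^sub>C x) = c *\<^sub>C A x"
  and cblinear_bounded_linear: "cblinear A \<Longrightarrow> bounded_linear A"
  by (auto simp: cblinear_def linear_simps)

lemma cblinear_diff: "cblinear A \<Longrightarrow> A (x - y) = A x - A y"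
  and cblinear_zero: "cblinear A \<Longrightarrow> A 0 = 0"
  by (simp_all add: cblinear_def linear_simps)

lemma cblinear_sum: "cblinear A \<Longrightarrow> A (sum f I) = (\<Sum>i\<in>I. A (f i))"
  by (simp add: cblinear_def bounded_linear.linear linear_sum)

lemma cblinear_bound:
  assumes "cblinear A" obtains K where "K \<ge> 0" "\<And>x. norm (A x) \<le> K * norm x"
proof -
  from bounded_linear.nonneg_bounded[OF cblinear_bounded_linear[OF assms]]
  obtain K where "0 \<le> K" "\<forall>x. norm (A x) \<le> norm x * K" by blast
  then show thesis by (intro that[of K]) (auto simp: mult.commute)
qed

lemma cblinear_compose: "cblinear A \<Longrightarrow> cblinear B \<Longrightarrow> cblinear (\<lambda>x. A (B x))"
  by (auto simp: cblinear_def intro: bounded_linear_compose)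

lemma cblinear_id: "cblinear (\<lambda>x. x)"
  by (simp add: cblinear_def bounded_linear_ident)

lemma bounded_ops_UNIV_iff: "A \<in> bounded_ops UNIV UNIV \<longleftrightarrow> cblinear A"
proof
  assume "A \<in> bounded_ops UNIV UNIV"
  then show "cblinear A" unfolding bounded_ops_def by (auto intro: cblinearI)
next
  assume A: "cblinear A"
  obtain K where "\<And>x. norm (A x) \<le> K * norm x" using cblinear_bound[OF A] by metis
  then show "A \<in> bounded_ops UNIV UNIV"
    using A by (auto simp: bounded_ops_def cblinear_add cblinear_scaleC)
qed

section \<open>Orthogonal projections onto closed subspaces\<close>

lemma closed_subspace_projection:
  fixes S :: "'a::complex_hilbert set"
  assumes S: "cvec.subspace S" "closed S"
  obtains y where "y \<in> S" "\<And>s. s \<in> S \<Longrightarrow> cinner (x - y) s = 0"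
proof -
  have S0: "0 \<in> S" and Sadd: "\<And>u v. u \<in> S \<Longrightarrow> v \<in> S \<Longrightarrow> u + v \<in> S"
    and Ssc: "\<And>c u. u \<in> S \<Longrightarrow> c *\<^sub>C u \<in> S"
    using S(1) by (auto simp: cvec.subspace_def)
  have SscR: "r *\<^sub>R u \<in> S" if "u \<in> S" for r u using Ssc[OF that] by (simp add: scaleR_scaleC)
  define d where "d = infdist x S"
  have dle: "d \<le> norm (x - s)" if "s \<in> S" for s
    using infdist_le[OF that, of x] by (simp add: d_def dist_norm)
  have d0: "d \<ge> 0" by (simp add: d_def infdist_nonneg)
  have "\<exists>y\<in>S. norm (x - y) < d + e" if "e > 0" for e
  proof (rule ccontr)
    assume "\<not> (\<exists>y\<in>S. norm (x - y) < d + e)"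
    then have "d + e \<le> infdist x S"
      using S0 by (auto simp: infdist_def dist_norm not_less intro!: cINF_greatest)
    then show False using that by (simp add: d_def)
  qed
  then have "\<forall>n. \<exists>y\<in>S. norm (x - y) < d + 1 / Suc n" by simp
  then obtain y where yS: "\<And>n. y n \<in> S" and yd: "\<And>n. norm (x - y n) < d + 1 / Suc n" by metis
  \<comment> \<open>Parallelogram law; the midpoint of \<open>y m\<close> and \<open>y n\<close>
    lies in \<open>S\<close>, hence at distance at least \<open>d\<close> from
    \<open>x\<close>.\<close>
  have par: "(norm (y m - y n))\<^sup>2 \<le> 2 * (norm (x - y m))\<^sup>2 + 2 * (norm (x - y n))\<^sup>2 - 4 * d\<^sup>2"
    for m n
  proof -
    have "d \<le> norm (x - (1/2) *\<^sub>R (y m + y n))" by (intro dle SscR Sadd yS)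
    then have "d\<^sup>2 \<le> (norm (x - (1/2) *\<^sub>R (y m + y n)))\<^sup>2" using d0 by (intro power_mono)
    then show ?thesis
      by (simp add: power2_norm_eq_inner inner_diff_left inner_diff_right inner_add_left
          inner_add_right inner_commute algebra_simps)
  qed
  have lim: "(\<lambda>n. norm (x - y n)) \<longlonglongrightarrow> d"
  proof (rule tendsto_sandwich[OF _ _ tendsto_const])
    show "(\<lambda>n. d + 1 / Suc n) \<longlonglongrightarrow> d"
      using tendsto_add[OF tendsto_const[of d] LIMSEQ_inverse_real_of_nat]
      by (simp add: inverse_eq_divide)
  qed (use dle yS less_imp_le[OF yd] in auto)
  have "Cauchy y"
  proof (rule metric_CauchyI)
    fix e :: real assume e: "e > 0"
    have "(\<lambda>n. (norm (x - y n))\<^sup>2) \<longlonglongrightarrow> d\<^sup>2" by (intro tendsto_intros lim)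
    then have "\<forall>\<^sub>F n in sequentially. (norm (x - y n))\<^sup>2 < d\<^sup>2 + e\<^sup>2 / 4"
      using e by (intro order_tendstoD(2)[where y="d\<^sup>2"]) auto
    then obtain N where N: "\<And>n. n \<ge> N \<Longrightarrow> (norm (x - y n))\<^sup>2 < d\<^sup>2 + e\<^sup>2 / 4"
      by (auto simp: eventually_sequentially)
    have "dist (y m) (y n) < e" if "m \<ge> N" "n \<ge> N" for m n
    proof -
      have "(norm (y m - y n))\<^sup>2 < e\<^sup>2" using par[of m n] N[OF that(1)] N[OF that(2)] by linarith
      then show ?thesis using e by (simp add: dist_norm power2_less_imp_less)
    qed
    then show "\<exists>M. \<forall>m\<ge>M. \<forall>n\<ge>M. dist (y m) (y n) < e" by blast
  qed
  then obtain z where z: "y \<longlonglongrightarrow> z" by (auto simp: Cauchy_convergent_iff convergent_def)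
  have zS: "z \<in> S" using closed_sequentially[OF S(2) _ z] yS by blast
  have zd: "norm (x - z) = d"
    by (rule LIMSEQ_unique[OF _ lim]) (intro tendsto_intros z)
  have re: "Re (cinner (x - z) s) = 0" if s: "s \<in> S" for s
  proof -
    \<comment> \<open>The exact minimiser of the quadratic in t has \<open>inner s s\<close> as
      denominator. Adding 1 covers s = 0 and still forces t = 0.\<close>
    define t where "t = inner (x - z) s / (inner s s + 1)"
    have "d \<le> norm (x - (z + t *\<^sub>R s))" by (intro dle Sadd zS SscR s)
    then have "(norm (x - z))\<^sup>2 \<le> (norm (x - (z + t *\<^sub>R s)))\<^sup>2" using d0 zd
      by (intro power_mono) auto
    also have "\<dots> = (norm (x - z))\<^sup>2 - 2 * t * inner (x - z) s + t\<^sup>2 * inner s s"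
      unfolding power2_norm_eq_inner
      by (simp add: inner_diff_left inner_diff_right inner_add_left
          inner_add_right inner_commute algebra_simps power2_eq_square)
    finally have *: "2 * t * inner (x - z) s \<le> t\<^sup>2 * inner s s" by simp
    have p: "inner s s + 1 > 0" by (simp add: add_nonneg_pos)
    then have i: "inner (x - z) s = t * (inner s s + 1)" by (simp add: t_def)
    have "2 * t\<^sup>2 * (inner s s + 1) \<le> t\<^sup>2 * inner s s"
      using * unfolding i by (simp add: power2_eq_square algebra_simps)
    then have "t\<^sup>2 * (inner s s + 2) \<le> 0" by (simp add: algebra_simps)
    moreover have "inner s s + 2 > 0" by (simp add: add_nonneg_pos)
    ultimately have "t = 0" by (simp add: mult_le_0_iff)
    then show ?thesis using i by (simp add: inner_eq_Re_cinner)
  qed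
  \<comment> \<open>The real part at \<i> s is, up to sign, the imaginary part at s.\<close>
  have "cinner (x - z) s = 0" if s: "s \<in> S" for s
    using re[OF s] re[OF Ssc[OF s, of \<i>]] by (simp add: cinner_scaleC_right complex_eq_iff)
  with zS show thesis by (rule that)
qed

lemma orth_subspace: "cvec.subspace (orth S)"
  by (auto simp: cvec.subspace_def orth_def cinner_add_left cinner_scaleC_left)

lemma orth_closed: "closed (orth (S::'a::complex_hilbert set))"
proof -
  have "orth S = (\<Inter>y\<in>S. {x. cinner x y = 0})" by (auto simp: orth_def)
  then show ?thesis
    by (auto intro!: closed_INT closed_Collect_eq continuous_on_const
        linear_continuous_on bounded_linear_cinner_left)
qed

lemma orth_orth:
  fixes S :: "'a::complex_hilbert set"
  assumes S: "cvec.subspace S" "closed S"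
  shows "orth (orth S) = S"
proof
  show "S \<subseteq> orth (orth S)"
    unfolding orth_def by (auto, metis cinner_commute complex_cnj_zero)
  show "orth (orth S) \<subseteq> S"
  proof
    fix x assume x: "x \<in> orth (orth S)"
    obtain y where y: "y \<in> S" "\<And>s. s \<in> S \<Longrightarrow> cinner (x - y) s = 0"
      using closed_subspace_projection[OF S] by metis
    have "x - y \<in> orth S" using y by (simp add: orth_def)
    moreover have "cinner y (x - y) = 0" using y cinner_commute[of y "x - y"] by simp
    ultimately have "cinner (x - y) (x - y) = 0"
      using x by (simp add: orth_def cinner_diff_left[of x y "x - y"])
    then show "x \<in> S" using y by simp
  qed
qed

lemma orth_proj:
  fixes S :: "'a::complex_hilbert set"
  assumes S: "cvec.subspace S" "closed S"
  shows orth_proj_in: "orth_proj S x \<in> S"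
    and orth_proj_diff: "s \<in> S \<Longrightarrow> cinner (x - orth_proj S x) s = 0"
    and orth_proj_eqI: "y \<in> S \<Longrightarrow> (\<And>s. s \<in> S \<Longrightarrow> cinner (x - y) s = 0) \<Longrightarrow> orth_proj S x = y"
proof -
  have uniq: "y = y'" if "y \<in> S" "x - y \<in> orth S" "y' \<in> S" "x - y' \<in> orth S" for y y'
  proof -
    have "y' - y \<in> S" using that S by (simp add: cvec.subspace_diff)
    then have "cinner (x - y) (y' - y) = 0" "cinner (x - y') (y' - y) = 0"
      using that by (auto simp: orth_def)
    then have "cinner (y' - y) (y' - y) = 0" by (simp add: cinner_diff_left)
    then show ?thesis by simp
  qed
  obtain y where y: "y \<in> S" "x - y \<in> orth S"
    by (rule closed_subspace_projection[OF S, of x]) (simp add: orth_def)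
  then have eq: "orth_proj S x = y"
    unfolding orth_proj_def using uniq by (intro the_equality) auto
  then show "orth_proj S x \<in> S" "s \<in> S \<Longrightarrow> cinner (x - orth_proj S x) s = 0"
    using y by (auto simp: orth_def)
  show "orth_proj S x = y'" if "y' \<in> S" "\<And>s. s \<in> S \<Longrightarrow> cinner (x - y') s = 0" for y'
    using uniq[OF y, of y'] that eq by (auto simp: orth_def)
qed

lemma orth_proj_self:
  assumes "cvec.subspace S" "closed S" "x \<in> S" shows "orth_proj S x = x"
  using assms by (intro orth_proj_eqI) auto

lemma orth_proj_cinner:
  assumes "cvec.subspace S" "closed S"
  shows "cinner (orth_proj S x) (orth_proj S y) = cinner (orth_proj S x) y"
proof -
  have "cinner (y - orth_proj S y) (orth_proj S x) = 0"
    by (intro orth_proj_diff orth_proj_in assms)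
  then have "cinner (orth_proj S x) (y - orth_proj S y) = 0"
    using cinner_commute[of "orth_proj S x" "y - orth_proj S y"] by simp
  then show ?thesis by (simp add: cinner_diff_right)
qed

lemma norm_orth_proj_le:
  assumes S: "cvec.subspace S" "closed S" shows "norm (orth_proj S x) \<le> norm x"
proof -
  have "(norm (orth_proj S x))\<^sup>2 = cmod (cinner (orth_proj S x) x)"
    unfolding orth_proj_cinner[OF S, of x x, symmetric] cinner_self by (simp add: norm_power)
  also have "\<dots> \<le> norm (orth_proj S x) * norm x" by (rule cinner_cauchy_schwarz)
  finally show ?thesis
    by (cases "orth_proj S x = 0") (simp_all add: power2_eq_square)
qed

lemma cblinear_orth_proj:
  assumes S: "cvec.subspace S" "closed S" shows "cblinear (orth_proj S)"
proof (rule cblinearI)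
  note d = orth_proj_diff[OF S]
  show "orth_proj S (x + y) = orth_proj S x + orth_proj S y" for x y
  proof (rule orth_proj_eqI[OF S])
    show "orth_proj S x + orth_proj S y \<in> S"
      by (intro cvec.subspace_add S orth_proj_in)
    show "cinner (x + y - (orth_proj S x + orth_proj S y)) s = 0" if "s \<in> S" for s
      using d[OF that, of x] d[OF that, of y] by (simp add: cinner_diff_left cinner_add_left)
  qed
  show "orth_proj S (c *\<^sub>C x) = c *\<^sub>C orth_proj S x" for c x
  proof (rule orth_proj_eqI[OF S])
    show "c *\<^sub>C orth_proj S x \<in> S" by (intro cvec.subspace_scale S orth_proj_in)
    show "cinner (c *\<^sub>C x - c *\<^sub>C orth_proj S x) s = 0" if "s \<in> S" for s
      using d[OF that, of x] by (simp add: cinner_diff_left cinner_scaleC_left)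
  qed
  show "norm (orth_proj S x) \<le> 1 * norm x" for x using norm_orth_proj_le[OF S] by simp
qed

section \<open>Riesz representation and adjoints\<close>

lemma riesz_representation:
  fixes l :: "'a::complex_hilbert \<Rightarrow> complex"
  assumes add: "\<And>x y. l (x + y) = l x + l y" and sc: "\<And>c x. l (c *\<^sub>C x) = c * l x"
    and bd: "\<And>x. cmod (l x) \<le> K * norm x"
  obtains v where "\<And>x. l x = cinner x v"
proof (cases "\<forall>x. l x = 0")
  case True
  then show thesis using that[of 0] by simp
next
  case False
  then obtain u where u: "l u \<noteq> 0" by blast
  have bl: "bounded_linear l"
    using add sc bd by (intro bounded_linear_intro[where K=K])
      (auto simp: scaleR_scaleC scaleR_conv_of_real mult.commute)
  have l0: "l 0 = 0" using sc[of 0 0] by simp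
  have ker: "cvec.subspace {x. l x = 0}" "closed {x. l x = 0}"
    using add sc l0 bl by (auto simp: cvec.subspace_def
        intro!: closed_Collect_eq continuous_on_const linear_continuous_on)
  obtain w where w: "l w = 0" "\<And>s. l s = 0 \<Longrightarrow> cinner (u - w) s = 0"
    using closed_subspace_projection[OF ker, of u] by auto
  define y where "y = u - w"
  have ly: "l y = l u" using add[of y w] w by (simp add: y_def)
  then have "y \<noteq> 0" using u l0 by auto
  then have yy: "cinner y y \<noteq> 0" by simp
  have perp: "cinner s y = 0" if "l s = 0" for s
    using w(2)[OF that] cinner_commute[of s y] by (simp add: y_def)
  \<comment> \<open>Subtracting (l x / l y) y from x gives a vector of the kernel, orthogonal to y.
    The scalar is conjugated because \<open>cinner\<close> is antilinear in its second
    argument.\<close>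
  show thesis
  proof (rule that[of "cnj (l y / cinner y y) *\<^sub>C y"])
    fix x
    have "l (x + (- (l x / l y)) *\<^sub>C y) = 0" unfolding add sc using u ly by simp
    from perp[OF this] have "cinner x y = l x / l y * cinner y y"
      by (simp only: cinner_add_left cinner_scaleC_left) simp
    then show "l x = cinner x (cnj (l y / cinner y y) *\<^sub>C y)"
      using u ly yy by (simp add: cinner_scaleC_right)
  qed
qed

text \<open>The adjoint between two different types, as needed for the maps from the space of
  \<open>T\<close> to the Drury--Arveson space; \<open>adj\<close> has one type for domain and
  range.\<close>

definition hadj :: "('a::complex_hilbert \<Rightarrow> 'b::complex_hilbert) \<Rightarrow> 'b \<Rightarrow> 'a" where
  "hadj A y = (THE z. \<forall>x. cinner (A x) y = cinner x z)"

lemma hadj_eqI: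
  assumes "\<And>x. cinner (A x) y = cinner x z"
  shows "hadj A y = z"
  unfolding hadj_def
proof (rule the_equality)
  fix z' assume "\<forall>x. cinner (A x) y = cinner x z'"
  then have "cinner (z' - z) (z' - z) = 0" using assms by (simp add: cinner_diff_right)
  then show "z' = z" by simp
qed (use assms in blast)

lemma hadj_right:
  assumes A: "cblinear A" shows "cinner x (hadj A y) = cinner (A x) y"
proof -
  obtain K where K: "K \<ge> 0" "\<And>x. norm (A x) \<le> K * norm x" using cblinear_bound[OF A] by metis
  have "cmod (cinner (A x) y) \<le> (K * norm y) * norm x" for x
    using cinner_cauchy_schwarz[of "A x" y] mult_right_mono[OF K(2)[of x] norm_ge_zero[of y]]
    by (simp add: algebra_simps)
  then obtain v where v: "\<And>x. cinner (A x) y = cinner x v"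
    by (rule riesz_representation[where l="\<lambda>x. cinner (A x) y", rotated 2])
      (auto simp: cblinear_add[OF A] cblinear_scaleC[OF A] cinner_add_left cinner_scaleC_left)
  with hadj_eqI[OF v] show ?thesis by simp
qed

lemma hadj_left:
  assumes A: "cblinear A" shows "cinner (hadj A y) x = cinner y (A x)"
  using hadj_right[OF A, of x y] by (metis cinner_commute)

lemma norm_hadj_le:
  assumes A: "cblinear A" and K0: "K \<ge> 0" and K: "\<And>x. norm (A x) \<le> K * norm x"
  shows "norm (hadj A y) \<le> K * norm y"
proof (cases "hadj A y = 0")
  case True
  then show ?thesis using K0 by simp
next
  case False
  have "(norm (hadj A y))\<^sup>2 = cmod (cinner (A (hadj A y)) y)"
    unfolding hadj_right[OF A, symmetric] cinner_self by (simp add: norm_power)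
  also have "\<dots> \<le> (K * norm (hadj A y)) * norm y"
    using cinner_cauchy_schwarz[of "A (hadj A y)" y] K[of "hadj A y"]
    by (meson mult_right_mono norm_ge_zero order_trans)
  finally show ?thesis using False by (simp add: power2_eq_square algebra_simps)
qed

lemma cblinear_hadj:
  assumes A: "cblinear A" shows "cblinear (hadj A)"
proof -
  obtain K where K: "K \<ge> 0" "\<And>x. norm (A x) \<le> K * norm x" using cblinear_bound[OF A] by metis
  show ?thesis
    by (rule cblinearI[where K=K])
      (auto intro!: hadj_eqI norm_hadj_le[OF A K]
        simp: hadj_right[OF A] cinner_add_right cinner_scaleC_right)
qed

lemma hadj_hadj: "cblinear A \<Longrightarrow> hadj (hadj A) = A"
  by (intro ext hadj_eqI) (simp add: hadj_left)

lemma hadj_compose: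
  assumes "cblinear A" "cblinear B"
  shows "hadj (\<lambda>x. A (B x)) y = hadj B (hadj A y)"
  by (rule hadj_eqI) (simp add: assms hadj_right)

lemma adj_UNIV: "adj UNIV A = hadj A"
  by (simp add: adj_def hadj_def fun_eq_iff)

lemma uniform_boundedness:
  fixes F :: "('a::{real_normed_vector, complete_space} \<Rightarrow> complex) set"
  assumes bl: "\<And>l. l \<in> F \<Longrightarrow> bounded_linear l"
    and pt: "\<And>x. \<exists>K. \<forall>l\<in>F. cmod (l x) \<le> K"
  obtains C where "C \<ge> 0" "\<And>l x. l \<in> F \<Longrightarrow> cmod (l x) \<le> C * norm x"
proof -
  define V where "V n = {x. \<forall>l\<in>F. cmod (l x) \<le> real n}" for n :: nat
  have V: "closed (V n)" for n
  proof -
    have "V n = (\<Inter>l\<in>F. {x. cmod (l x) \<le> real n})" by (auto simp: V_def)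
    then show ?thesis
      by (simp only:) (intro closed_INT ballI closed_Collect_le continuous_on_const
          continuous_on_norm linear_continuous_on bl)
  qed
  have "\<Union>(range V) = UNIV"
  proof (rule set_eqI, simp)
    fix x obtain K where "\<forall>l\<in>F. cmod (l x) \<le> K" using pt by blast
    then show "\<exists>n. x \<in> V n" by (auto simp: V_def intro!: exI[of _ "nat \<lceil>K\<rceil>"])
      (meson order_trans real_nat_ceiling_ge)
  qed
  then have "\<not> (\<forall>n. interior (V n) = {})"
    using Baire_category_alt[of "euclidean :: 'a topology" "range V"] V
      completely_metrizable_space_euclidean
    by fastforce
  then obtain n x where "x \<in> interior (V n)" by blast
  then obtain r where r: "r > 0" "cball x r \<subseteq> V n" by (meson mem_interior_cball)
  \<comment> \<open>Both x and x + z lie in \<open>V n\<close> when z has norm r, so l z, the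
    difference of two values of modulus at most n, has modulus at most 2 n.\<close>
  show thesis
  proof (rule that[of "2 * n / r"])
    fix l y assume l: "l \<in> F"
    interpret l: bounded_linear l by (rule bl[OF l])
    show "cmod (l y) \<le> 2 * n / r * norm y"
    proof (cases "y = 0")
      case False
      define z where "z = (r / norm y) *\<^sub>R y"
      have "norm z = r" using r False by (simp add: z_def)
      then have "x + z \<in> V n" "x \<in> V n" using r by (auto simp: dist_norm)
      then have "cmod (l (x + z)) \<le> n" "cmod (l x) \<le> n" using l by (auto simp: V_def)
      then have "cmod (l z) \<le> 2 * n"
        using norm_triangle_ineq4[of "l (x + z)" "l x"] by (simp add: l.add)
      then show ?thesis using False r by (simp add: z_def l.scaleR field_simps)
    qed (simp add: l.zero)
  qed (use r in auto)
qed

section \<open>Words and multi-indices\<close>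

abbreviation deg :: "('d::finite \<Rightarrow> nat) \<Rightarrow> nat" where
  "deg \<alpha> \<equiv> sum \<alpha> UNIV"

definition counts :: "'d list \<Rightarrow> 'd \<Rightarrow> nat" where
  "counts w k = count_list w k"

definition inc :: "'d \<Rightarrow> ('d \<Rightarrow> nat) \<Rightarrow> 'd \<Rightarrow> nat" where
  "inc k \<alpha> = \<alpha>(k := Suc (\<alpha> k))"

lemma counts_Nil [simp]: "counts [] = (\<lambda>_. 0)"
  by (simp add: counts_def fun_eq_iff)

lemma counts_Cons [simp]: "counts (k # w) = inc k (counts w)"
  by (auto simp: counts_def inc_def fun_eq_iff)

lemma counts_eq_iff: "counts v = counts w \<longleftrightarrow> mset v = mset w"
  by (simp add: multiset_eq_iff counts_def fun_eq_iff count_mset)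

lemma deg_inc [simp]: "deg (inc k \<alpha>) = Suc (deg \<alpha>)"
proof -
  have "deg (inc k \<alpha>) = (\<Sum>i\<in>UNIV. \<alpha> i + (if i = k then 1 else 0))"
    by (rule sum.cong) (auto simp: inc_def)
  then show ?thesis by (simp add: sum.distrib)
qed

lemma deg_counts [simp]: "deg (counts w) = length w"
  by (induction w) auto

lemma finite_words [simp]: "finite {w::'d::finite list. length w = n}"
  using finite_lists_length_eq[of "UNIV :: 'd set" n] by simp

lemma words_of_counts:
  fixes \<alpha> :: "'d::finite \<Rightarrow> nat"
  shows "{w. counts w = \<alpha>} = permutations_of_multiset (Abs_multiset \<alpha>)"
proof -
  have c: "count (Abs_multiset \<alpha>) = \<alpha>" by (rule Abs_multiset_inverse) simp
  show ?thesis
    by (auto simp: permutations_of_multiset_def multiset_eq_iff c counts_def fun_eq_iff count_mset)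
qed

text \<open>The multinomial coefficient. The weights of the Drury--Arveson norm are its reciprocals,
  which is why that space is the symmetric part of the Fock space over words; sums over words and
  over multi-indices are exchanged through this identity.\<close>

lemma card_words_of_counts:
  fixes \<alpha> :: "'d::finite \<Rightarrow> nat"
  shows "real (card {w. counts w = \<alpha>}) = 1 / da_weight \<alpha>"
proof -
  have c: "count (Abs_multiset \<alpha>) = \<alpha>" by (rule Abs_multiset_inverse) simp
  have s: "size (Abs_multiset \<alpha>) = deg \<alpha>"
    unfolding size_multiset_overloaded_eq c
    by (rule sum.mono_neutral_left) (auto simp: not_in_iff c)
  have p: "(\<Prod>x\<in>set_mset (Abs_multiset \<alpha>). fact (\<alpha> x)) = (\<Prod>x\<in>UNIV. fact (\<alpha> x) :: nat)"
    by (rule prod.mono_neutral_left) (auto simp: not_in_iff c)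
  have "card {w. counts w = \<alpha>} * (\<Prod>x\<in>UNIV. fact (\<alpha> x)) = fact (deg \<alpha>)"
    using card_permutations_of_multiset_aux[of "Abs_multiset \<alpha>"]
    unfolding c s p words_of_counts .
  then have "real (card {w. counts w = \<alpha>} * (\<Prod>x\<in>UNIV. fact (\<alpha> x))) = real (fact (deg \<alpha>))"
    by (simp only:)
  then have "real (card {w. counts w = \<alpha>}) * (\<Prod>x\<in>UNIV. fact (\<alpha> x)) = fact (deg \<alpha>)"
    by (simp only: of_nat_mult of_nat_prod of_nat_fact)
  moreover have "(\<Prod>x\<in>UNIV. fact (\<alpha> x) :: real) \<noteq> 0" by simp
  ultimately show ?thesis by (simp add: da_weight_def field_simps)
qed

lemma ex_word_of_counts: "\<exists>w. counts w = (\<alpha> :: 'd::finite \<Rightarrow> nat)"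
proof (rule ccontr)
  assume "\<not> ?thesis"
  then have "real (card {w. counts w = \<alpha>}) = 0" by simp
  then show False using da_weight_pos[of \<alpha>] by (simp add: card_words_of_counts)
qed

lemma finite_deg [simp]: "finite {\<alpha> :: 'd::finite \<Rightarrow> nat. deg \<alpha> = n}"
proof (rule finite_subset)
  show "{\<alpha> :: 'd \<Rightarrow> nat. deg \<alpha> = n} \<subseteq> counts ` {w. length w = n}"
    using ex_word_of_counts deg_counts
      by (metis (mono_tags, lifting) image_eqI mem_Collect_eq subsetI)
qed simp

lemma sum_words_counts:
  fixes G :: "('d::finite \<Rightarrow> nat) \<Rightarrow> real"
  shows "(\<Sum>w | length w = n. G (counts w)) = (\<Sum>\<alpha> | deg \<alpha> = n. G \<alpha> / da_weight \<alpha>)"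
proof -
  have "(\<Sum>w | length w = n. G (counts w)) =
      (\<Sum>\<alpha> | deg \<alpha> = n. \<Sum>w | w \<in> {w. length w = n} \<and> counts w = \<alpha>. G (counts w))"
    by (rule sum.group[symmetric]) auto
  also have "\<dots> = (\<Sum>\<alpha> | deg \<alpha> = n. G \<alpha> / da_weight \<alpha>)"
  proof (rule sum.cong[OF refl])
    fix \<alpha> :: "'d \<Rightarrow> nat" assume "\<alpha> \<in> {\<alpha>. deg \<alpha> = n}"
    then have eq: "{w. w \<in> {w. length w = n} \<and> counts w = \<alpha>} = {w. counts w = \<alpha>}" by auto
    have "(\<Sum>w | counts w = \<alpha>. G (counts w)) = (\<Sum>w | counts w = \<alpha>. G \<alpha>)"
      by (rule sum.cong) auto
    then show "(\<Sum>w | w \<in> {w. length w = n} \<and> counts w = \<alpha>. G (counts w)) = G \<alpha> / da_weight \<alpha>"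
      unfolding eq by (simp add: card_words_of_counts)
  qed
  finally show ?thesis .
qed

lemma sum_words_Suc:
  fixes F :: "'d::finite list \<Rightarrow> 'b::comm_monoid_add"
  shows "(\<Sum>w | length w = Suc n. F w) = (\<Sum>k\<in>UNIV. \<Sum>w | length w = n. F (k # w))"
proof -
  have "(\<Sum>k\<in>UNIV. \<Sum>w | length w = n. F (k # w)) =
      (\<Sum>(k, w)\<in>UNIV \<times> {w. length w = n}. F (k # w))"
    by (rule sum.cartesian_product)
  also have "\<dots> = (\<Sum>w | length w = Suc n. F w)"
    by (rule sum.reindex_bij_witness[where j="\<lambda>(k, w). k # w" and i="\<lambda>w. (hd w, tl w)"])
      (auto simp: length_Suc_conv)
  finally show ?thesis ..
qed

lemma prod_list_counts:
  fixes h :: "'d::finite \<Rightarrow> 'b::comm_monoid_mult"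
  shows "(\<Prod>i\<leftarrow>w. h i) = (\<Prod>k\<in>UNIV. h k ^ counts w k)"
proof (induction w)
  case (Cons k w)
  have "(\<Prod>i\<in>UNIV. h i ^ counts (k # w) i) = (\<Prod>i\<in>UNIV. (if i =
      k then h k else 1) * h i ^ counts w i)"
    by (rule prod.cong) (auto simp: inc_def)
  then show ?case using Cons by (simp add: prod.distrib)
qed simp

lemma sum_words_prod_list:
  fixes h :: "'d::finite \<Rightarrow> 'b::comm_semiring_1"
  shows "(\<Sum>w | length w = n. \<Prod>i\<leftarrow>w. h i) = (\<Sum>k\<in>UNIV. h k) ^ n"
proof (induction n)
  case (Suc n)
  then show ?case
    by (simp add: sum_words_Suc sum_distrib_left[symmetric] sum_distrib_right)
qed simp

section \<open>Regrouping of unconditional sums\<close>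

lemma has_sum_fibers:
  fixes g :: "'x \<Rightarrow> 'b::banach" and \<nu> :: "'x \<Rightarrow> nat"
  assumes "(g has_sum S) UNIV"
  shows "(\<lambda>n. infsum g {x. \<nu> x = n}) sums S"
proof -
  let ?P = "SIGMA n:UNIV. {x. \<nu> x = n}"
  have "bij_betw snd ?P UNIV"
    by (rule bij_betwI[where g="\<lambda>x. (\<nu> x, x)"]) auto
  then have *: "((\<lambda>p. g (snd p)) has_sum S) ?P"
    using has_sum_reindex_bij_betw[of snd ?P UNIV g S] assms by simp
  then have s: "(\<lambda>(n, x). g x) summable_on ?P" and S: "infsum (\<lambda>(n, x). g x) ?P = S"
    by (auto simp: case_prod_unfold summable_on_def dest: infsumI)
  have "((\<lambda>n. infsum g {x. \<nu> x = n}) has_sum S) UNIV"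
    using has_sum_infsum[OF summable_on_Sigma_banach[OF s]] infsum_Sigma'_banach[OF s] S by simp
  then show ?thesis by (rule has_sum_imp_sums)
qed

lemma has_sum_deg:
  fixes g :: "('d::finite \<Rightarrow> nat) \<Rightarrow> 'b::banach"
  assumes "(g has_sum S) UNIV"
  shows "(\<lambda>n. \<Sum>\<alpha> | deg \<alpha> = n. g \<alpha>) sums S"
  using has_sum_fibers[OF assms, of "\<lambda>\<alpha>. deg \<alpha>"] by simp

text \<open>Converse of \<open>has_sum_deg\<close> for nonnegative terms: a finite set of indices
  has bounded degree, so its sum stays below the sum by degrees.\<close>

lemma has_sum_degI:
  fixes g :: "('d::finite \<Rightarrow> nat) \<Rightarrow> real"
  assumes g: "\<And>\<alpha>. g \<alpha> \<ge> 0" and S: "(\<lambda>n. \<Sum>\<alpha> | deg \<alpha> = n. g \<alpha>) sums S"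
  shows "(g has_sum S) UNIV"
proof -
  have "sum g F \<le> S" if F: "finite F" for F
  proof -
    define N where "N = Suc (Max (insert 0 (deg ` F)))"
    have N: "deg \<alpha> < N" if "\<alpha> \<in> F" for \<alpha>
      using that F by (simp add: N_def le_imp_less_Suc)
    have "sum g F \<le> sum g (\<Union>n<N. {\<alpha>. deg \<alpha> = n})"
      using N g by (intro sum_mono2) auto
    also have "\<dots> = (\<Sum>n<N. \<Sum>\<alpha> | deg \<alpha> = n. g \<alpha>)"
      by (intro sum.UNION_disjoint) auto
    also have "\<dots> \<le> (\<Sum>n. \<Sum>\<alpha> | deg \<alpha> = n. g \<alpha>)"
      by (rule sum_le_suminf) (use S g in \<open>auto simp: sums_iff sum_nonneg\<close>)
    also have "\<dots> = S" using S by (simp add: sums_iff)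
    finally show ?thesis .
  qed
  then have "bdd_above (sum g ` {F. F \<subseteq> UNIV \<and> finite F})" by (intro bdd_aboveI2) blast
  then have "g summable_on UNIV" using g by (intro nonneg_bdd_above_summable_on) auto
  then have *: "(g has_sum infsum g UNIV) UNIV" by simp
  with has_sum_deg[OF this] S show ?thesis using sums_unique2 by metis
qed


section \<open>Elements of the Drury--Arveson space\<close>

lemma da_eqI: "(\<And>\<alpha>. da_coeff f \<alpha> = da_coeff g \<alpha>) \<Longrightarrow> f = g"
  by (metis da_coeff_inject ext)

lemma da_coeff_Abs:
  "(\<lambda>\<alpha>. da_weight \<alpha> * (norm (c \<alpha>))\<^sup>2) summable_on UNIV \<Longrightarrow> da_coeff (Abs_da c) = c"
  by (simp add: Abs_da_inverse)

lemmas da_coeff_simps = zero_drury_arveson.rep_eq plus_drury_arveson.rep_eq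
  scaleC_drury_arveson.rep_eq da_coeff_diff

definition da_mono :: "('d::finite \<Rightarrow> nat) \<Rightarrow> 'd drury_arveson" where
  "da_mono \<alpha> = Abs_da (\<lambda>\<beta>. if \<beta> = \<alpha> then 1 else 0)"

lemma da_coeff_mono: "da_coeff (da_mono \<alpha>) \<beta> = (if \<beta> = \<alpha> then 1 else 0)"
proof -
  have "(\<lambda>\<beta>. da_weight \<beta> * (norm (if \<beta> = \<alpha> then 1 else 0 :: complex))\<^sup>2) summable_on UNIV"
    by (rule finite_nonzero_values_imp_summable_on) (rule finite_subset[of _ "{\<alpha>}"], auto)
  from da_coeff_Abs[OF this] show ?thesis by (simp add: da_mono_def)
qed

lemma cinner_da_mono: "cinner f (da_mono \<alpha>) = of_real (da_weight \<alpha>) * da_coeff f \<alpha>"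
proof -
  have "cinner f (da_mono \<alpha>) = (\<Sum>\<^sub>\<infinity>\<beta>\<in>{\<alpha>}. complex_of_real (da_weight \<beta>) * da_coeff f \<beta>)"
    unfolding cinner_drury_arveson_def
    by (rule infsum_cong_neutral) (auto simp: da_coeff_mono)
  then show ?thesis by simp
qed

text \<open>Coordinates in the symmetric Fock space. The weight is absorbed by
  \<open>cinner\<close>, so the squared norm is the unweighted sum of squares over all words, and
  the backward shift becomes the removal of the first letter.\<close>

definition da_hat :: "'d::finite drury_arveson \<Rightarrow> 'd list \<Rightarrow> complex" where
  "da_hat f w = cinner f (da_mono (counts w))"

lemma da_hat_coeff: "da_hat f w = of_real (da_weight (counts w)) * da_coeff f (counts w)"
  by (simp add: da_hat_def cinner_da_mono)

lemma da_hat_eqI: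
  fixes f g :: "'d::finite drury_arveson"
  assumes "\<And>w. da_hat f w = da_hat g w" shows "f = g"
proof (rule da_eqI)
  fix \<alpha> :: "'d \<Rightarrow> nat"
  obtain w where "counts w = \<alpha>" using ex_word_of_counts[of \<alpha>] ..
  with assms[of w] show "da_coeff f \<alpha> = da_coeff g \<alpha>"
    using da_weight_pos[of \<alpha>] by (simp add: da_hat_coeff)
qed

lemma da_hat_norm_sums: "(\<lambda>n. \<Sum>w | length w = n. (cmod (da_hat f w))\<^sup>2) sums (norm f)\<^sup>2"
proof -
  have "((\<lambda>\<alpha>. da_weight \<alpha> * (norm (da_coeff f \<alpha>))\<^sup>2) has_sum (norm f)\<^sup>2) UNIV"
    unfolding da_norm_sq by (rule has_sum_infsum[OF da_coeff_summable])
  from has_sum_deg[OF this]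
  have "(\<lambda>n. \<Sum>\<alpha> | deg \<alpha> = n. da_weight \<alpha> * (norm (da_coeff f \<alpha>))\<^sup>2) sums (norm f)\<^sup>2" .
  moreover have "(\<Sum>w | length w = n. (cmod (da_hat f w))\<^sup>2) =
      (\<Sum>\<alpha> | deg \<alpha> = n. da_weight \<alpha> * (norm (da_coeff f \<alpha>))\<^sup>2)" for n
  proof -
    have "(cmod (of_real (da_weight \<alpha>) * da_coeff f \<alpha>))\<^sup>2 / da_weight \<alpha> =
        da_weight \<alpha> * (norm (da_coeff f \<alpha>))\<^sup>2" for \<alpha>
      using da_weight_pos[of \<alpha>] by (simp add: norm_mult power_mult_distrib power2_eq_square)
    then show ?thesis
      using sum_words_counts[of "\<lambda>\<alpha>. (cmod (of_real (da_weight \<alpha>) * da_coeff f \<alpha>))\<^sup>2" n]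
      by (simp add: da_hat_coeff)
  qed
  ultimately show ?thesis by simp
qed

text \<open>The device that produces elements of the space: a square summable family on words that
  ignores the order of letters. The backward shifts and the components of the Poisson kernel are
  obtained from it.\<close>

lemma ex_da_hat:
  fixes a :: "'d::finite list \<Rightarrow> complex"
  assumes cont: "\<And>v w. counts v = counts w \<Longrightarrow> a v = a w"
    and sums: "(\<lambda>n. \<Sum>w | length w = n. (cmod (a w))\<^sup>2) sums S"
  obtains f where "\<And>w. da_hat f w = a w" "(norm f)\<^sup>2 = S"
proof -
  define b where "b \<alpha> = a (SOME w. counts w = \<alpha>)" for \<alpha>
  have b: "b (counts w) = a w" for w
    unfolding b_def by (rule cont) (metis (mono_tags) someI)
  define c where "c \<alpha> = b \<alpha> / of_real (da_weight \<alpha>)" for \<alpha>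
  have "(\<Sum>w | length w = n. (cmod (a w))\<^sup>2) = (\<Sum>\<alpha> | deg \<alpha> = n. da_weight \<alpha> * (norm (c \<alpha>))\<^sup>2)" for n
  proof -
    have "(cmod (b \<alpha>))\<^sup>2 / da_weight \<alpha> = da_weight \<alpha> * (norm (c \<alpha>))\<^sup>2" for \<alpha>
      using da_weight_pos[of \<alpha>] by (simp add: c_def norm_divide power_divide power2_eq_square)
    then show ?thesis using sum_words_counts[of "\<lambda>\<alpha>. (cmod (b \<alpha>))\<^sup>2" n] by (simp add: b)
  qed
  then have "((\<lambda>\<alpha>. da_weight \<alpha> * (norm (c \<alpha>))\<^sup>2) has_sum S) UNIV"
    using sums by (intro has_sum_degI) (auto simp: da_weight_nonneg)
  then have co: "da_coeff (Abs_da c) = c" by (intro da_coeff_Abs) (auto simp: summable_on_def)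
  have h: "da_hat (Abs_da c) w = a w" for w
    using da_weight_pos[of "counts w"] by (simp add: da_hat_coeff co c_def b)
  show thesis
  proof (rule that[OF h])
    show "(norm (Abs_da c))\<^sup>2 = S"
      using da_hat_norm_sums[of "Abs_da c"] sums sums_unique2 unfolding h by blast
  qed
qed

lift_definition da_part :: "('d::finite \<Rightarrow> nat) set \<Rightarrow> 'd drury_arveson \<Rightarrow> 'd drury_arveson"
  is "\<lambda>A c \<alpha>. if \<alpha> \<in> A then c \<alpha> else 0"
  by (erule summable_on_comparison_test) (auto simp: da_weight_nonneg)

lemma norm_da_part_le: "norm (da_part A f) \<le> norm f"
proof (rule power2_le_imp_le)
  show "(norm (da_part A f))\<^sup>2 \<le> (norm f)\<^sup>2"
    unfolding da_norm_sq
    by (rule infsum_mono[OF da_coeff_summable da_coeff_summable])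
      (simp add: da_part.rep_eq da_weight_nonneg)
qed simp

lemma da_part_da_part: "da_part A (da_part B f) = da_part (A \<inter> B) f"
  by (rule da_eqI) (simp add: da_part.rep_eq)

lemma da_part_UNIV [simp]: "da_part UNIV f = f"
  by (rule da_eqI) (simp add: da_part.rep_eq)

lemma cinner_da_part: "cinner (da_part A f) g = cinner f (da_part A g)"
  unfolding cinner_drury_arveson_def by (rule infsum_cong) (simp add: da_part.rep_eq)

section \<open>Evaluation at points of the ball\<close>

definition zpow :: "('d::finite \<Rightarrow> nat) \<Rightarrow> complex^'d \<Rightarrow> complex" where
  "zpow \<alpha> z = (\<Prod>i\<in>UNIV. (z $ i) ^ \<alpha> i)"

lemma zpow_inc: "zpow (inc k \<alpha>) z = z $ k * zpow \<alpha> z"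
proof -
  have "zpow (inc k \<alpha>) z = (\<Prod>i\<in>UNIV. (if i = k then z $ k else 1) * (z $ i) ^ \<alpha> i)"
    unfolding zpow_def by (rule prod.cong) (auto simp: inc_def)
  then show ?thesis by (simp add: prod.distrib zpow_def)
qed

text \<open>The reproducing kernel at z, which as a function of w is 1 / (1 - <w, z>).\<close>

definition da_kernel :: "complex^'d::finite \<Rightarrow> 'd drury_arveson" where
  "da_kernel z = Abs_da (\<lambda>\<alpha>. cnj (zpow \<alpha> z) / of_real (da_weight \<alpha>))"

lemma da_coeff_kernel:
  fixes z :: "complex^'d::finite"
  assumes "z \<in> ball 0 1"
  shows "da_coeff (da_kernel z) \<alpha> = cnj (zpow \<alpha> z) / of_real (da_weight \<alpha>)"
proof -
  have n: "(norm z)\<^sup>2 = (\<Sum>i\<in>UNIV. (cmod (z $ i))\<^sup>2)"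
    by (simp add: norm_vec_def L2_set_def sum_nonneg)
  have "(norm z)\<^sup>2 < 1" using assms by (simp add: power_less_one_iff abs_square_less_1)
  then have "(\<lambda>n. ((norm z)\<^sup>2) ^ n) sums (1 / (1 - (norm z)\<^sup>2))"
    by (intro geometric_sums) simp
  \<comment> \<open>Multinomial theorem: the n-th power of a finite sum is a sum over words of
    length n, regrouped by letter counts. The geometric series then gives the squared norm of the
    kernel.\<close>
  moreover have "((norm z)\<^sup>2) ^ n = (\<Sum>\<alpha> | deg \<alpha> = n. (cmod (zpow \<alpha> z))\<^sup>2 / da_weight \<alpha>)" for n
  proof -
    have "(\<Prod>k\<in>UNIV. ((cmod (z $ k))\<^sup>2) ^ \<alpha> k) = (cmod (zpow \<alpha> z))\<^sup>2" for \<alpha>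
      unfolding zpow_def prod_norm[symmetric] prod_power_distrib
      by (rule prod.cong[OF refl]) (metis norm_power power_mult mult.commute)
    then show ?thesis
      unfolding n sum_words_prod_list[symmetric] prod_list_counts sum_words_counts[symmetric]
        by simp
  qed
  ultimately have "((\<lambda>\<alpha>. (cmod (zpow \<alpha> z))\<^sup>2 / da_weight \<alpha>) has_sum (1 / (1 - (norm z)\<^sup>2))) UNIV"
    by (intro has_sum_degI) (auto simp: da_weight_nonneg)
  moreover have "(cmod (zpow \<alpha> z))\<^sup>2 / da_weight \<alpha> =
      da_weight \<alpha> * (cmod (cnj (zpow \<alpha> z) / of_real (da_weight \<alpha>)))\<^sup>2" for \<alpha>
    using da_weight_pos[of \<alpha>] by (simp add: norm_divide power_divide power2_eq_square)
  ultimately have "(\<lambda>\<alpha>. da_weight \<alpha> * (cmod (cnj (zpow \<alpha> z) / of_real (da_weight \<alpha>)))\<^sup>2)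
      summable_on UNIV" unfolding summable_on_def by auto
  from da_coeff_Abs[OF this] show ?thesis by (simp add: da_kernel_def)
qed

lemma
  fixes f :: "'d::finite drury_arveson"
  assumes z: "z \<in> ball 0 1"
  shows da_eval_kernel: "da_eval f z = cinner f (da_kernel z)"
    and da_eval_has_sum: "((\<lambda>\<alpha>. da_coeff f \<alpha> * zpow \<alpha> z) has_sum da_eval f z) UNIV"
proof -
  have eq: "complex_of_real (da_weight \<alpha>) * (da_coeff f \<alpha> * cnj (da_coeff (da_kernel z) \<alpha>)) =
      da_coeff f \<alpha> * zpow \<alpha> z" for \<alpha>
    using da_weight_pos[of \<alpha>] by (simp add: da_coeff_kernel[OF z])
  show "da_eval f z = cinner f (da_kernel z)"
    unfolding cinner_drury_arveson_def da_eval_def eq zpow_def ..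
  have "(\<lambda>\<alpha>. da_coeff f \<alpha> * zpow \<alpha> z) summable_on UNIV"
    using da_summable_product[OF da_coeff_summable[of f] da_coeff_summable[of "da_kernel z"]]
    unfolding eq .
  then show "((\<lambda>\<alpha>. da_coeff f \<alpha> * zpow \<alpha> z) has_sum da_eval f z) UNIV"
    unfolding da_eval_def zpow_def by (rule has_sum_infsum)
qed

lemma da_eval_linear:
  assumes "z \<in> ball 0 1"
  shows "da_eval (f + g) z = da_eval f z + da_eval g z" "da_eval (c *\<^sub>C f) z = c * da_eval f z"
    "da_eval (f - g) z = da_eval f z - da_eval g z"
  using assms by (simp_all add: da_eval_kernel cinner_add_left cinner_scaleC_left cinner_diff_left)

lemma da_eval_mono: "da_eval (da_mono \<alpha>) z = zpow \<alpha> z"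
proof -
  have "da_eval (da_mono \<alpha>) z = (\<Sum>\<^sub>\<infinity>\<beta>\<in>{\<alpha>}. zpow \<beta> z)"
    unfolding da_eval_def zpow_def by (rule infsum_cong_neutral) (auto simp: da_coeff_mono)
  then show ?thesis by simp
qed

text \<open>Turns a grading of the monomials into a power series in t. It is used for the total
  degree, with z' = t z, and for the exponent of one variable, with a single coordinate
  scaled.\<close>

lemma da_eval_part_sums:
  fixes f :: "'d::finite drury_arveson" and \<nu> :: "('d \<Rightarrow> nat) \<Rightarrow> nat"
  assumes z: "z \<in> ball 0 1" "z' \<in> ball 0 1"
    and m: "\<And>\<alpha>. zpow \<alpha> z' = t ^ \<nu> \<alpha> * zpow \<alpha> z"
  shows "(\<lambda>n. da_eval (da_part {\<alpha>. \<nu> \<alpha> = n} f) z * t ^ n) sums da_eval f z'"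
proof -
  have "infsum (\<lambda>\<alpha>. da_coeff f \<alpha> * zpow \<alpha> z') {\<alpha>. \<nu> \<alpha> = n} =
      da_eval (da_part {\<alpha>. \<nu> \<alpha> = n} f) z * t ^ n" for n
  proof -
    have "infsum (\<lambda>\<alpha>. da_coeff f \<alpha> * zpow \<alpha> z') {\<alpha>. \<nu> \<alpha> = n} =
        (\<Sum>\<^sub>\<infinity>\<alpha>. da_coeff (da_part {\<alpha>. \<nu> \<alpha> = n} f) \<alpha> * zpow \<alpha> z * t ^ n)"
      by (rule infsum_cong_neutral) (auto simp: da_part.rep_eq m)
    then show ?thesis by (simp add: infsum_cmult_left' da_eval_def zpow_def)
  qed
  with has_sum_fibers[OF da_eval_has_sum[OF z(2), of f], of \<nu>] show ?thesis by simp
qed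

section \<open>Identity theorem on the ball\<close>

lemma powser_coeff_zero:
  fixes a :: "nat \<Rightarrow> complex"
  assumes "\<And>t. cmod t < 1 \<Longrightarrow> (\<lambda>n. a n * t ^ n) sums 0"
  shows "a n = 0"
proof (induction n rule: less_induct)
  case (less n)
  have "((\<lambda>_. 0) \<longlongrightarrow> a (0 + n)) (at (0::complex))"
  proof (rule powser_limit_0_strong[where s=1 and a="\<lambda>m. a (m + n)"])
    fix t :: complex assume t: "t \<noteq> 0" "norm t < 1"
    have "(\<lambda>m. a (m + n) * t ^ (m + n)) sums (0 - (\<Sum>i<n. a i * t ^ i))"
      by (rule sums_iff_shift'[where f="\<lambda>n. a n * t ^ n", THEN iffD2]) (use assms t in simp)
    then have "(\<lambda>m. (a (m + n) * t ^ m) * t ^ n) sums (0 * t ^ n)"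
      using less by (simp add: power_add mult.assoc)
    then show "(\<lambda>m. a (m + n) * t ^ m) sums 0"
      using t(1) by (simp only: sums_mult2_iff[of "t ^ n"] power_not_zero not_False_eq_True)
  qed simp
  from LIM_const_eq[OF this] show ?case by simp
qed

text \<open>The variables are treated one at a time: scaling the k-th coordinate by t gives a power
  series in t whose coefficients are the slices of f with fixed exponent in that variable. After the
  last variable a single monomial is left.\<close>

lemma da_eval_eq_0D:
  fixes f :: "'d::finite drury_arveson"
  assumes f: "\<And>z. z \<in> ball 0 1 \<Longrightarrow> da_eval f z = 0"
  shows "f = 0"
proof -
  have slice: "da_eval (da_part {\<alpha>. \<alpha> k = j} g) z = 0"
    if g: "\<And>z. z \<in> ball 0 1 \<Longrightarrow> da_eval g z = 0" and z: "z \<in> ball 0 1"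
    for k j z and g :: "'d drury_arveson"
  proof (rule powser_coeff_zero[where a="\<lambda>j. da_eval (da_part {\<alpha>. \<alpha> k = j} g) z"])
    fix t :: complex assume t: "cmod t < 1"
    define z' where "z' = (\<chi> i. if i = k then t * z $ i else z $ i)"
    have "norm z' \<le> norm z"
      unfolding norm_vec_def using t
      by (intro L2_set_mono) (auto simp: z'_def norm_mult intro: mult_left_le_one_le)
    then have z': "z' \<in> ball 0 1" using z by simp
    have "zpow \<alpha> z' = t ^ \<alpha> k * zpow \<alpha> z" for \<alpha>
    proof -
      have "zpow \<alpha> z' = (\<Prod>i\<in>UNIV. (if i = k then t ^ \<alpha> k else 1) * (z $ i) ^ \<alpha> i)"
        unfolding zpow_def by (rule prod.cong) (auto simp: z'_def power_mult_distrib)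
      then show ?thesis by (simp add: prod.distrib zpow_def)
    qed
    from da_eval_part_sums[OF z z' this, of g] g[OF z']
    show "(\<lambda>n. da_eval (da_part {\<alpha>. \<alpha> k = n} g) z * t ^ n) sums 0" by simp
  qed
  have slices: "\<forall>z\<in>ball 0 1. da_eval (da_part {\<alpha>. \<forall>k\<in>K. \<alpha> k = \<beta> k} f) z = 0" for K \<beta>
  proof (induction K rule: finite_induct[OF finite])
    case 1 then show ?case using f by simp
  next
    case (2 k K)
    have "da_part {\<alpha>. \<forall>k\<in>insert k K. \<alpha> k = \<beta> k} f =
        da_part {\<alpha>. \<alpha> k = \<beta> k} (da_part {\<alpha>. \<forall>k\<in>K. \<alpha> k = \<beta> k} f)"
      unfolding da_part_da_part by (rule arg_cong[where f="\<lambda>A. da_part A f"]) auto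
    then show ?case using slice 2 by auto
  qed
  show ?thesis
  proof (rule da_eqI)
    fix \<beta> :: "'d \<Rightarrow> nat"
    \<comment> \<open>A point of norm 1/2 is built from this vector; all its coordinates are
      nonzero, so no monomial vanishes there.\<close>
    define v :: "complex^'d" where "v = (\<chi> i. 1)"
    define z where "z = (1 / (2 * norm v)) *\<^sub>R v"
    have v: "v \<noteq> 0" by (simp add: v_def vec_eq_iff)
    have z: "z \<in> ball 0 1" using v by (simp add: z_def)
    have "{\<alpha>. \<forall>k\<in>UNIV. \<alpha> k = \<beta> k} = {\<beta>}" by auto
    moreover have "da_part {\<beta>} f = da_coeff f \<beta> *\<^sub>C da_mono \<beta>"
      by (rule da_eqI) (auto simp: da_part.rep_eq da_coeff_simps da_coeff_mono)
    ultimately have "da_eval (da_coeff f \<beta> *\<^sub>C da_mono \<beta>) z = 0"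
      using slices[of UNIV \<beta>] z by auto
    then have "da_coeff f \<beta> * zpow \<beta> z = 0"
      using z by (simp only: da_eval_linear da_eval_mono)
    moreover have "zpow \<beta> z \<noteq> 0" using v by (auto simp: zpow_def z_def v_def)
    ultimately show "da_coeff f \<beta> = da_coeff 0 \<beta>" by (simp add: da_coeff_simps)
  qed
qed

lemma da_eval_eqI:
  assumes "\<And>z. z \<in> ball 0 1 \<Longrightarrow> da_eval f z = da_eval g z"
  shows "f = g"
  using da_eval_eq_0D[of "f - g"] assms by (simp add: da_eval_linear)

section \<open>Multipliers\<close>

lemma closure_cvec_subspace:
  fixes S :: "'a::complex_hilbert set"
  assumes S: "cvec.subspace S" shows "cvec.subspace (closure S)"
  unfolding cvec.subspace_def
proof (intro conjI ballI allI)
  show "0 \<in> closure S" using S closure_subset by (auto simp: cvec.subspace_def)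
next
  fix x y assume "x \<in> closure S" "y \<in> closure S"
  then obtain a b where "\<forall>n. a n \<in> S" "a \<longlonglongrightarrow> x" "\<forall>n. b n \<in> S" "b \<longlonglongrightarrow> y"
    by (auto simp: closure_sequential)
  then show "x + y \<in> closure S"
    using S unfolding closure_sequential cvec.subspace_def
    by (intro exI[of _ "\<lambda>n. a n + b n"]) (auto intro: tendsto_add)
next
  fix c x assume "x \<in> closure S"
  then obtain a where "\<forall>n. a n \<in> S" "a \<longlonglongrightarrow> x"
    by (auto simp: closure_sequential)
  then show "c *\<^sub>C x \<in> closure S"
    using S unfolding closure_sequential cvec.subspace_def
    by (intro exI[of _ "\<lambda>n. c *\<^sub>C a n"])
      (auto intro: bounded_linear.tendsto[OF bounded_linear_scaleC])
qed

lemma cvec_subspace_dense: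
  fixes S :: "'a::complex_hilbert set"
  assumes S: "cvec.subspace S" and d: "\<And>x. (\<And>y. y \<in> S \<Longrightarrow> cinner x y = 0) \<Longrightarrow> x = 0"
  shows "closure S = UNIV"
proof -
  have "orth (closure S) = {0}"
  proof -
    have "x = 0" if "x \<in> orth (closure S)" for x
      using that closure_subset[of S] by (intro d) (auto simp: orth_def)
    then show ?thesis by (auto simp: orth_def)
  qed
  then have "orth (orth (closure S)) = UNIV" by (simp add: orth_def)
  then show ?thesis using orth_orth[OF closure_cvec_subspace[OF S]] by simp
qed

lemma mult_op_eqI:
  assumes "\<And>z. z \<in> ball 0 1 \<Longrightarrow> da_eval g z = \<phi> z * da_eval f z"
  shows "mult_op \<phi> f = g"
  unfolding mult_op_def using assms by (intro the_equality ballI da_eval_eqI) auto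

lemma da_eval_mult_op:
  assumes "\<phi> \<in> multipliers" "z \<in> ball 0 1"
  shows "da_eval (mult_op \<phi> f) z = \<phi> z * da_eval f z"
proof -
  obtain g where g: "\<forall>z\<in>ball 0 1. da_eval g z = \<phi> z * da_eval f z"
    using assms(1) unfolding multipliers_def by blast
  then have "mult_op \<phi> f = g" by (intro mult_op_eqI) auto
  then show ?thesis using g assms(2) by simp
qed

lemma cinner_mult_op_kernel:
  assumes "\<phi> \<in> multipliers" "z \<in> ball 0 1"
  shows "cinner (mult_op \<phi> f) (da_kernel z) = \<phi> z * cinner f (da_kernel z)"
  using da_eval_mult_op[OF assms] assms(2) by (simp add: da_eval_kernel)

text \<open>The functional \<open>f \<mapsto> \<langle>\<phi> f, g\<rangle>\<close> is continuous when \<open>g\<close> is a combination of kernel functions, and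
  such \<open>g\<close> are dense; hence the uniform boundedness principle applies.\<close>

lemma cblinear_mult_op:
  fixes \<phi> :: "complex^'d::finite \<Rightarrow> complex"
  assumes \<phi>: "\<phi> \<in> multipliers" shows "cblinear (mult_op \<phi>)"
proof -
  have add: "mult_op \<phi> (f + g) = mult_op \<phi> f + mult_op \<phi> g"
    and scale: "mult_op \<phi> (c *\<^sub>C f) = c *\<^sub>C mult_op \<phi> f" for f g c
    by (rule mult_op_eqI; simp add: da_eval_linear da_eval_mult_op[OF \<phi>] algebra_simps)+
  define D where "D = {g. bounded_linear (\<lambda>f. cinner (mult_op \<phi> f) g)}"
  have D: "cvec.subspace D"
    unfolding cvec.subspace_def D_def
    by (auto simp: cinner_add_right cinner_scaleC_right
        intro: bounded_linear_add bounded_linear_const_mult bounded_linear_zero)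
  have "da_kernel z \<in> D" if "z \<in> ball 0 1" for z
    by (simp add: D_def cinner_mult_op_kernel[OF \<phi> that] bounded_linear_const_mult
        bounded_linear_cinner_left)
  then have dense: "closure D = UNIV"
    by (intro cvec_subspace_dense[OF D] da_eval_eq_0D) (auto simp: da_eval_kernel)
  define F where "F = (\<lambda>g f. cinner (mult_op \<phi> f) g) ` {g \<in> D. norm g \<le> 1}"
  have Fbl: "bounded_linear l" if "l \<in> F" for l using that by (auto simp: F_def D_def)
  have Fpt: "\<exists>K. \<forall>l\<in>F. cmod (l f) \<le> K" for f
  proof (intro exI[of _ "norm (mult_op \<phi> f)"] ballI)
    fix l assume "l \<in> F"
    then obtain g where g: "norm g \<le> 1" "l f = cinner (mult_op \<phi> f) g" by (auto simp: F_def)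
    have "cmod (l f) \<le> norm (mult_op \<phi> f) * norm g" unfolding g by (rule cinner_cauchy_schwarz)
    also have "\<dots> \<le> norm (mult_op \<phi> f)" using g(1) by (simp add: mult_left_le)
    finally show "cmod (l f) \<le> norm (mult_op \<phi> f)" .
  qed
  from uniform_boundedness[of F, OF Fbl Fpt] obtain C
    where C: "C \<ge> 0" "\<And>l f. l \<in> F \<Longrightarrow> cmod (l f) \<le> C * norm f" by blast
  have CD: "cmod (cinner (mult_op \<phi> f) g) \<le> C * norm f * norm g" if "g \<in> D" for f g
  proof (cases "g = 0")
    case False
    define h where "h = (1 / complex_of_real (norm g)) *\<^sub>C g"
    have "h \<in> D" using D that by (simp add: h_def cvec.subspace_def)
    moreover have "norm h \<le> 1" using False by (simp add: h_def norm_scaleC norm_divide)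
    ultimately have "cmod (cinner (mult_op \<phi> f) h) \<le> C * norm f"
      by (intro C(2)[of "\<lambda>f. cinner (mult_op \<phi> f) h"]) (auto simp: F_def)
    then show ?thesis using False
      by (simp add: h_def cinner_scaleC_right norm_mult norm_divide field_simps)
  qed simp
  \<comment> \<open>By density the bound on \<open>D\<close> may be tested against
    \<open>mult_op \<phi> f\<close> itself, which gives the operator bound.\<close>
  have "norm (mult_op \<phi> f) \<le> C * norm f" for f
  proof -
    have "mult_op \<phi> f \<in> closure D" using dense by simp
    then obtain g where g: "\<And>n. g n \<in> D" "g \<longlonglongrightarrow> mult_op \<phi> f" by (auto simp: closure_sequential)
    have "(\<lambda>n. cmod (cinner (mult_op \<phi> f) (g n))) \<longlonglongrightarrow> cmod (cinner (mult_op \<phi> f) (mult_op \<phi> f))"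
      by (intro tendsto_norm bounded_linear.tendsto[OF bounded_linear_cinner_right] g)
    moreover have "(\<lambda>n. C * norm f * norm (g n)) \<longlonglongrightarrow> C * norm f * norm (mult_op \<phi> f)"
      by (intro tendsto_intros g)
    ultimately have "cmod (cinner (mult_op \<phi> f) (mult_op \<phi> f)) \<le> C * norm f * norm (mult_op \<phi> f)"
      by (rule LIMSEQ_le) (use CD[OF g(1)] in auto)
    then show ?thesis
      using C(1) by (cases "mult_op \<phi> f = 0") (auto simp: cinner_self norm_mult power2_eq_square)
  qed
  then show ?thesis by (intro cblinearI add scale)
qed

lemma multipliersI:
  assumes "\<phi> \<in> extensional (ball 0 1)"
    and "\<And>f z. z \<in> ball 0 1 \<Longrightarrow> da_eval (A f) z = \<phi> z * da_eval f z"
  shows "\<phi> \<in> multipliers" "mult_op \<phi> f = A f"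
  using assms by (auto simp: multipliers_def intro!: mult_op_eqI exI[of _ "A _"])

lemma
  shows const_multiplier: "(\<lambda>z\<in>ball 0 1. c) \<in> multipliers"
    and mult_op_const: "mult_op (\<lambda>z\<in>ball 0 1. c) f = c *\<^sub>C f"
  by (rule multipliersI[where A="(*\<^sub>C) c"]; simp add: da_eval_linear)+

lemma
  assumes "\<phi> \<in> multipliers" "\<psi> \<in> multipliers"
  shows add_multiplier: "(\<lambda>z\<in>ball 0 1. \<phi> z + \<psi> z) \<in> multipliers"
    and mult_op_add: "mult_op (\<lambda>z\<in>ball 0 1. \<phi> z + \<psi> z) f = mult_op \<phi> f + mult_op \<psi> f"
  by (rule multipliersI[where A="\<lambda>f. mult_op \<phi> f + mult_op \<psi> f"];
      simp add: da_eval_linear da_eval_mult_op assms algebra_simps)+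

lemma
  assumes "\<phi> \<in> multipliers" "\<psi> \<in> multipliers"
  shows times_multiplier: "(\<lambda>z\<in>ball 0 1. \<phi> z * \<psi> z) \<in> multipliers"
    and mult_op_times: "mult_op (\<lambda>z\<in>ball 0 1. \<phi> z * \<psi> z) f = mult_op \<phi> (mult_op \<psi> f)"
  by (rule multipliersI[where A="\<lambda>f. mult_op \<phi> (mult_op \<psi> f)"];
      simp add: da_eval_mult_op assms)+

lemma
  assumes "\<phi> \<in> multipliers"
  shows scale_multiplier: "(\<lambda>z\<in>ball 0 1. c * \<phi> z) \<in> multipliers"
    and mult_op_scale: "mult_op (\<lambda>z\<in>ball 0 1. c * \<phi> z) f = c *\<^sub>C mult_op \<phi> f"
  by (rule multipliersI[where A="\<lambda>f. c *\<^sub>C mult_op \<phi> f"];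
      simp add: da_eval_mult_op da_eval_linear assms)+

lemma mult_op_commute:
  assumes "\<phi> \<in> multipliers" "\<psi> \<in> multipliers"
  shows "mult_op \<phi> (mult_op \<psi> f) = mult_op \<psi> (mult_op \<phi> f)"
  by (rule mult_op_eqI) (simp add: da_eval_mult_op assms)

lemma mult_op_bound:
  assumes "\<phi> \<in> multipliers"
  obtains C where "C \<ge> 0" "\<And>f. norm (mult_op \<phi> f) \<le> C * norm f"
  using cblinear_bound[OF cblinear_mult_op[OF assms]] by metis

lemma hadj_mult_op_const: "hadj (mult_op (\<lambda>z\<in>ball 0 1. c)) f = cnj c *\<^sub>C f"
  by (rule hadj_eqI) (simp add: mult_op_const cinner_scaleC_left cinner_scaleC_right)

lemma hadj_mult_op_add:
  assumes m: "\<phi> \<in> multipliers" "\<psi> \<in> multipliers"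
  shows "hadj (mult_op (\<lambda>z\<in>ball 0 1. \<phi> z + \<psi> z)) f = hadj (mult_op \<phi>) f + hadj (mult_op \<psi>) f"
  by (rule hadj_eqI)
    (simp add: mult_op_add[OF m] cinner_add_left cinner_add_right hadj_right cblinear_mult_op m)

text \<open>Taking adjoints reverses products, but multiplications commute, so the order can be kept
  as it stands; inductions over polynomials then match the order of composition in the
  calculus.\<close>

lemma hadj_mult_op_times:
  assumes m: "\<phi> \<in> multipliers" "\<psi> \<in> multipliers"
  shows "hadj (mult_op (\<lambda>z\<in>ball 0 1. \<phi> z * \<psi> z)) f = hadj (mult_op \<phi>) (hadj (mult_op \<psi>) f)"
  by (rule hadj_eqI)
    (simp add: mult_op_times[OF m] mult_op_commute[OF m] hadj_right cblinear_mult_op m)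

section \<open>Backward shifts\<close>

primrec back_word :: "('d \<Rightarrow> 'a \<Rightarrow> 'a) \<Rightarrow> 'd list \<Rightarrow> 'a \<Rightarrow> 'a" where
  "back_word B [] x = x"
| "back_word B (k # w) x = back_word B w (B k x)"

text \<open>The squared norm of the homogeneous part of degree n, computed over words.\<close>

definition level :: "nat \<Rightarrow> 'd::finite drury_arveson \<Rightarrow> real" where
  "level n f = (\<Sum>w | length w = n. (cmod (da_hat f w))\<^sup>2)"

lemma level_sums: "(\<lambda>n. level n f) sums (norm f)\<^sup>2"
  unfolding level_def by (rule da_hat_norm_sums)

lemma level_nonneg: "level n f \<ge> 0"
  by (simp add: level_def sum_nonneg)

text \<open>Removal of the first letter; \<open>mult_op_coord\<close> identifies it as the adjoint
  of multiplication by the k-th coordinate. \<open>SOME\<close> is justified by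
  \<open>ex_da_hat\<close>, and the coordinates determine the element by
  \<open>da_hat_eqI\<close>.\<close>

definition da_back :: "'d::finite \<Rightarrow> 'd drury_arveson \<Rightarrow> 'd drury_arveson" where
  "da_back k f = (SOME g. \<forall>w. da_hat g w = da_hat f (k # w))"

lemma da_hat_back:
  fixes f :: "'d::finite drury_arveson"
  shows "da_hat (da_back k f) w = da_hat f (k # w)"
proof -
  have le: "(\<Sum>w | length w = n. (cmod (da_hat f (k # w)))\<^sup>2) \<le> level (Suc n) f" for n
  proof -
    have "(\<Sum>w | length w = n. (cmod (da_hat f (k # w)))\<^sup>2) \<le>
        (\<Sum>j\<in>UNIV. \<Sum>w | length w = n. (cmod (da_hat f (j # w)))\<^sup>2)"
      by (rule member_le_sum) (auto intro: sum_nonneg)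
    then show ?thesis by (simp add: level_def sum_words_Suc)
  qed
  have "summable (\<lambda>n. level (Suc n) f)"
    using level_sums[of f] by (simp add: sums_iff summable_Suc_iff[of "\<lambda>n. level n f"])
  then have s: "summable (\<lambda>n. \<Sum>w | length w = n. (cmod (da_hat f (k # w)))\<^sup>2)"
    by (rule summable_comparison_test'[where N=0]) (use le in \<open>auto simp: sum_nonneg\<close>)
  have "da_hat f (k # v) = da_hat f (k # w)" if "counts v = counts w" for v w
    using that by (simp add: da_hat_def)
  from ex_da_hat[of "\<lambda>w. da_hat f (k # w)", OF this summable_sums[OF s]]
  have "\<exists>g. \<forall>w. da_hat g w = da_hat f (k # w)" by metis
  then have "\<forall>w. da_hat (da_back k f) w = da_hat f (k # w)" unfolding da_back_def by (rule someI_ex)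
  then show ?thesis ..
qed

lemma sum_level_back: "(\<Sum>k\<in>UNIV. level n (da_back k f)) = level (Suc n) f"
  by (simp add: level_def da_hat_back sum_words_Suc)

text \<open>Quadratic form of the identity that the sum of M_k M_k^* is the projection onto the
  orthogonal complement of the constants.\<close>

lemma sum_norm_back: "(\<Sum>k\<in>UNIV. (norm (da_back k f))\<^sup>2) = (norm f)\<^sup>2 - level 0 f"
proof -
  have "(\<lambda>n. \<Sum>k\<in>UNIV. level n (da_back k f)) sums (\<Sum>k\<in>UNIV. (norm (da_back k f))\<^sup>2)"
    by (intro sums_sum level_sums)
  then have "(\<lambda>n. level (Suc n) f) sums (\<Sum>k\<in>UNIV. (norm (da_back k f))\<^sup>2)"
    by (simp add: sum_level_back)
  moreover have "(\<lambda>n. level (Suc n) f) sums ((norm f)\<^sup>2 - level 0 f)"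
    using level_sums[of f] by (simp add: sums_Suc_iff[of "\<lambda>n. level n f"])
  ultimately show ?thesis by (rule sums_unique2)
qed

lemma da_hat_linear:
  "da_hat (f + g) w = da_hat f w + da_hat g w" "da_hat (c *\<^sub>C f) w = c * da_hat f w"
  by (simp_all add: da_hat_def cinner_add_left cinner_scaleC_left)

lemma cblinear_da_back: "cblinear (da_back k)"
proof (rule cblinearI[where K=1])
  fix f
  have "(norm (da_back k f))\<^sup>2 \<le> (\<Sum>k\<in>UNIV. (norm (da_back k f))\<^sup>2)"
    by (rule member_le_sum) auto
  also have "\<dots> \<le> (norm f)\<^sup>2" using level_nonneg[of 0 f] by (simp add: sum_norm_back)
  finally have "(norm (da_back k f))\<^sup>2 \<le> (norm f)\<^sup>2" .
  from power2_le_imp_le[OF this norm_ge_zero] show "norm (da_back k f) \<le> 1 * norm f" by simp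
qed (auto intro!: da_hat_eqI simp: da_hat_back da_hat_linear)

lemma sum_norm_back_word:
  "(\<Sum>w | length w = n. (norm (back_word da_back w f))\<^sup>2) = (norm f)\<^sup>2 - (\<Sum>i<n. level i f)"
proof (induction n arbitrary: f)
  case (Suc n)
  have "(\<Sum>w | length w = Suc n. (norm (back_word da_back w f))\<^sup>2) =
      (\<Sum>k\<in>UNIV. (norm (da_back k f))\<^sup>2 - (\<Sum>i<n. level i (da_back k f)))"
    by (simp add: sum_words_Suc Suc)
  also have "\<dots> = (norm f)\<^sup>2 - level 0 f - (\<Sum>i<n. level (Suc i) f)"
    by (simp add: sum_subtractf sum_norm_back sum.swap[of _ "{..<n}"] sum_level_back)
  finally show ?case by (simp add: sum.lessThan_Suc_shift del: sum.lessThan_Suc)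
qed simp

lemma pure_da_back: "(\<lambda>n. \<Sum>w | length w = n. (norm (back_word da_back w f))\<^sup>2) \<longlonglongrightarrow> 0"
proof -
  have "(\<lambda>n. (norm f)\<^sup>2 - (\<Sum>i<n. level i f)) \<longlonglongrightarrow> (norm f)\<^sup>2 - (norm f)\<^sup>2"
    using level_sums[of f] by (intro tendsto_diff tendsto_const) (simp add: sums_def)
  then show ?thesis by (simp add: sum_norm_back_word)
qed

lemma da_back_commute: "da_back i (da_back j f) = da_back j (da_back i f)"
proof (rule da_hat_eqI)
  fix w
  have "counts (j # i # w) = counts (i # j # w)" by (simp only: counts_eq_iff) simp
  then have "da_hat f (j # i # w) = da_hat f (i # j # w)" by (simp only: da_hat_def)
  then show "da_hat (da_back i (da_back j f)) w = da_hat (da_back j (da_back i f)) w"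
    by (simp only: da_hat_back)
qed

lemma da_hat_kernel:
  "z \<in> ball 0 1 \<Longrightarrow> da_hat (da_kernel z) w = cnj (zpow (counts w) z)"
  using da_weight_pos[of "counts w"] by (simp add: da_hat_coeff da_coeff_kernel)

text \<open>Kernel functions are joint eigenvectors of the backward shifts. Pairing with them shows
  that coordinates are multipliers and that their operators are the adjoints of the backward
  shifts.\<close>

lemma da_back_kernel: "z \<in> ball 0 1 \<Longrightarrow> da_back k (da_kernel z) = cnj (z $ k) *\<^sub>C da_kernel z"
  by (rule da_hat_eqI) (simp add: da_hat_back da_hat_linear da_hat_kernel zpow_inc)

lemma
  shows coord_multiplier: "coord k \<in> multipliers"
    and mult_op_coord: "mult_op (coord k) f = hadj (da_back k) f"
  by (rule multipliersI[where A="hadj (da_back k)"];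
      simp add: coord_def da_eval_kernel hadj_left[OF cblinear_da_back] da_back_kernel
        cinner_scaleC_right)+

lemma hadj_mult_op_coord: "hadj (mult_op (coord k)) = da_back k"
  using hadj_hadj[OF cblinear_da_back, of k] by (simp add: mult_op_coord[abs_def])

lemma mult_op_coord_mono: "mult_op (coord k) (da_mono \<alpha>) = da_mono (inc k \<alpha>)"
  by (rule mult_op_eqI) (simp add: da_eval_mono zpow_inc coord_def)

section \<open>Conjugation of Taylor coefficients\<close>

lift_definition da_cnj :: "'d::finite drury_arveson \<Rightarrow> 'd drury_arveson" is "\<lambda>c \<alpha>. cnj (c \<alpha>)"
  by simp

lemma da_cnj_da_cnj [simp]: "da_cnj (da_cnj f) = f"
  by (rule da_eqI) (simp add: da_cnj.rep_eq)

lemma cinner_da_cnj: "cinner (da_cnj f) g = cnj (cinner f (da_cnj g))"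
  unfolding cinner_drury_arveson_def infsum_cnj[symmetric] by (simp add: da_cnj.rep_eq)

definition vec_cnj :: "complex^'d \<Rightarrow> complex^'d" where
  "vec_cnj z = (\<chi> i. cnj (z $ i))"

lemma vec_cnj_ball [simp]: "norm (vec_cnj z) = norm z" "vec_cnj (vec_cnj z) = z"
  by (simp_all add: vec_cnj_def norm_vec_def vec_eq_iff)

lemma da_eval_cnj: "da_eval (da_cnj f) z = cnj (da_eval f (vec_cnj z))"
  unfolding da_eval_def infsum_cnj[symmetric] by (simp add: da_cnj.rep_eq vec_cnj_def)

text \<open>Conjugating both the argument and the value keeps the function analytic and conjugates
  its Taylor coefficients; on operators it is conjugation by the antiunitary map
  \<open>da_cnj\<close>.\<close>

definition mult_cnj :: "(complex^'d::finite \<Rightarrow> complex) \<Rightarrow> complex^'d \<Rightarrow> complex" where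
  "mult_cnj \<phi> = (\<lambda>z\<in>ball 0 1. cnj (\<phi> (vec_cnj z)))"

lemma
  assumes "\<phi> \<in> multipliers"
  shows cnj_multiplier: "mult_cnj \<phi> \<in> multipliers"
    and mult_op_cnj: "mult_op (mult_cnj \<phi>) f = da_cnj (mult_op \<phi> (da_cnj f))"
  by (rule multipliersI[where A="\<lambda>f. da_cnj (mult_op \<phi> (da_cnj f))"];
      simp add: mult_cnj_def da_eval_cnj da_eval_mult_op assms)+

lemma mult_cnj_mult_cnj: "\<phi> \<in> multipliers \<Longrightarrow> mult_cnj (mult_cnj \<phi>) = \<phi>"
  by (auto simp: mult_cnj_def multipliers_def extensional_def restrict_def fun_eq_iff)

section \<open>Dilation of pure commuting row contractions\<close>

definition psd_form :: "('a::complex_hilbert \<Rightarrow> 'a \<Rightarrow> complex) \<Rightarrow> bool" where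
  "psd_form q \<longleftrightarrow> (\<forall>x y z. q (x + y) z = q x z + q y z) \<and> (\<forall>c x y. q (c *\<^sub>C x) y = c * q x y) \<and>
     (\<forall>x y. q x y = cnj (q y x)) \<and> (\<forall>x. Re (q x x) \<ge> 0)"

lemma psd_formD:
  assumes "psd_form q"
  shows "q (x + y) z = q x z + q y z" "q (c *\<^sub>C x) y = c * q x y" "q x y = cnj (q y x)"
    "Re (q x x) \<ge> 0" "q x (y + z) = q x y + q x z" "q x (c *\<^sub>C y) = cnj c * q x y"
    "q x x = of_real (Re (q x x))"
proof -
  show 1: "q (x + y) z = q x z + q y z" "q (c *\<^sub>C x) y = c * q x y" "q x y = cnj (q y x)"
    "Re (q x x) \<ge> 0" for x y z c
    using assms unfolding psd_form_def by blast+
  show "q x (y + z) = q x y + q x z" "q x (c *\<^sub>C y) = cnj c * q x y"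
    using 1(1)[of y z x] 1(2)[of c y x] 1(3)[of x] by (metis complex_cnj_add complex_cnj_mult)+
  have "Im (q x x) = - Im (q x x)" using arg_cong[OF 1(3)[of x x], of Im] by simp
  then show "q x x = of_real (Re (q x x))" by (simp add: complex_eq_iff)
qed

lemma psd_form_cauchy_schwarz:
  assumes q: "psd_form q"
  shows "(cmod (q x y))\<^sup>2 \<le> Re (q x x) * Re (q y y)"
proof -
  note D = psd_formD[OF q]
  let ?a = "Re (q x x)" and ?b = "Re (q y y)" and ?s = "(cmod (q x y))\<^sup>2"
  \<comment> \<open>The form evaluated at x - t q(x, y) y for real t.\<close>
  have nonneg: "0 \<le> ?a - 2 * t * ?s + t\<^sup>2 * ?s * ?b" for t
  proof -
    define c where "c = - of_real t * q x y"
    have "q (x + c *\<^sub>C y) (x + c *\<^sub>C y) =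
        q x x + cnj c * q x y + c * cnj (q x y) + c * cnj c * q y y"
      using D(3)[of y x] by (simp add: D(1,2,5,6) algebra_simps)
    also have "\<dots> = q x x - 2 * t * (q x y * cnj (q x y)) + t\<^sup>2 * (q x y * cnj (q x y)) * q y y"
      by (simp add: c_def power2_eq_square algebra_simps)
    also have "\<dots> = of_real (?a - 2 * t * ?s + t\<^sup>2 * ?s * ?b)"
      unfolding complex_norm_square[symmetric] using D(7)[of x] D(7)[of y] by simp
    finally show ?thesis using D(4)[of "x + c *\<^sub>C y"] by simp
  qed
  show ?thesis
  proof (cases "?b = 0")
    case True
    \<comment> \<open>With ?b = 0 the inequality is affine in t, and for nonzero ?s this t would
      give the value -1.\<close>
    have "?s = 0"
      using nonneg[of "(?a + 1) / (2 * ?s)"] unfolding True by (cases "?s = 0") simp_all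
    then show ?thesis by (simp add: True)
  next
    case False
    then have "?b > 0" using D(4)[of y] by simp
    then show ?thesis using nonneg[of "1 / ?b"] by (simp add: power2_eq_square field_simps)
  qed
qed

lemma psd_form_zero:
  assumes "psd_form q" "Re (q x x) = 0" shows "q x y = 0"
  using psd_form_cauchy_schwarz[OF assms(1), of x y] assms(2) by simp

text \<open>The Schur complement of \<open>q\<close> with respect to the vector \<open>u\<close>; when \<open>q u u = 0\<close>, the division by
  zero makes it equal to \<open>q\<close>.\<close>

definition schur :: "('a \<Rightarrow> 'a \<Rightarrow> complex) \<Rightarrow> 'a \<Rightarrow> 'a \<Rightarrow> 'a \<Rightarrow> complex" where
  "schur q u x y = q x y - q x u * q u y / q u u"

text \<open>Positivity of the complement is the Cauchy-Schwarz inequality divided by q(u,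
  u).\<close>

lemma psd_form_schur:
  assumes q: "psd_form q" shows "psd_form (schur q u)"
proof -
  note D = psd_formD[OF q]
  have "schur q u x y = cnj (schur q u y x)" for x y
    using D(3)[of x y] D(3)[of x u] D(3)[of u y] D(3)[of u u]
    by (simp add: schur_def mult.commute)
  moreover have "Re (schur q u x x) \<ge> 0" for x
  proof (cases "Re (q u u) = 0")
    case True
    then have "q u u = 0" using D(7)[of u] by simp
    then show ?thesis using D(4) by (simp add: schur_def)
  next
    case False
    then have p: "Re (q u u) > 0" using D(4)[of u] by simp
    have "q x u * q u x / q u u = of_real ((cmod (q x u))\<^sup>2 / Re (q u u))"
      unfolding of_real_divide complex_norm_square using D(3)[of u x] D(7)[of u] by simp
    then have "Re (schur q u x x) = Re (q x x) - (cmod (q x u))\<^sup>2 / Re (q u u)"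
      by (simp add: schur_def)
    moreover have "(cmod (q x u))\<^sup>2 / Re (q u u) \<le> Re (q x x)"
      using p psd_form_cauchy_schwarz[OF q, of x u] by (simp add: divide_le_eq)
    ultimately show ?thesis by simp
  qed
  ultimately show ?thesis
    unfolding psd_form_def using D(1,2) by (auto simp: schur_def field_simps add_divide_distrib)
qed

primrec schur_iter :: "('a \<Rightarrow> 'a \<Rightarrow> complex) \<Rightarrow> (nat \<Rightarrow> 'a) \<Rightarrow> nat \<Rightarrow> 'a \<Rightarrow> 'a \<Rightarrow> complex" where
  "schur_iter q u 0 = q"
| "schur_iter q u (Suc n) = schur (schur_iter q u n) (u n)"

text \<open>Iterated Schur complements against \<open>u 0, u 1, \<dots>\<close> play the role of Gram--Schmidt
  orthonormalization for the semi-inner product \<open>q\<close>.\<close>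

lemma psd_form_expansion:
  fixes q :: "'a::complex_hilbert \<Rightarrow> 'a \<Rightarrow> complex" and u :: "nat \<Rightarrow> 'a"
  assumes q: "psd_form q"
  obtains g where "\<And>i x y. g i (x + y) = g i x + (g i y :: complex)"
    "\<And>i c x. g i (c *\<^sub>C x) = c * g i x"
    "\<And>n x. (\<Sum>i<n. (cmod (g i x))\<^sup>2) \<le> Re (q x x)"
    "\<And>j. (\<lambda>i. (cmod (g i (u j)))\<^sup>2) sums Re (q (u j) (u j))"
proof -
  let ?E = "schur_iter q u"
  have E: "psd_form (?E n)" for n by (induction n) (auto simp: q psd_form_schur)
  note D = psd_formD[OF E]
  \<comment> \<open>If \<open>u i\<close> has length zero for the i-th form, division by zero makes
    \<open>g i\<close> vanish, in agreement with a Schur complement that leaves the form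
    unchanged.\<close>
  define g where "g i x = ?E i x (u i) / of_real (sqrt (Re (?E i (u i) (u i))))" for i x
  have step: "(cmod (g i x))\<^sup>2 = Re (?E i x x) - Re (?E (Suc i) x x)" for i x
  proof -
    have "?E i x (u i) * ?E i (u i) x / ?E i (u i) (u i) =
        of_real ((cmod (?E i x (u i)))\<^sup>2 / Re (?E i (u i) (u i)))"
      unfolding of_real_divide complex_norm_square using D(3)[of i "u i" x] D(7)[of i "u i"] by simp
    also have "(cmod (?E i x (u i)))\<^sup>2 / Re (?E i (u i) (u i)) = (cmod (g i x))\<^sup>2"
      using D(4)[of i "u i"] by (simp add: g_def norm_divide power_divide)
    finally show ?thesis by (simp add: schur_def)
  qed
  have tele: "(\<Sum>i<n. (cmod (g i x))\<^sup>2) = Re (q x x) - Re (?E n x x)" for n x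
    by (induction n) (simp_all add: step)
  \<comment> \<open>Once eliminated, \<open>u j\<close> stays in the null space of all later forms,
    so the expansion at \<open>u j\<close> is complete after finitely many steps.\<close>
  have kill: "?E n (u j) y = 0" if "j < n" for j n y
    using that
  proof (induction n arbitrary: y)
    case (Suc n)
    show ?case
    proof (cases "j = n")
      case True
      show ?thesis
      proof (cases "?E n (u n) (u n) = 0")
        case zero: True
        then have "?E n (u n) y = 0" by (intro psd_form_zero[OF E]) simp
        then show ?thesis by (simp add: True schur_def zero)
      qed (simp add: True schur_def)
    next
      case False
      then show ?thesis using Suc by (simp add: schur_def)
    qed
  qed simp
  show thesis
  proof (rule that[of g])
    show "(\<Sum>i<n. (cmod (g i x))\<^sup>2) \<le> Re (q x x)" for n x
      using D(4)[of n x] by (simp add: tele)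
    show "(\<lambda>i. (cmod (g i (u j)))\<^sup>2) sums Re (q (u j) (u j))" for j
    proof -
      have "\<forall>\<^sub>F n in sequentially. Re (q (u j) (u j)) = (\<Sum>i<n. (cmod (g i (u j)))\<^sup>2)"
        using kill[of j] by (auto simp: tele eventually_sequentially intro!: exI[of _ "Suc j"])
      then show ?thesis unfolding sums_def by (rule tendsto_eventually[OF eventually_mono]) simp
    qed
  qed (simp_all add: g_def D(1,2) add_divide_distrib)
qed

section \<open>The Poisson kernel of a pure row\<close>

lemma summable_cinner:
  fixes f g :: "nat \<Rightarrow> 'b::complex_hilbert"
  assumes "summable (\<lambda>i. (norm (f i))\<^sup>2)" "summable (\<lambda>i. (norm (g i))\<^sup>2)"
  shows "summable (\<lambda>i. norm (f i) * norm (g i))" "summable (\<lambda>i. cinner (f i) (g i))"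
proof -
  have "norm (norm (f i) * norm (g i)) \<le> (norm (f i))\<^sup>2 + (norm (g i))\<^sup>2" for i
    using sum_squares_bound[of "norm (f i)" "norm (g i)"]
      mult_nonneg_nonneg[OF norm_ge_zero[of "f i"] norm_ge_zero[of "g i"]]
    unfolding real_norm_def by linarith
  then show s: "summable (\<lambda>i. norm (f i) * norm (g i))"
    by (intro summable_comparison_test'[OF summable_add[OF assms], where N=0]) auto
  show "summable (\<lambda>i. cinner (f i) (g i))"
    by (rule summable_comparison_test'[OF s, where N=0]) (rule cinner_cauchy_schwarz)
qed

text \<open>The form \<open>p\<close> allows two uses. With \<open>p\<close> the inner product and
  \<open>B k\<close> the adjoint of \<open>T k\<close> it serves the functional calculus. With
  \<open>B = da_back\<close> and \<open>p\<close> the form of the projection onto an invariant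
  subspace it serves the restriction of the coordinate multiplications to that subspace, while all
  maps remain defined on the whole space.\<close>

locale pure_row =
  fixes B :: "'d::finite \<Rightarrow> 'a::complex_hilbert \<Rightarrow> 'a" and p :: "'a \<Rightarrow> 'a \<Rightarrow> complex"
  assumes cblinear_B: "cblinear (B k)"
    and B_commute: "B i (B j x) = B j (B i x)"
    and psd_p: "psd_form p"
    and p_bound: "Re (p x x) \<le> (norm x)\<^sup>2"
    and row: "(\<Sum>k\<in>UNIV. Re (p (B k x) (B k x))) \<le> Re (p x x)"
    and p_pure: "(\<lambda>n. \<Sum>w | length w = n. Re (p (back_word B w x) (back_word B w x))) \<longlonglongrightarrow> 0"
begin

text \<open>For \<open>p = cinner\<close> and \<open>B k\<close> the adjoint of \<open>T k\<close>
  this is the form of the defect operator I - sum T_k T_k^*.\<close>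

definition defect :: "'a \<Rightarrow> 'a \<Rightarrow> complex" where
  "defect x y = p x y - (\<Sum>k\<in>UNIV. p (B k x) (B k y))"

lemma psd_defect: "psd_form defect"
proof -
  note D = psd_formD[OF psd_p]
  show ?thesis
    unfolding psd_form_def
  proof (intro conjI allI)
    show "defect x y = cnj (defect y x)" for x y
      unfolding defect_def complex_cnj_diff cnj_sum D(3)[of x y] by (simp flip: D(3))
    show "Re (defect x x) \<ge> 0" for x using row[of x] by (simp add: defect_def)
  qed (simp_all add: defect_def D(1,2) cblinear_add[OF cblinear_B] cblinear_scaleC[OF cblinear_B]
      sum.distrib sum_distrib_left right_diff_distrib)
qed

lemma back_word_B: "back_word B w (B k x) = B k (back_word B w x)"
  by (induction w arbitrary: x) (simp, metis B_commute back_word.simps(2))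

lemma back_word_counts: "counts v = counts w \<Longrightarrow> back_word B v x = back_word B w x"
proof -
  have snoc: "back_word B (v1 @ k # v2) x = back_word B (k # v1 @ v2) x" for v1 k v2 x
    by (induction v1 arbitrary: x) (simp_all add: B_commute)
  show "counts v = counts w \<Longrightarrow> back_word B v x = back_word B w x"
  proof (induction v arbitrary: w x)
    case Nil
    then have "w = []" using counts_eq_iff[of "[]" w] by simp
    then show ?case by simp
  next
    case (Cons k v)
    then have m: "mset (k # v) = mset w" by (simp only: counts_eq_iff)
    then have "k \<in> set w" by (metis list.set_intros(1) mset_eq_setD)
    then obtain w1 w2 where w: "w = w1 @ k # w2" by (auto simp: in_set_conv_decomp)
    have "counts v = counts (w1 @ w2)" unfolding counts_eq_iff using m w by simp
    then show ?case unfolding w snoc using Cons.IH by simp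
  qed
qed

lemma back_word_linear:
  "back_word B w (x + y) = back_word B w x + back_word B w y"
  "back_word B w (c *\<^sub>C x) = c *\<^sub>C back_word B w x"
  by (induction w arbitrary: x y)
    (simp_all add: cblinear_add[OF cblinear_B] cblinear_scaleC[OF cblinear_B])

definition defect_level :: "'a \<Rightarrow> nat \<Rightarrow> real" where
  "defect_level x n = (\<Sum>w | length w = n. Re (defect (back_word B w x) (back_word B w x)))"

lemma defect_level_partial_sum:
  "(\<Sum>n<N. defect_level x n) =
     Re (p x x) - (\<Sum>w | length w = N. Re (p (back_word B w x) (back_word B w x)))"
proof (induction N)
  case (Suc N)
  have "(\<Sum>w | length w = Suc N. Re (p (back_word B w x) (back_word B w x))) =
      (\<Sum>w | length w = N. \<Sum>k\<in>UNIV. Re (p (B k (back_word B w x)) (B k (back_word B w x))))"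
    unfolding sum_words_Suc back_word.simps back_word_B by (rule sum.swap)
  then have "defect_level x N =
      (\<Sum>w | length w = N. Re (p (back_word B w x) (back_word B w x))) -
      (\<Sum>w | length w = Suc N. Re (p (back_word B w x) (back_word B w x)))"
    by (simp add: defect_level_def defect_def sum_subtractf)
  then show ?case using Suc by simp
qed simp

text \<open>Purity removes the remainder of the telescoping sum, so the defect on all words recovers
  the whole of \<open>p x x\<close>.\<close>

lemma defect_level_sums: "defect_level x sums Re (p x x)"
  using tendsto_diff[OF tendsto_const[of "Re (p x x)"] p_pure[of x]]
  by (simp add: sums_def defect_level_partial_sum)

text \<open>The maps \<open>K i\<close> are the components of the Poisson kernel of the row contraction.\<close>

definition dilates :: "(nat \<Rightarrow> 'a \<Rightarrow> 'd drury_arveson) \<Rightarrow> bool" where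
  "dilates K \<longleftrightarrow> (\<forall>i. cblinear (K i)) \<and> (\<forall>i k x. K i (B k x) = da_back k (K i x)) \<and>
     (\<forall>x n. (\<Sum>i<n. (norm (K i x))\<^sup>2) \<le> Re (p x x))"

lemma dilates_summable:
  assumes "dilates K"
  shows "summable (\<lambda>i. (norm (K i x))\<^sup>2)" "(\<Sum>i. (norm (K i x))\<^sup>2) \<le> Re (p x x)"
proof -
  have le: "(\<Sum>i<n. (norm (K i x))\<^sup>2) \<le> Re (p x x)" for n using assms by (auto simp: dilates_def)
  show s: "summable (\<lambda>i. (norm (K i x))\<^sup>2)"
    by (rule summableI_nonneg_bounded[OF _ le]) simp
  show "(\<Sum>i. (norm (K i x))\<^sup>2) \<le> Re (p x x)"
    by (rule suminf_le_const[OF s le])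
qed

text \<open>Each functional \<open>g i\<close> in the expansion of the defect form defines a
  component whose coordinate at the word w is the value of \<open>g i\<close> at
  \<open>back_word B w x\<close>. Summing squares over i gives at most the defect at that vector,
  with equality on the orbit of \<open>C\<close>; summing over words then telescopes to
  \<open>p x x\<close>.\<close>

theorem dilation:
  fixes C :: "'a set"
  assumes C: "countable C"
  obtains K where "dilates K" "\<And>x y. x \<in> C \<Longrightarrow> (\<lambda>i. cinner (K i x) (K i y)) sums p x y"
proof -
  \<comment> \<open>The whole orbit is needed, since the coordinates of \<open>K i x\<close> are
    values of \<open>g i\<close> along it; the inserted 0 keeps the set nonempty, so that a sequence
    enumerates it.\<close>
  define W where "W = (\<lambda>(w, x). back_word B w x) ` (UNIV \<times> insert 0 C)"
  have W: "countable W" "W \<noteq> {}" using C by (auto simp: W_def)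
  define u where "u = from_nat_into W"
  have u: "\<exists>j. u j = back_word B w x" if "x \<in> C" for w x
  proof -
    have "back_word B w x \<in> W" using that unfolding W_def by (intro image_eqI[of _ _ "(w, x)"]) auto
    from from_nat_into_surj[OF W(1) this] show ?thesis by (simp add: u_def)
  qed
  obtain g where g: "\<And>i x y. g i (x + y) = g i x + (g i y :: complex)"
      "\<And>i c x. g i (c *\<^sub>C x) = c * g i x"
      "\<And>n x. (\<Sum>i<n. (cmod (g i x))\<^sup>2) \<le> Re (defect x x)"
      "\<And>j. (\<lambda>i. (cmod (g i (u j)))\<^sup>2) sums Re (defect (u j) (u j))"
    using psd_form_expansion[OF psd_defect, of u] by metis
  define lev where "lev i x n = (\<Sum>w | length w = n. (cmod (g i (back_word B w x)))\<^sup>2)" for i x n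
  have lev0: "lev i x n \<ge> 0" for i x n by (simp add: lev_def sum_nonneg)
  have lev_sum: "(\<Sum>i<m. lev i x n) \<le> defect_level x n" for m x n
    unfolding lev_def defect_level_def sum.swap[of _ _ "{..<m}"] by (intro sum_mono g(3))
  have lev1: "lev i x n \<le> defect_level x n" for i x n
    using lev_sum[of x n "Suc i"] member_le_sum[of i "{..<Suc i}" "\<lambda>i. lev i x n"] lev0 by simp
  have lev_summable: "summable (lev i x)" for i x
    by (rule summable_comparison_test'[where N=0])
      (use defect_level_sums[of x] lev1 lev0 in \<open>auto simp: sums_iff\<close>)
  have "\<exists>f. (\<forall>w. da_hat f w = g i (back_word B w x)) \<and> (norm f)\<^sup>2 = suminf (lev i x)" for i x
  proof -
    have "g i (back_word B v x) = g i (back_word B w x)" if "counts v = counts w" for v w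
      using back_word_counts[OF that] by simp
    moreover have "(\<lambda>n. \<Sum>w | length w = n. (cmod (g i (back_word B w x)))\<^sup>2) sums suminf (lev i x)"
      using summable_sums[OF lev_summable[of i x]] by (simp add: lev_def[abs_def])
    ultimately show ?thesis
      by (rule ex_da_hat[of "\<lambda>w. g i (back_word B w x)"]) (assumption | intro exI conjI allI)+
  qed
  then obtain K where hat: "\<And>i x w. da_hat (K i x) w = g i (back_word B w x)"
    and norm_K: "\<And>i x. (norm (K i x))\<^sup>2 = suminf (lev i x)"
    by metis
  have bound: "(\<Sum>i<n. (norm (K i x))\<^sup>2) \<le> Re (p x x)" for n x
  proof -
    have "(\<Sum>i<n. (norm (K i x))\<^sup>2) = (\<Sum>m. \<Sum>i<n. lev i x m)"
      unfolding norm_K by (rule suminf_sum[symmetric]) (rule lev_summable)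
    also have "\<dots> \<le> (\<Sum>m. defect_level x m)"
      by (rule suminf_le[OF lev_sum summable_sum[OF lev_summable]])
        (use defect_level_sums[of x] in \<open>simp add: sums_iff\<close>)
    finally show ?thesis using defect_level_sums[of x] by (simp add: sums_iff)
  qed
  have "norm (K i x) \<le> 1 * norm x" for i x
  proof -
    have "(norm (K i x))\<^sup>2 \<le> (\<Sum>i<Suc i. (norm (K i x))\<^sup>2)" by (rule member_le_sum) auto
    also have "\<dots> \<le> (norm x)\<^sup>2" using bound p_bound order_trans by blast
    finally have "(norm (K i x))\<^sup>2 \<le> (norm x)\<^sup>2" .
    from power2_le_imp_le[OF this norm_ge_zero] show ?thesis by simp
  qed
  then have cb: "cblinear (K i)" for i
    by (intro cblinearI[where K=1])
      (auto intro!: da_hat_eqI simp: da_hat_linear hat back_word_linear g(1,2))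
  have K: "dilates K"
    unfolding dilates_def using cb bound by (auto intro!: da_hat_eqI simp: da_hat_back hat)
  note sK = dilates_summable[OF K]
  \<comment> \<open>The part of \<open>p\<close> missed by the components. It is positive
    semidefinite by the Bessel bound and vanishes on the diagonal at each x in \<open>C\<close>, so
    the Cauchy-Schwarz inequality gives R(x, y) = 0 for every y, inside \<open>C\<close> or
    not.\<close>
  define R where "R x y = p x y - (\<Sum>i. cinner (K i x) (K i y))" for x y
  have sKK: "summable (\<lambda>i. cinner (K i x) (K i y))" for x y
    by (rule summable_cinner[OF sK(1) sK(1)])
  have Rxx: "Re (R x x) = Re (p x x) - (\<Sum>i. (norm (K i x))\<^sup>2)" for x
    using sums_Re[OF summable_sums[OF sKK[of x x]]] by (simp add: R_def cinner_self sums_iff)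
  have "psd_form R"
    unfolding psd_form_def
  proof (intro conjI allI)
    note D = psd_formD[OF psd_p]
    show "R (x + y) z = R x z + R y z" for x y z
      by (simp add: R_def D(1) cblinear_add[OF cb] cinner_add_left suminf_add[OF sKK sKK,
          symmetric])
    show "R (c *\<^sub>C x) y = c * R x y" for c x y
      by (simp add: R_def D(2) cblinear_scaleC[OF cb] cinner_scaleC_left right_diff_distrib
          suminf_mult[OF sKK])
    show "R x y = cnj (R y x)" for x y
    proof -
      have "cnj (\<Sum>i. cinner (K i y) (K i x)) = (\<Sum>i. cinner (K i x) (K i y))"
        using bounded_linear.suminf[OF bounded_linear_cnj sKK[of y x]]
          by (simp flip: cinner_commute)
      then show ?thesis using D(3)[of x y] by (simp add: R_def)
    qed
    show "Re (R x x) \<ge> 0" for x using sK(2)[of x] by (simp add: Rxx)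
  qed
  note R = this
  show thesis
  proof (rule that[OF K])
    fix x y assume x: "x \<in> C"
    have level: "(\<lambda>i. lev i x n) sums defect_level x n" for n
      unfolding lev_def defect_level_def
    proof (rule sums_sum)
      fix w :: "'d list"
      obtain j where "u j = back_word B w x" using u[OF x] by blast
      then show "(\<lambda>i. (cmod (g i (back_word B w x)))\<^sup>2) sums
          Re (defect (back_word B w x) (back_word B w x))"
        using g(4)[of j] by simp
    qed
    have "(\<Sum>n<N. defect_level x n) \<le> (\<Sum>i. (norm (K i x))\<^sup>2)" for N
    proof -
      have s: "(\<lambda>i. \<Sum>n<N. lev i x n) sums (\<Sum>n<N. defect_level x n)"
        by (intro sums_sum level)
      have "(\<Sum>n<N. lev i x n) \<le> (norm (K i x))\<^sup>2" for i
        unfolding norm_K by (rule sum_le_suminf[OF lev_summable]) (auto simp: lev0)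
      from suminf_le[OF this _ sK(1)] s show ?thesis by (simp add: sums_iff)
    qed
    then have "Re (p x x) \<le> (\<Sum>i. (norm (K i x))\<^sup>2)"
      using defect_level_sums[of x] unfolding sums_def by (intro LIMSEQ_le_const2) auto
    then have "Re (R x x) = 0" using sK(2)[of x] by (simp add: Rxx)
    from psd_form_zero[OF R this, of y]
    show "(\<lambda>i. cinner (K i x) (K i y)) sums p x y"
      using summable_sums[OF sKK[of x y]] by (simp add: R_def)
  qed
qed

end

section \<open>Approximation of multipliers by polynomials\<close>

inductive_set polys :: "(complex^'d::finite \<Rightarrow> complex) set" where
  const: "(\<lambda>z\<in>ball 0 1. c) \<in> polys"
| coord: "coord k \<in> polys"
| add: "p \<in> polys \<Longrightarrow> q \<in> polys \<Longrightarrow> (\<lambda>z\<in>ball 0 1. p z + q z) \<in> polys"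
| times: "p \<in> polys \<Longrightarrow> q \<in> polys \<Longrightarrow> (\<lambda>z\<in>ball 0 1. p z * q z) \<in> polys"

lemma polys_multipliers: "p \<in> polys \<Longrightarrow> p \<in> multipliers"
  by (induction rule: polys.induct)
    ((rule const_multiplier coord_multiplier add_multiplier times_multiplier; assumption?)+)

lemma zpow_polys: "(\<lambda>z\<in>ball 0 1. zpow \<alpha> z) \<in> polys"
proof -
  have "(\<lambda>z\<in>ball 0 1. zpow (counts w) z) \<in> polys" for w :: "'a list"
  proof (induction w)
    case Nil
    show ?case unfolding zpow_def counts_Nil power_0 prod.neutral_const by (rule polys.const)
  next
    case (Cons k w)
    have "(\<lambda>z\<in>ball 0 1. zpow (counts (k # w)) z) =
        (\<lambda>z\<in>ball 0 1. coord k z * (\<lambda>z\<in>ball 0 1. zpow (counts w) z) z)"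
      by (rule restrict_ext) (simp add: zpow_inc coord_def)
    then show ?case using polys.times[OF polys.coord[of k] Cons] by (simp only:)
  qed
  then show ?thesis using ex_word_of_counts[of \<alpha>] by auto
qed

lemma scale_polys: "p \<in> polys \<Longrightarrow> (\<lambda>z\<in>ball 0 1. c * p z) \<in> polys"
proof -
  assume p: "p \<in> polys"
  have "(\<lambda>z\<in>ball 0 1. c * p z) = (\<lambda>z\<in>ball 0 1. (\<lambda>z\<in>ball 0 1. c) z * p z)"
    by (rule restrict_ext) simp
  then show ?thesis using polys.times[OF polys.const p] by simp
qed

lemma sum_polys:
  assumes "finite F" "\<And>i. i \<in> F \<Longrightarrow> p i \<in> polys"
  shows "(\<lambda>z\<in>ball 0 1. \<Sum>i\<in>F. p i z) \<in> polys"
  using assms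
proof (induction F)
  case empty
  show ?case unfolding sum.empty by (rule polys.const)
next
  case (insert i F)
  have "(\<lambda>z\<in>ball 0 1. \<Sum>i\<in>insert i F. p i z) =
      (\<lambda>z\<in>ball 0 1. p i z + (\<lambda>z\<in>ball 0 1. \<Sum>i\<in>F. p i z) z)"
    by (rule restrict_ext) (use insert in simp)
  moreover have "(\<lambda>z\<in>ball 0 1. p i z + (\<lambda>z\<in>ball 0 1. \<Sum>i\<in>F. p i z) z) \<in> polys"
    by (intro polys.add insert) auto
  ultimately show ?case by (simp only:)
qed

section \<open>Homogeneous parts and truncation\<close>

abbreviation hpart :: "nat \<Rightarrow> 'd::finite drury_arveson \<Rightarrow> 'd drury_arveson" where
  "hpart n \<equiv> da_part {\<alpha>. deg \<alpha> = n}"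

lemma hpart_hpart: "hpart m (hpart n f) = (if m = n then hpart n f else 0)"
  by (rule da_eqI) (simp add: da_part.rep_eq da_coeff_simps)

lemma cinner_hpart: "cinner (hpart m f) (hpart n g) = (if m = n then cinner (hpart m f) g else 0)"
proof -
  have "cinner (hpart m f) (hpart n g) = cinner (hpart n (hpart m f)) g"
    by (simp add: cinner_da_part)
  then show ?thesis by (simp add: hpart_hpart)
qed

lemma da_hat_part: "da_hat (da_part A f) w = (if counts w \<in> A then da_hat f w else 0)"
  by (simp add: da_hat_coeff da_part.rep_eq)

lemma norm_da_part_deg:
  assumes "finite I"
  shows "(norm (da_part {\<alpha>. deg \<alpha> \<in> I} f))\<^sup>2 = (\<Sum>i\<in>I. level i f)"
proof -
  have "level n (da_part {\<alpha>. deg \<alpha> \<in> I} f) = (if n \<in> I then level n f else 0)" for n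
    unfolding level_def by (auto simp: da_hat_part intro!: sum.cong sum.neutral)
  then have "(\<lambda>n. if n \<in> I then level n f else 0) sums (norm (da_part {\<alpha>. deg \<alpha> \<in> I} f))\<^sup>2"
    using level_sums[of "da_part {\<alpha>. deg \<alpha> \<in> I} f"] by simp
  then show ?thesis using sums_If_finite_set[OF assms, of "\<lambda>n. level n f"] by (rule sums_unique2)
qed

lemma da_part_deg_sum:
  assumes "finite I"
  shows "da_part {\<alpha>. deg \<alpha> \<in> I} f = (\<Sum>i\<in>I. hpart i f)"
  using assms
proof (induction I)
  case empty
  show ?case by (rule da_eqI) (simp add: da_part.rep_eq da_coeff_simps)
next
  case (insert i I)
  have "da_part {\<alpha>. deg \<alpha> \<in> insert i I} f = hpart i f + da_part {\<alpha>. deg \<alpha> \<in> I} f"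
    using insert.hyps by (intro da_eqI) (auto simp: da_part.rep_eq da_coeff_simps)
  then show ?case using insert by simp
qed

lemma cinner_sum_sum:
  "cinner (sum f A) (sum g B :: 'a::complex_hilbert) = (\<Sum>i\<in>A. \<Sum>j\<in>B. cinner (f i) (g j))"
  by (subst cinner_sum_left) (subst cinner_sum_right, rule refl)

definition trunc :: "nat \<Rightarrow> 'd::finite drury_arveson \<Rightarrow> 'd drury_arveson" where
  "trunc D = da_part {\<alpha>. deg \<alpha> \<in> {..<D}}"

lemma norm_trunc_le: "norm (trunc D f) \<le> norm f"
  by (simp add: trunc_def norm_da_part_le)

lemma trunc_sum: "trunc D f = (\<Sum>i<D. hpart i f)"
  unfolding trunc_def by (rule da_part_deg_sum) simp

lemma trunc_tendsto: "(\<lambda>D. trunc D f) \<longlonglongrightarrow> f"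
proof -
  have eq: "(norm (f - trunc D f))\<^sup>2 = (norm f)\<^sup>2 - (\<Sum>n<D. level n f)" for D
  proof -
    have "cinner (trunc D f) f = cinner (trunc D f) (trunc D f)"
      by (simp add: trunc_def da_part_da_part flip: cinner_da_part)
    then have "inner (trunc D f) f = inner (trunc D f) (trunc D f)"
      by (simp add: inner_eq_Re_cinner)
    then have "(norm (f - trunc D f))\<^sup>2 = (norm f)\<^sup>2 - (norm (trunc D f))\<^sup>2"
      unfolding power2_norm_eq_inner by (simp add: inner_diff_left inner_diff_right inner_commute)
    then show ?thesis by (simp only: trunc_def norm_da_part_deg finite_lessThan)
  qed
  have "(\<lambda>D. (norm f)\<^sup>2 - (\<Sum>n<D. level n f)) \<longlonglongrightarrow> (norm f)\<^sup>2 - (norm f)\<^sup>2"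
    using level_sums[of f] by (intro tendsto_diff tendsto_const) (simp add: sums_def)
  then have "(\<lambda>D. sqrt ((norm (f - trunc D f))\<^sup>2)) \<longlonglongrightarrow> sqrt 0"
    unfolding eq by (intro tendsto_real_sqrt) simp
  then have "(\<lambda>D. norm (trunc D f - f)) \<longlonglongrightarrow> 0" by (simp add: norm_minus_commute[of f])
  from tendsto_norm_zero_cancel[OF this] show ?thesis by (rule Lim_null[THEN iffD2])
qed

lemma da_eval_0 [simp]: "da_eval 0 z = 0"
  by (simp add: da_eval_def da_coeff_simps)

text \<open>The multiplier as an element of the Drury--Arveson space, namely its product with the
  constant function 1.\<close>

definition symbol :: "(complex^'d::finite \<Rightarrow> complex) \<Rightarrow> 'd drury_arveson" where
  "symbol \<phi> = mult_op \<phi> (da_mono (\<lambda>_. 0))"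

lemma da_eval_symbol: "\<phi> \<in> multipliers \<Longrightarrow> z \<in> ball 0 1 \<Longrightarrow> da_eval (symbol \<phi>) z = \<phi> z"
  by (simp add: symbol_def da_eval_mult_op da_eval_mono zpow_def)

definition hom_part :: "nat \<Rightarrow> (complex^'d::finite \<Rightarrow> complex) \<Rightarrow> complex^'d \<Rightarrow> complex" where
  "hom_part n \<phi> = (\<lambda>z\<in>ball 0 1. da_eval (hpart n (symbol \<phi>)) z)"

lemma hom_part_polys:
  fixes \<phi> :: "complex^'d::finite \<Rightarrow> complex"
  shows "hom_part n \<phi> \<in> polys"
proof -
  have "da_eval (hpart n f) z = (\<Sum>\<alpha> | deg \<alpha> = n. da_coeff f \<alpha> * zpow \<alpha> z)"
    for f :: "'d drury_arveson" and z
  proof -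
    have "da_eval (hpart n f) z = (\<Sum>\<^sub>\<infinity>\<alpha>\<in>{\<alpha>. deg \<alpha> = n}. da_coeff f \<alpha> * zpow \<alpha> z)"
      unfolding da_eval_def zpow_def[symmetric]
      by (rule infsum_cong_neutral) (auto simp: da_part.rep_eq)
    then show ?thesis by simp
  qed
  then have "hom_part n \<phi> = (\<lambda>z\<in>ball 0 1. \<Sum>\<alpha> | deg \<alpha> = n.
      (\<lambda>z\<in>ball 0 1. da_coeff (symbol \<phi>) \<alpha> * (\<lambda>z\<in>ball 0 1. zpow \<alpha> z) z) z)"
    unfolding hom_part_def by (intro restrict_ext) simp
  then show ?thesis using sum_polys[OF finite_deg scale_polys[OF zpow_polys]] by simp
qed

lemma zpow_scale: "zpow \<alpha> (t *s z) = t ^ deg \<alpha> * zpow \<alpha> z"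
  by (simp add: zpow_def power_mult_distrib prod.distrib power_sum)

lemma norm_vector_scale: "norm (t *s z) = cmod t * norm (z :: complex^'d)"
  unfolding norm_vec_def by (simp add: norm_mult L2_set_right_distrib)

text \<open>In the grading by degree M_\<phi> is lower triangular, and its block from degree i to
  degree l is multiplication by the part of \<phi> of degree l - i. Both sides are compared as
  coefficients of power series in t along the points t z.\<close>

lemma hpart_mult_op:
  fixes f :: "'d::finite drury_arveson"
  assumes \<phi>: "\<phi> \<in> multipliers"
  shows "hpart l (mult_op \<phi> (hpart i f)) = (if i \<le>
      l then mult_op (hom_part (l - i) \<phi>) (hpart i f) else 0)"
proof (rule da_eval_eqI)
  fix z :: "complex^'d" assume z: "z \<in> ball 0 1"
  let ?f = "hpart i f"
  define b where "b n = (if i \<le> n then hom_part (n - i) \<phi> z * da_eval ?f z else 0)" for n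
  have "da_eval (hpart l (mult_op \<phi> ?f)) z - b l = 0"
  proof (rule powser_coeff_zero[where a="\<lambda>n. da_eval (hpart n (mult_op \<phi> ?f)) z - b n"])
    fix t :: complex assume t: "cmod t < 1"
    have "norm (t *s z) \<le> norm z"
      using t unfolding norm_vector_scale by (intro mult_left_le_one_le) auto
    then have z': "t *s z \<in> ball 0 1" using z by simp
    note part = da_eval_part_sums[OF z z', of t "\<lambda>\<alpha>. deg \<alpha>", OF zpow_scale]
    have "(\<lambda>n. da_eval (hpart n ?f) z * t ^ n) = (\<lambda>n. if n = i then da_eval ?f z * t ^ n else 0)"
      using z by (auto simp: hpart_hpart da_eval_kernel)
    with part[of ?f] have "(\<lambda>n. if n = i then da_eval ?f z * t ^ n else 0) sums da_eval ?f (t *s z)"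
      by simp
    then have f: "da_eval ?f (t *s z) = da_eval ?f z * t ^ i"
      using sums_single[of i "\<lambda>n. da_eval ?f z * t ^ n"] sums_unique2 by blast
    have "(\<lambda>n. hom_part n \<phi> z * t ^ n) sums \<phi> (t *s z)"
      using part[of "symbol \<phi>"] z z' by (simp add: hom_part_def da_eval_symbol[OF \<phi>])
    then have "(\<lambda>n. hom_part n \<phi> z * t ^ n * (da_eval ?f z * t ^ i)) sums
        (\<phi> (t *s z) * (da_eval ?f z * t ^ i))"
      by (rule sums_mult2)
    then have "(\<lambda>n. b (n + i) * t ^ (n + i)) sums (da_eval (mult_op \<phi> ?f) (t *s z))"
      by (simp add: b_def da_eval_mult_op[OF \<phi> z'] f power_add mult_ac)
    then have "(\<lambda>n. b n * t ^ n) sums (da_eval (mult_op \<phi> ?f) (t *s z))"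
      by (rule sums_zero_iff_shift[THEN iffD1, rotated]) (simp add: b_def)
    from sums_diff[OF part[of "mult_op \<phi> ?f"] this]
    show "(\<lambda>n. (da_eval (hpart n (mult_op \<phi> ?f)) z - b n) * t ^ n) sums 0"
      by (simp add: left_diff_distrib)
  qed
  then show "da_eval (hpart l (mult_op \<phi> ?f)) z =
      da_eval (if i \<le> l then mult_op (hom_part (l - i) \<phi>) ?f else 0) z"
    using z by (simp add: b_def da_eval_mult_op polys_multipliers[OF hom_part_polys])
qed

section \<open>Fejer means of a multiplier\<close>

definition fejer :: "nat \<Rightarrow> (complex^'d::finite \<Rightarrow> complex) \<Rightarrow> complex^'d \<Rightarrow> complex" where
  "fejer N \<phi> = (\<lambda>z\<in>ball 0 1. \<Sum>j<N. (\<lambda>z\<in>ball 0 1. of_real (1 - j / N) * hom_part j \<phi> z) z)"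

lemma fejer_polys: "fejer N \<phi> \<in> polys"
  unfolding fejer_def by (intro sum_polys scale_polys hom_part_polys) simp

lemma da_eval_sum: "z \<in> ball 0 1 \<Longrightarrow> da_eval (\<Sum>i\<in>F. f i) z = (\<Sum>i\<in>F. da_eval (f i) z)"
  by (simp add: da_eval_kernel cinner_sum_left)

lemma mult_op_fejer:
  "mult_op (fejer N \<phi>) f = (\<Sum>j<N. of_real (1 - j / N) *\<^sub>C mult_op (hom_part j \<phi>) f)"
  by (rule mult_op_eqI)
    (simp add: fejer_def da_eval_sum da_eval_linear da_eval_mult_op polys_multipliers[OF
        hom_part_polys]
      sum_distrib_right mult.assoc)

text \<open>The factor by which the Fejer mean scales the block of M_\<phi> from degree i to degree
  l.\<close>

definition fejer_coeff :: "nat \<Rightarrow> nat \<Rightarrow> nat \<Rightarrow> real" where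
  "fejer_coeff N i l = (if i \<le> l \<and> l - i < N then 1 - (l - i) / N else 0)"

lemma cinner_mult_op_fejer:
  fixes f g :: "'d::finite drury_arveson"
  assumes \<phi>: "\<phi> \<in> multipliers"
  shows "cinner (mult_op (fejer N \<phi>) (hpart i f)) (hpart l g) =
    of_real (fejer_coeff N i l) * cinner (mult_op \<phi> (hpart i f)) (hpart l g)"
proof -
  have hom: "mult_op (hom_part j \<phi>) (hpart i f) = hpart (i + j) (mult_op \<phi> (hpart i f))" for j
    by (simp add: hpart_mult_op[OF \<phi>])
  have "cinner (mult_op (fejer N \<phi>) (hpart i f)) (hpart l g) =
      (\<Sum>j<N. of_real (1 - j / N) * cinner (hpart (i + j) (mult_op \<phi> (hpart i f))) (hpart l g))"
    unfolding mult_op_fejer cinner_sum_left cinner_scaleC_left hom ..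
  also have "\<dots> = (\<Sum>j<N. if l =
      i + j then of_real (1 - j / N) * cinner (mult_op \<phi> (hpart i f)) (hpart l g) else 0)"
    by (rule sum.cong)
      (simp_all add: cinner_hpart cinner_da_part[of _ "mult_op \<phi> (hpart i f)" g])
  also have "\<dots> = of_real (fejer_coeff N i l) * cinner (mult_op \<phi> (hpart i f)) (hpart l g)"
  proof (cases "i \<le> l")
    case True
    then have "(l = i + j) = (j = l - i)" for j by auto
    then show ?thesis using True by (simp add: fejer_coeff_def of_nat_diff)
  qed (simp add: fejer_coeff_def)
  finally show ?thesis .
qed

lemma cinner_mult_op_hpart_less:
  assumes "\<phi> \<in> multipliers" "l < i"
  shows "cinner (mult_op \<phi> (hpart i f)) (hpart l g) = 0"
  using hpart_mult_op[OF assms(1), of l i f] assms(2) by (simp flip: cinner_da_part)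

text \<open>The Fejer coefficients are averages over windows of length \<open>N\<close>: the compression of \<open>M\<^sub>\<phi>\<close> to
  each window has norm at most that of \<open>M\<^sub>\<phi>\<close>, and each degree lies in exactly \<open>N\<close> windows.\<close>

lemma norm_cinner_fejer_le:
  fixes f g :: "'d::finite drury_arveson"
  assumes \<phi>: "\<phi> \<in> multipliers" and N: "N > 0"
    and C: "C \<ge> 0" "\<And>f. norm (mult_op \<phi> f) \<le> C * norm f"
  shows "cmod (cinner (mult_op (fejer N \<phi>) (trunc D f)) (trunc D g)) \<le> C * norm f * norm g"
proof -
  \<comment> \<open>Windows of N consecutive degrees ending at s, cut off at \<open>D\<close>. Each
    i < D lies in the windows s = i, ..., i + N - 1, all below D + N. Degrees i \<le> l share i + N
    - l of them (none if this is negative), which is N times their Fejer coefficient.\<close>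
  define I where "I s = {i. i < D \<and> i \<le> s \<and> s < i + N}" for s
  have fin: "finite (I s)" for s by (simp add: I_def)
  define Q where "Q s = da_part {\<alpha> :: 'd \<Rightarrow> nat. deg \<alpha> \<in> I s}" for s
  have Q: "Q s h = (\<Sum>i<D. if i \<in> I s then hpart i h else 0)" for s h
    unfolding Q_def da_part_deg_sum[OF fin]
    by (simp add: sum.inter_filter[symmetric] I_def)
  have Q2: "(\<Sum>s<D+N. (norm (Q s h))\<^sup>2) \<le> N * (norm h)\<^sup>2" for h
  proof -
    have "(\<Sum>s<D+N. (norm (Q s h))\<^sup>2) = (\<Sum>s<D+N. \<Sum>i<D. if i \<in> I s then level i h else 0)"
      unfolding Q_def norm_da_part_deg[OF fin]
      by (simp add: sum.inter_filter[symmetric] I_def)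
    also have "\<dots> = (\<Sum>i<D. \<Sum>s<D+N. if i \<in> I s then level i h else 0)" by (rule sum.swap)
    also have "\<dots> = (\<Sum>i<D. N * level i h)"
    proof (rule sum.cong[OF refl])
      fix i assume "i \<in> {..<D}"
      then have "{s \<in> {..<D+N}. i \<in> I s} = {i..<i+N}" by (auto simp: I_def)
      then show "(\<Sum>s<D+N. if i \<in> I s then level i h else 0) = N * level i h"
        by (simp add: sum.inter_filter[symmetric])
    qed
    also have "\<dots> \<le> N * (norm h)\<^sup>2"
      unfolding sum_distrib_left[symmetric]
      using sum_le_suminf[of "\<lambda>n. level n h" "{..<D}"] level_sums[of h]
      by (intro mult_left_mono) (auto simp: sums_iff level_nonneg)
    finally show ?thesis .
  qed
  have coeff: "of_nat N * cinner (mult_op (fejer N \<phi>) (hpart i f)) (hpart l g) =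
      (\<Sum>s<D+N. if i \<in> I s \<and> l \<in> I s then cinner (mult_op \<phi> (hpart i f)) (hpart l g) else 0)"
    if "i < D" "l < D" for i l
  proof (cases "i \<le> l")
    case True
    then have "{s \<in> {..<D+N}. i \<in> I s \<and> l \<in> I s} = {l..<i+N}" using that by (auto simp: I_def)
    then have "(\<Sum>s<D+N. if i \<in> I s \<and> l \<in> I s then cinner (mult_op \<phi> (hpart i f)) (hpart l g) else 0)
        = of_nat (i + N - l) * cinner (mult_op \<phi> (hpart i f)) (hpart l g)"
      by (simp add: sum.inter_filter[symmetric])
    moreover have "real N * fejer_coeff N i l = real (i + N - l)"
      using True N by (auto simp: fejer_coeff_def field_simps of_nat_diff)
    then have "of_nat N * complex_of_real (fejer_coeff N i l) = of_nat (i + N - l)"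
      by (metis of_real_mult of_real_of_nat_eq)
    ultimately show ?thesis by (simp add: cinner_mult_op_fejer[OF \<phi>] mult.assoc[symmetric])
  next
    case False
    then have "cinner (mult_op \<phi> (hpart i f)) (hpart l g) = 0"
      by (intro cinner_mult_op_hpart_less[OF \<phi>]) simp
    then show ?thesis by (simp add: cinner_mult_op_fejer[OF \<phi>] cong: if_cong)
  qed
  have cbf: "cblinear (mult_op (fejer N \<phi>))"
    by (rule cblinear_mult_op[OF polys_multipliers[OF fejer_polys]])
  have cb: "cblinear (mult_op \<phi>)" by (rule cblinear_mult_op[OF \<phi>])
  have "of_nat N * cinner (mult_op (fejer N \<phi>) (trunc D f)) (trunc D g) =
      (\<Sum>i<D. \<Sum>l<D. of_nat N * cinner (mult_op (fejer N \<phi>) (hpart i f)) (hpart l g))"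
    unfolding trunc_sum cblinear_sum[OF cbf] cinner_sum_sum
    by (simp add: sum_distrib_left)
  also have "\<dots> = (\<Sum>i<D. \<Sum>l<D. \<Sum>s<D+N. if i \<in> I s \<and> l \<in> I s
      then cinner (mult_op \<phi> (hpart i f)) (hpart l g) else 0)"
    by (intro sum.cong refl coeff) auto
  also have "\<dots> = (\<Sum>s<D+N. \<Sum>i<D. \<Sum>l<D. if i \<in> I s \<and> l \<in> I s
      then cinner (mult_op \<phi> (hpart i f)) (hpart l g) else 0)"
    unfolding sum.swap[of _ "{..<D+N}" "{..<D}"] ..
  also have "\<dots> = (\<Sum>s<D+N. cinner (mult_op \<phi> (Q s f)) (Q s g))"
    unfolding Q cblinear_sum[OF cb] cinner_sum_sum
    by (intro sum.cong refl) (auto simp: cblinear_zero[OF cb])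
  finally have eq: "of_nat N * cinner (mult_op (fejer N \<phi>) (trunc D f)) (trunc D g) =
      (\<Sum>s<D+N. cinner (mult_op \<phi> (Q s f)) (Q s g))" .
  have "N * cmod (cinner (mult_op (fejer N \<phi>) (trunc D f)) (trunc D g)) =
      cmod (\<Sum>s<D+N. cinner (mult_op \<phi> (Q s f)) (Q s g))"
    unfolding eq[symmetric] by (simp add: norm_mult)
  also have "\<dots> \<le> (\<Sum>s<D+N. C * (norm (Q s f) * norm (Q s g)))"
  proof (rule sum_norm_le)
    fix s
    have "cmod (cinner (mult_op \<phi> (Q s f)) (Q s g)) \<le> norm (mult_op \<phi> (Q s f)) * norm (Q s g)"
      by (rule cinner_cauchy_schwarz)
    also have "\<dots> \<le> (C * norm (Q s f)) * norm (Q s g)" by (intro mult_right_mono C) simp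
    finally show "cmod (cinner (mult_op \<phi> (Q s f)) (Q s g)) \<le> C * (norm (Q s f) * norm (Q s g))"
      by (simp add: mult.assoc)
  qed
  also have "\<dots> = C * (\<Sum>s<D+N. \<bar>norm (Q s f)\<bar> * \<bar>norm (Q s g)\<bar>)" by (simp add: sum_distrib_left)
  \<comment> \<open>Cauchy-Schwarz over the windows; by \<open>Q2\<close> each of the two factors
    contributes a square root of N, which cancels the N on the left.\<close>
  also have "\<dots> \<le> C * (L2_set (\<lambda>s. norm (Q s f)) {..<D+N} * L2_set (\<lambda>s. norm (Q s g)) {..<D+N})"
    by (intro mult_left_mono L2_set_mult_ineq C)
  also have "\<dots> \<le> C * (sqrt (N * (norm f)\<^sup>2) * sqrt (N * (norm g)\<^sup>2))"
    unfolding L2_set_def by (intro mult_left_mono mult_mono real_sqrt_le_mono Q2 C) (auto intro: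
        sum_nonneg)
  also have "\<dots> = N * (C * norm f * norm g)" by (simp add: real_sqrt_mult)
  finally show ?thesis using N by simp
qed

text \<open>The uniform bound is part of the notion because it upgrades weak operator convergence to
  weak-* convergence.\<close>

definition wot_conv ::
    "(nat \<Rightarrow> complex^'d::finite \<Rightarrow> complex) \<Rightarrow> (complex^'d \<Rightarrow> complex) \<Rightarrow> bool" where
  "wot_conv q \<phi> \<longleftrightarrow> (\<exists>C. \<forall>n f. norm (mult_op (q n) f) \<le> C * norm f) \<and>
     (\<forall>f g. (\<lambda>n. cinner (mult_op (q n) f) g) \<longlonglongrightarrow> cinner (mult_op \<phi> f) g)"

lemma fejer_wot_conv:
  fixes \<phi> :: "complex^'d::finite \<Rightarrow> complex"
  assumes \<phi>: "\<phi> \<in> multipliers"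
  shows "wot_conv (\<lambda>n. fejer (Suc n) \<phi>) \<phi>"
proof -
  let ?M = "\<lambda>n. mult_op (fejer (Suc n) \<phi>)"
  have cb: "cblinear (mult_op \<phi>)" by (rule cblinear_mult_op[OF \<phi>])
  have cbn: "cblinear (?M n)" for n
    by (rule cblinear_mult_op[OF polys_multipliers[OF fejer_polys]])
  obtain C where C: "C \<ge> 0" "\<And>f. norm (mult_op \<phi> f) \<le> C * norm f"
    using mult_op_bound[OF \<phi>] by metis
  have bd: "cmod (cinner (?M n f) g) \<le> C * norm f * norm g" for n f g
  proof (rule LIMSEQ_le_const2)
    show "(\<lambda>D. cmod (cinner (?M n (trunc D f)) (trunc D g))) \<longlonglongrightarrow> cmod (cinner (?M n f) g)"
      by (intro tendsto_norm tendsto_cinner trunc_tendsto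
          bounded_linear.tendsto[OF cblinear_bounded_linear[OF cbn]])
  qed (use norm_cinner_fejer_le[OF \<phi> _ C] in auto)
  have le: "norm (?M n f) \<le> C * norm f" for n f
    using bd[of n f "?M n f"] C(1)
    by (cases "?M n f = 0") (auto simp: cinner_self norm_mult power2_eq_square)
  have conv: "(\<lambda>n. cinner (?M n f) g) \<longlonglongrightarrow> cinner (mult_op \<phi> f) g" for f g
  proof (rule metric_LIMSEQ_I)
    fix e :: real assume e: "e > 0"
    \<comment> \<open>Half of \<open>R D\<close> bounds the error of truncating both vectors, for
      any operator bounded by \<open>C\<close>; the Fejer operator and its limit use one half
      each.\<close>
    define R where "R D = 2 * C * norm (f - trunc D f) * norm g + 2 * C * norm f * norm (g
        - trunc D g)" for D
    have "R \<longlonglongrightarrow> 2 * C * norm (f - f) * norm g + 2 * C * norm f * norm (g - g)"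
      unfolding R_def by (intro tendsto_intros trunc_tendsto)
    then have "\<forall>\<^sub>F D in sequentially. R D < e / 2" using e by (intro order_tendstoD(2)) auto
    then obtain D where D: "R D < e / 2" by (auto simp: eventually_sequentially)
    have "(\<lambda>n. \<Sum>i<D. \<Sum>l<D. of_real (fejer_coeff (Suc n) i l) * cinner (mult_op \<phi> (hpart i f)) (hpart
        l g))
        \<longlonglongrightarrow> (\<Sum>i<D. \<Sum>l<D. cinner (mult_op \<phi> (hpart i f)) (hpart l g))"
    proof (intro tendsto_sum)
      fix i l
      show "(\<lambda>n. of_real (fejer_coeff (Suc n) i l) * cinner (mult_op \<phi> (hpart i f)) (hpart l g))
          \<longlonglongrightarrow> cinner (mult_op \<phi> (hpart i f)) (hpart l g)"
      proof (cases "i \<le> l")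
        case True
        have "(\<lambda>n. 1 - real (l - i) * inverse (real (Suc n))) \<longlonglongrightarrow> 1 - real (l - i) * 0"
          by (intro tendsto_intros LIMSEQ_inverse_real_of_nat)
        then have "(\<lambda>n. 1 - real (l - i) * inverse (real (Suc n))) \<longlonglongrightarrow> 1" by simp
        then have "(\<lambda>n. fejer_coeff (Suc n) i l) \<longlonglongrightarrow> 1"
        proof (rule Lim_transform_eventually)
          show "\<forall>\<^sub>F n in sequentially. 1 - real (l - i) * inverse (real (Suc n)) =
              fejer_coeff (Suc n) i l"
            using True by (auto simp: fejer_coeff_def eventually_sequentially divide_inverse
                of_nat_diff
                intro!: exI[of _ l])
        qed
        then have "(\<lambda>n. complex_of_real (fejer_coeff (Suc n) i l)) \<longlonglongrightarrow> of_real 1"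
          by (rule tendsto_of_real)
        then show ?thesis using tendsto_mult[OF _ tendsto_const] by fastforce
      qed (simp add: cinner_mult_op_hpart_less[OF \<phi>])
    qed
    then have "(\<lambda>n. cinner (?M n (trunc D f)) (trunc D g)) \<longlonglongrightarrow>
        cinner (mult_op \<phi> (trunc D f)) (trunc D g)"
      unfolding trunc_sum cblinear_sum[OF cbn] cblinear_sum[OF cb] cinner_sum_sum
      by (simp add: cinner_mult_op_fejer[OF \<phi>])
    from metric_LIMSEQ_D[OF this half_gt_zero[OF e]] obtain n0 where n0: "\<And>n. n \<ge> n0 \<Longrightarrow>
        cmod (cinner (?M n (trunc D f)) (trunc D g) - cinner (mult_op \<phi> (trunc D f)) (trunc D g)) <
            e / 2"
      unfolding dist_norm by blast
    have trunc_err: "cmod (cinner (A f) g - cinner (A (trunc D f)) (trunc D g)) \<le> R D / 2"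
      if A: "cblinear A" "\<And>f. norm (A f) \<le> C * norm f" for A ::
        "'d drury_arveson \<Rightarrow> 'd drury_arveson"
    proof -
      have "cinner (A f) g - cinner (A (trunc D f)) (trunc D g) =
          cinner (A (f - trunc D f)) g + cinner (A (trunc D f)) (g - trunc D g)"
        by (simp add: cblinear_diff[OF A(1)] cinner_diff_left cinner_diff_right)
      also have "cmod \<dots> \<le>
          norm (A (f - trunc D f)) * norm g + norm (A (trunc D f)) * norm (g - trunc D g)"
        by (intro norm_triangle_le add_mono cinner_cauchy_schwarz)
      also have "\<dots> \<le> (C * norm (f - trunc D f)) * norm g + (C * norm f) * norm (g - trunc D g)"
        using order_trans[OF A(2) mult_left_mono[OF norm_trunc_le C(1)]]
        by (intro add_mono mult_right_mono A) auto
      finally show ?thesis by (simp add: R_def)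
    qed
    have norm3: "norm (a + b - c) \<le> norm a + norm b + norm c" for a b c :: complex
      using norm_triangle_ineq4[of "a + b" c] norm_triangle_ineq[of a b] by linarith
    have "dist (cinner (?M n f) g) (cinner (mult_op \<phi> f) g) < e" if "n \<ge> n0" for n
    proof -
      have "cinner (?M n f) g - cinner (mult_op \<phi> f) g =
          (cinner (?M n f) g - cinner (?M n (trunc D f)) (trunc D g)) +
          (cinner (?M n (trunc D f)) (trunc D g) - cinner (mult_op \<phi> (trunc D f)) (trunc D g)) -
          (cinner (mult_op \<phi> f) g - cinner (mult_op \<phi> (trunc D f)) (trunc D g))" by simp
      then have "dist (cinner (?M n f) g) (cinner (mult_op \<phi> f) g) \<le>
          cmod (cinner (?M n f) g - cinner (?M n (trunc D f)) (trunc D g)) +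
          cmod (cinner (?M n (trunc D f)) (trunc D g)
              - cinner (mult_op \<phi> (trunc D f)) (trunc D g)) +
          cmod (cinner (mult_op \<phi> f) g - cinner (mult_op \<phi> (trunc D f)) (trunc D g))"
        unfolding dist_norm using norm3 by metis
      then show ?thesis
        using trunc_err[OF cbn le, of n] trunc_err[OF cb C(2)] n0[OF that] D by linarith
    qed
    then show "\<exists>no. \<forall>n\<ge>no. dist (cinner (?M n f) g) (cinner (mult_op \<phi> f) g) < e" by blast
  qed
  show ?thesis unfolding wot_conv_def using le conv by blast
qed

text \<open>Tannery's theorem with the dominating series of C |f i| |g i|: convergence passes from
  rank one functionals to trace class ones.\<close>

lemma wot_conv_suminf:
  assumes q: "wot_conv q \<phi>"
    and f: "summable (\<lambda>i. (norm (f i))\<^sup>2)" and g: "summable (\<lambda>i. (norm (g i))\<^sup>2)"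
  shows "(\<lambda>n. \<Sum>i. cinner (mult_op (q n) (f i)) (g i)) \<longlonglongrightarrow> (\<Sum>i. cinner (mult_op \<phi> (f i)) (g i))"
proof -
  obtain C where C: "\<And>n f. norm (mult_op (q n) f) \<le> C * norm f"
    using q unfolding wot_conv_def by blast
  show ?thesis
  proof (rule tannerys_theorem[where M="\<lambda>i. C * (norm (f i) * norm (g i))", THEN conjunct2,
      THEN conjunct2])
    show "((\<lambda>n. cinner (mult_op (q n) (f k)) (g k)) \<longlongrightarrow> cinner (mult_op \<phi> (f k)) (g k)) sequentially"
      for k
      using q unfolding wot_conv_def by blast
    have "norm (cinner (mult_op (q n) (f k)) (g k)) \<le> C * (norm (f k) * norm (g k))" for k n
      using order_trans[OF cinner_cauchy_schwarz mult_right_mono[OF C norm_ge_zero]]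
      by (simp add: mult.assoc)
    then show "\<forall>\<^sub>F (k, n) in sequentially \<times>\<^sub>F sequentially.
        norm (cinner (mult_op (q n) (f k)) (g k)) \<le> C * (norm (f k) * norm (g k))"
      by (intro always_eventually) auto
    show "summable (\<lambda>i. C * (norm (f i) * norm (g i)))"
      by (intro summable_mult summable_cinner f g)
  qed simp
qed

section \<open>The functional calculus\<close>

lemma limitin_topology_generated_byI:
  assumes "l \<in> \<Union>S" and "\<And>U. U \<in> S \<Longrightarrow> l \<in> U \<Longrightarrow> \<forall>\<^sub>F x in F. f x \<in> U"
  shows "limitin (topology_generated_by S) f l F"
  unfolding limitin_def
proof (intro conjI allI impI)
  show "l \<in> topspace (topology_generated_by S)" using assms(1)
    by (simp add: topology_generated_by_topspace)
  fix U assume "openin (topology_generated_by S) U \<and> l \<in> U"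
  then have "generate_topology_on S U" "l \<in> U" by (auto dest: openin_topology_generated_by)
  then show "\<forall>\<^sub>F x in F. f x \<in> U"
  proof (induction rule: generate_topology_on.induct)
    case (Int a b)
    then show ?case by (auto intro: eventually_conj)
  next
    case (UN K)
    then obtain k where "k \<in> K" "l \<in> k" by blast
    then show ?case using UN.IH[of k] by (auto elim: eventually_mono)
  qed (auto intro: assms(2))
qed

lemma topspace_weak_star:
  assumes "0 \<in> S" shows "topspace (weak_star S) = bounded_ops S S"
proof -
  have "bounded_ops S S \<in> {{A \<in> bounded_ops S S. (\<Sum>n. cinner (A (\<xi> n)) (\<eta> n)) \<in> U} | \<xi> \<eta> U.
        range \<xi> \<subseteq> S \<and> range \<eta> \<subseteq> S \<and>
        summable (\<lambda>n. (norm (\<xi> n))\<^sup>2) \<and> summable (\<lambda>n. (norm (\<eta> n))\<^sup>2) \<and> open U}"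
    using assms by (intro CollectI exI[of _ "\<lambda>_. 0"] exI[of _ UNIV]) auto
  then show ?thesis unfolding weak_star_def topology_generated_by_topspace by blast
qed

lemma topspace_mult_weak_star: "topspace mult_weak_star = multipliers"
  using cblinear_mult_op
  by (auto simp: mult_weak_star_def topspace_pullback_topology topspace_weak_star
      bounded_ops_UNIV_iff)

lemma wot_conv_limitin:
  assumes q: "\<And>n. q n \<in> multipliers" and \<phi>: "\<phi> \<in> multipliers" and conv: "wot_conv q \<phi>"
  shows "limitin mult_weak_star q \<phi> sequentially"
proof -
  have "limitin (weak_star UNIV) (\<lambda>n. mult_op (q n)) (mult_op \<phi>) sequentially"
    unfolding weak_star_def
  proof (rule limitin_topology_generated_byI, goal_cases)
    case 1
    then show ?case
      using topspace_weak_star[of "UNIV :: 'a drury_arveson set"] cblinear_mult_op[OF \<phi>]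
      by (simp add: bounded_ops_UNIV_iff weak_star_def topology_generated_by_topspace)
  next
    case (2 W)
    then obtain \<xi> \<eta> U where W: "W = {A \<in> bounded_ops UNIV UNIV. (\<Sum>n. cinner (A (\<xi> n)) (\<eta> n)) \<in> U}"
      and s: "summable (\<lambda>n. (norm (\<xi> n))\<^sup>2)" "summable (\<lambda>n. (norm (\<eta> n))\<^sup>2)" and U: "open U"
      by blast
    have "\<forall>\<^sub>F n in sequentially. (\<Sum>i. cinner (mult_op (q n) (\<xi> i)) (\<eta> i)) \<in> U"
      using 2(2) by (intro topological_tendstoD[OF wot_conv_suminf[OF conv s] U]) (simp add: W)
    then show ?case using cblinear_mult_op[OF q] by (simp add: W bounded_ops_UNIV_iff)
  qed
  then show ?thesis
    using q \<phi> unfolding mult_weak_star_def limitin_def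
    by (auto simp: openin_pullback_topology topspace_pullback_topology)
qed

lemma weak_star_limitD:
  assumes lim: "limitin (weak_star S) A L F" and S: "0 \<in> S" "x \<in> S" "y \<in> S"
  shows "((\<lambda>n. cinner (A n x) y) \<longlongrightarrow> cinner (L x) y) F"
proof (rule topological_tendstoI)
  fix U assume U: "open U" "cinner (L x) y \<in> U"
  \<comment> \<open>Sequences supported at index 0 produce the rank one functional given by x and
    y.\<close>
  define \<xi> \<eta> where "\<xi> n = (if n = 0 then x else 0)" and
    "\<eta> n = (if n = 0 then y else 0)" for n :: nat
  have eq: "(\<Sum>n. cinner (B (\<xi> n)) (\<eta> n)) = cinner (B x) y" for B :: "'a \<Rightarrow> 'a"
    by (subst suminf_finite[of "{0}"]) (auto simp: \<xi>_def \<eta>_def)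
  have sm: "summable (\<lambda>n. (norm (\<xi> n))\<^sup>2)" "summable (\<lambda>n. (norm (\<eta> n))\<^sup>2)"
    by (rule summable_finite[of "{0}"]; simp add: \<xi>_def \<eta>_def)+
  define W where "W = {B \<in> bounded_ops S S. (\<Sum>n. cinner (B (\<xi> n)) (\<eta> n)) \<in> U}"
  have "openin (weak_star S) W"
    unfolding weak_star_def W_def
    by (intro topology_generated_by_Basis CollectI exI[of _ \<xi>] exI[of _ \<eta>] exI[of _ U])
      (use S U sm in \<open>auto simp: \<xi>_def \<eta>_def\<close>)
  moreover have "L \<in> W"
    using limitin_topspace[OF lim] U by (simp add: topspace_weak_star[OF S(1)] W_def eq)
  ultimately have "\<forall>\<^sub>F n in F. A n \<in> W" using lim by (simp add: limitin_def)
  then show "\<forall>\<^sub>F n in F. cinner (A n x) y \<in> U" by (auto simp: W_def eq elim: eventually_mono)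
qed

section \<open>Uniqueness of the calculus\<close>

lemma is_calculusD:
  assumes "is_calculus S T \<Phi>"
  shows "\<phi> \<in> multipliers \<Longrightarrow> \<Phi> \<phi> \<in> bounded_ops S S"
    "\<Phi> (\<lambda>z\<in>ball 0 1. 1) = (\<lambda>x\<in>S. x)"
    "\<phi> \<in> multipliers \<Longrightarrow> \<psi> \<in> multipliers \<Longrightarrow> \<Phi> (\<lambda>z\<in>ball 0 1. \<phi> z + \<psi> z) = (\<lambda>x\<in>S. \<Phi> \<phi> x + \<Phi> \<psi> x)"
    "\<phi> \<in> multipliers \<Longrightarrow> \<psi> \<in> multipliers \<Longrightarrow> \<Phi> (\<lambda>z\<in>ball 0 1. \<phi> z * \<psi> z) = compose S (\<Phi> \<phi>) (\<Phi> \<psi>)"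
    "\<phi> \<in> multipliers \<Longrightarrow> \<Phi> (\<lambda>z\<in>ball 0 1. c * \<phi> z) = (\<lambda>x\<in>S. c *\<^sub>C \<Phi> \<phi> x)"
    "continuous_map mult_weak_star (weak_star S) \<Phi>"
    "\<Phi> (coord k) = T k"
  using assms unfolding is_calculus_def by (blast dest: PiE_mem)+

lemma is_calculus_const:
  fixes \<Phi> :: "(complex^'d::finite \<Rightarrow> complex) \<Rightarrow> 'a::complex_hilbert \<Rightarrow> 'a"
  assumes "is_calculus S T \<Phi>"
  shows "\<Phi> (\<lambda>z\<in>ball 0 1. c) = (\<lambda>x\<in>S. c *\<^sub>C x)"
proof -
  have "(\<lambda>z\<in>ball 0 1. c) = (\<lambda>z :: complex^'d\<in>ball 0 1. c * (\<lambda>z\<in>ball 0 1. 1) z)"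
    by (rule restrict_ext) simp
  then have "\<Phi> (\<lambda>z\<in>ball 0 1. c) = (\<lambda>x\<in>S. c *\<^sub>C \<Phi> (\<lambda>z\<in>ball 0 1. 1) x)"
    using is_calculusD(5)[OF assms const_multiplier[of 1], where c=c] by (simp only:)
  then show ?thesis unfolding is_calculusD(2)[OF assms] by (simp cong: restrict_cong)
qed

lemma is_calculus_fejer_tendsto:
  assumes \<Phi>: "is_calculus S T \<Phi>" and \<phi>: "\<phi> \<in> multipliers" and S: "0 \<in> S" "x \<in> S" "y \<in> S"
  shows "(\<lambda>n. cinner (\<Phi> (fejer (Suc n) \<phi>) x) y) \<longlonglongrightarrow> cinner (\<Phi> \<phi> x) y"
proof (rule weak_star_limitD[OF _ S])
  have "limitin mult_weak_star (\<lambda>n. fejer (Suc n) \<phi>) \<phi> sequentially"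
    by (intro wot_conv_limitin fejer_wot_conv polys_multipliers[OF fejer_polys] \<phi>)
  from continuous_map_limit[OF is_calculusD(6)[OF \<Phi>] this]
  show "limitin (weak_star S) (\<lambda>n. \<Phi> (fejer (Suc n) \<phi>)) (\<Phi> \<phi>) sequentially" by (simp add: o_def)
qed

text \<open>The algebraic rules fix the values on polynomials, and weak-* continuity carries the
  agreement along the Fejer polynomials.\<close>

lemma is_calculus_unique:
  assumes S: "cvec.subspace S" and \<Phi>: "is_calculus S T \<Phi>" and \<Psi>: "is_calculus S T \<Psi>"
  shows "\<Phi> = \<Psi>"
proof (rule extensionalityI)
  show "\<Phi> \<in> extensional multipliers" "\<Psi> \<in> extensional multipliers"
    using \<Phi> \<Psi> by (auto simp: is_calculus_def PiE_def)
  have polys: "\<Phi> p = \<Psi> p" if "p \<in> polys" for p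
    using that
  proof (induction rule: polys.induct)
    case (const c)
    show ?case unfolding is_calculus_const[OF \<Phi>] is_calculus_const[OF \<Psi>] ..
  next
    case (coord k)
    show ?case using is_calculusD(7)[OF \<Phi>] is_calculusD(7)[OF \<Psi>] by simp
  next
    case (add p q)
    note m = add.hyps[THEN polys_multipliers]
    show ?case unfolding is_calculusD(3)[OF \<Phi> m] is_calculusD(3)[OF \<Psi> m] add.IH ..
  next
    case (times p q)
    note m = times.hyps[THEN polys_multipliers]
    show ?case unfolding is_calculusD(4)[OF \<Phi> m] is_calculusD(4)[OF \<Psi> m] times.IH ..
  qed
  fix \<phi> :: "complex^'b \<Rightarrow> complex" assume \<phi>: "\<phi> \<in> multipliers"
  have ext: "\<Phi> \<phi> \<in> S \<rightarrow>\<^sub>E S" "\<Psi> \<phi> \<in> S \<rightarrow>\<^sub>E S"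
    using is_calculusD(1)[OF \<Phi> \<phi>] is_calculusD(1)[OF \<Psi> \<phi>] by (auto simp: bounded_ops_def)
  show "\<Phi> \<phi> = \<Psi> \<phi>"
  proof (rule extensionalityI[of _ S])
    fix x assume x: "x \<in> S"
    have S0: "0 \<in> S" using S by (simp add: cvec.subspace_def)
    have eq: "cinner (\<Phi> \<phi> x) y = cinner (\<Psi> \<phi> x) y" if "y \<in> S" for y
      using is_calculus_fejer_tendsto[OF \<Phi> \<phi> S0 x that] is_calculus_fejer_tendsto[OF \<Psi> \<phi> S0 x that]
      unfolding polys[OF fejer_polys] by (rule LIMSEQ_unique)
    have "\<Phi> \<phi> x - \<Psi> \<phi> x \<in> S" using ext x S by (auto intro: cvec.subspace_diff)
    from eq[OF this] have "cinner (\<Phi> \<phi> x - \<Psi> \<phi> x) (\<Phi> \<phi> x - \<Psi> \<phi> x) = 0"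
      by (simp add: cinner_diff_left)
    then show "\<Phi> \<phi> x = \<Psi> \<phi> x" by simp
  qed (use ext in \<open>auto simp: PiE_def\<close>)
qed

section \<open>Double series and matrix norms\<close>

lemma suminf_cauchy_schwarz:
  fixes a b :: "nat \<Rightarrow> real"
  assumes nn: "\<And>n. a n \<ge> 0" "\<And>n. b n \<ge> 0"
    and s: "summable (\<lambda>n. (a n)\<^sup>2)" "summable (\<lambda>n. (b n)\<^sup>2)"
  shows "summable (\<lambda>n. a n * b n)" "(\<Sum>n. a n * b n) \<le> sqrt (\<Sum>n. (a n)\<^sup>2) * sqrt (\<Sum>n. (b n)\<^sup>2)"
proof -
  have le: "(\<Sum>i<n. a i * b i) \<le> sqrt (\<Sum>n. (a n)\<^sup>2) * sqrt (\<Sum>n. (b n)\<^sup>2)" for n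
  proof -
    have "(\<Sum>i<n. a i * b i) \<le> L2_set a {..<n} * L2_set b {..<n}"
      using L2_set_mult_ineq[of a b "{..<n}"] nn by simp
    also have "\<dots> \<le> sqrt (\<Sum>n. (a n)\<^sup>2) * sqrt (\<Sum>n. (b n)\<^sup>2)"
      unfolding L2_set_def using s
      by (intro mult_mono real_sqrt_le_mono sum_le_suminf) (auto intro: sum_nonneg suminf_nonneg)
    finally show ?thesis .
  qed
  show sm: "summable (\<lambda>n. a n * b n)"
    by (rule summableI_nonneg_bounded[OF _ le]) (simp add: nn)
  show "(\<Sum>n. a n * b n) \<le> sqrt (\<Sum>n. (a n)\<^sup>2) * sqrt (\<Sum>n. (b n)\<^sup>2)"
    by (rule suminf_le_const[OF sm le])
qed

lemma summable_prod_decode: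
  fixes a :: "nat \<Rightarrow> nat \<Rightarrow> real"
  assumes nn: "\<And>n i. a n i \<ge> 0" and s: "\<And>n. summable (a n)" "summable (\<lambda>n. suminf (a n))"
  shows "(\<lambda>(n, i). a n i) summable_on UNIV" "summable (\<lambda>m. case prod_decode m of (n, i) \<Rightarrow> a n i)"
proof -
  have "(\<lambda>(n, i). a n i) summable_on UNIV \<times> UNIV"
  proof (rule summable_on_SigmaI[where g="\<lambda>n. suminf (a n)"])
    show "((\<lambda>i. case (n, i) of (n, i) \<Rightarrow> a n i) has_sum suminf (a n)) UNIV" for n
      using sums_nonneg_imp_has_sum[OF summable_sums[OF s(1)[of n]] nn] by simp
    show "(\<lambda>n. suminf (a n)) summable_on UNIV"
      by (rule summable_nonneg_imp_summable_on[OF s(2)]) (simp add: suminf_nonneg s nn)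
  qed (simp add: nn)
  then show *: "(\<lambda>(n, i). a n i) summable_on UNIV" by simp
  then have "(\<lambda>m. case prod_decode m of (n, i) \<Rightarrow> a n i) summable_on UNIV"
    by (simp add: summable_on_reindex_bij_betw[OF bij_prod_decode])
  then show "summable (\<lambda>m. case prod_decode m of (n, i) \<Rightarrow> a n i)" by (rule summable_on_imp_summable)
qed

text \<open>A subbasic set of the weak-* topology uses one sequence of vector pairs, whereas the
  Poisson kernel applied to a sequence yields a double family; the pairing function converts one
  into the other.\<close>

lemma suminf_prod_decode:
  fixes f :: "nat \<Rightarrow> nat \<Rightarrow> complex"
  assumes f: "\<And>n i. cmod (f n i) \<le> a n i" and s: "\<And>n. summable (a n)" "summable (\<lambda>n. suminf (a n))"
  shows "(\<Sum>m. case prod_decode m of (n, i) \<Rightarrow> f n i) = (\<Sum>n. \<Sum>i. f n i)"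
proof -
  have nn: "a n i \<ge> 0" for n i using f[of n i] norm_ge_zero[of "f n i"] by linarith
  have "(\<lambda>x. norm (case x of (n, i) \<Rightarrow> f n i)) summable_on UNIV"
    by (rule Infinite_Sum.abs_summable_on_comparison_test'[OF summable_prod_decode(1)[OF nn s]])
        (auto simp: f)
  then have sf: "(\<lambda>(n, i). f n i) summable_on UNIV" by (rule abs_summable_summable)
  have inf: "infsum g UNIV = suminf g" if "g summable_on UNIV" for g :: "nat \<Rightarrow> complex"
    using has_sum_imp_sums[OF has_sum_infsum[OF that]] by (simp add: sums_iff)
  have "(\<lambda>m. case prod_decode m of (n, i) \<Rightarrow> f n i) summable_on UNIV"
    using sf by (simp add: summable_on_reindex_bij_betw[OF bij_prod_decode])
  then have "(\<Sum>m. case prod_decode m of (n, i) \<Rightarrow> f n i) = infsum (\<lambda>(n, i). f n i) UNIV"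
    by (simp add: inf[symmetric] infsum_reindex_bij_betw[OF bij_prod_decode])
  also have "\<dots> = (\<Sum>\<^sub>\<infinity>n. \<Sum>\<^sub>\<infinity>i. f n i)"
    using infsum_Sigma'_banach[of f UNIV "\<lambda>_. UNIV"] sf by simp
  also have "\<dots> = (\<Sum>n. \<Sum>\<^sub>\<infinity>i. f n i)"
    using summable_on_Sigma_banach[of f UNIV "\<lambda>_. UNIV"] sf by (intro inf) simp
  also have "\<dots> = (\<Sum>n. \<Sum>i. f n i)"
  proof -
    have "f n summable_on UNIV" for n
      by (rule norm_summable_imp_summable_on)
        (rule summable_comparison_test'[OF s(1)[of n], where N=0], simp add: f)
    then show ?thesis by (simp add: inf)
  qed
  finally show ?thesis .
qed

text \<open>The supremum defining the matrix norm bounds the elements of its set once that set is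
  known to be bounded; a sum of bounds for the entries provides this, and scaling to unit length
  gives the inequality.\<close>

lemma matrix_op_norm_bound:
  fixes A :: "nat \<Rightarrow> nat \<Rightarrow> 'a::complex_hilbert \<Rightarrow> 'a"
  assumes A: "\<And>i j. i < n \<Longrightarrow> j < n \<Longrightarrow> cblinear (A i j)"
  shows "L2_set (\<lambda>i. norm (\<Sum>j<n. A i j (x j))) {..<n} \<le>
      matrix_op_norm UNIV n A * L2_set (\<lambda>j. norm (x j)) {..<n}"
    and "matrix_op_norm UNIV n A \<ge> 0"
proof -
  let ?X = "{sqrt (\<Sum>i<n. (norm (\<Sum>j<n. A i j (x j)))\<^sup>2) | x.
      (\<forall>j<n. x j \<in> UNIV) \<and> (\<Sum>j<n. (norm (x j))\<^sup>2) \<le> 1}"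
  have "\<forall>i j. \<exists>c. i < n \<longrightarrow> j < n \<longrightarrow> c \<ge> 0 \<and> (\<forall>x. norm (A i j x) \<le> c * norm x)"
    using cblinear_bound[OF A] by metis
  then obtain c where c: "\<And>i j. i < n \<Longrightarrow> j < n \<Longrightarrow> c i j \<ge> 0"
    "\<And>i j x. i < n \<Longrightarrow> j < n \<Longrightarrow> norm (A i j x) \<le> c i j * norm x" by metis
  have bdd: "bdd_above ?X"
  proof (rule bdd_aboveI)
    fix r assume "r \<in> ?X"
    then obtain x where r: "r = L2_set (\<lambda>i. norm (\<Sum>j<n. A i j (x j))) {..<n}"
      and x: "(\<Sum>j<n. (norm (x j))\<^sup>2) \<le> 1" by (auto simp: L2_set_def)
    have x1: "norm (x j) \<le> 1" if "j < n" for j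
    proof -
      have "(norm (x j))\<^sup>2 \<le> (\<Sum>j<n. (norm (x j))\<^sup>2)" using that by (intro member_le_sum) auto
      then have "(norm (x j))\<^sup>2 \<le> 1\<^sup>2" using x by simp
      then show ?thesis by (rule power2_le_imp_le) simp
    qed
    have "r \<le> (\<Sum>i<n. norm (\<Sum>j<n. A i j (x j)))" unfolding r by (rule L2_set_le_sum) simp
    also have "\<dots> \<le> (\<Sum>i<n. \<Sum>j<n. c i j)"
    proof (intro sum_mono order_trans[OF norm_sum] sum_mono)
      fix i j assume "i \<in> {..<n}" "j \<in> {..<n}"
      then have "norm (A i j (x j)) \<le> c i j * norm (x j)" "c i j * norm (x j) \<le> c i j"
        using c x1[of j] by (auto intro: mult_left_le)
      then show "norm (A i j (x j)) \<le> c i j" by linarith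
    qed
    finally show "r \<le> (\<Sum>i<n. \<Sum>j<n. c i j)" .
  qed
  have le: "L2_set (\<lambda>i. norm (\<Sum>j<n. A i j (y j))) {..<n} \<le> matrix_op_norm UNIV n A"
    if "(\<Sum>j<n. (norm (y j))\<^sup>2) \<le> 1" for y
    unfolding matrix_op_norm_def L2_set_def using that by (intro cSup_upper bdd) auto
  show "matrix_op_norm UNIV n A \<ge> 0"
    using order_trans[OF L2_set_nonneg le[of "\<lambda>_. 0"]] by simp
  show "L2_set (\<lambda>i. norm (\<Sum>j<n. A i j (x j))) {..<n} \<le>
      matrix_op_norm UNIV n A * L2_set (\<lambda>j. norm (x j)) {..<n}"
  proof (cases "L2_set (\<lambda>j. norm (x j)) {..<n} = 0")
    case True
    then have "x j = 0" if "j < n" for j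
      using that by (simp add: L2_set_eq_0_iff)
    then have "L2_set (\<lambda>i. norm (\<Sum>j<n. A i j (x j))) {..<n} = 0"
      by (auto simp: L2_set_eq_0_iff cblinear_zero[OF A] intro!: sum.neutral)
    then show ?thesis using True by simp
  next
    case False
    define r where "r = L2_set (\<lambda>j. norm (x j)) {..<n}"
    have r: "r > 0" using False L2_set_nonneg[of "\<lambda>j. norm (x j)" "{..<n}"] unfolding r_def
      by linarith
    define y where "y j = complex_of_real (1 / r) *\<^sub>C x j" for j
    have "(\<Sum>j<n. (norm (y j))\<^sup>2) = (\<Sum>j<n. (norm (x j))\<^sup>2) / r\<^sup>2"
      using r by (simp add: y_def norm_scaleC norm_divide power_divide sum_divide_distrib)
    also have "\<dots> = 1" using r by (simp add: r_def L2_set_def sum_nonneg)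
    finally have "L2_set (\<lambda>i. norm (\<Sum>j<n. A i j (y j))) {..<n} \<le> matrix_op_norm UNIV n A"
      by (intro le) simp
    also have "L2_set (\<lambda>i. norm (\<Sum>j<n. A i j (y j))) {..<n} =
        L2_set (\<lambda>i. 1 / r * norm (\<Sum>j<n. A i j (x j))) {..<n}"
    proof (rule L2_set_cong[OF refl])
      fix i assume "i \<in> {..<n}"
      then have "(\<Sum>j<n. A i j (y j)) = complex_of_real (1 / r) *\<^sub>C (\<Sum>j<n. A i j (x j))"
        by (simp add: y_def cblinear_scaleC[OF A] cvec.scale_sum_right)
      then show "norm (\<Sum>j<n. A i j (y j)) = 1 / r * norm (\<Sum>j<n. A i j (x j))"
        using r by (simp add: norm_scaleC norm_divide)
    qed
    also have "\<dots> = 1 / r * L2_set (\<lambda>i. norm (\<Sum>j<n. A i j (x j))) {..<n}"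
      by (rule L2_set_right_distrib[symmetric]) (use r in simp)
    finally show ?thesis using r by (simp add: r_def[symmetric] field_simps)
  qed
qed

lemma summable_mult_op_sq:
  assumes \<phi>: "\<phi> \<in> multipliers" and f: "summable (\<lambda>i. (norm (f i))\<^sup>2)"
  shows "summable (\<lambda>i. (norm (mult_op \<phi> (f i)))\<^sup>2)"
proof -
  obtain C where C: "C \<ge> 0" "\<And>f. norm (mult_op \<phi> f) \<le> C * norm f"
    using mult_op_bound[OF \<phi>] by metis
  have "(norm (mult_op \<phi> (f i)))\<^sup>2 \<le> C\<^sup>2 * (norm (f i))\<^sup>2" for i
    using power_mono[OF C(2)[of "f i"], of 2] by (simp add: power_mult_distrib)
  then show ?thesis
    by (intro summable_comparison_test'[OF summable_mult[OF f, of "C\<^sup>2"], where N=0]) simp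
qed

text \<open>The map \<open>A\<close> plays the role of the adjoint of r applied to the row. It is
  chosen before \<open>K\<close> and hence is the same for all families, which is the source of the
  independence of the calculus from the family.\<close>

lemma (in pure_row) dilates_poly:
  assumes "r \<in> polys"
  shows "\<exists>A. \<forall>K. dilates K \<longrightarrow> (\<forall>i x. K i (A x) = hadj (mult_op r) (K i x))"
  using assms
proof (induction rule: polys.induct)
  case (const c)
  show ?case
    unfolding hadj_mult_op_const
    by (intro exI[of _ "\<lambda>x. cnj c *\<^sub>C x"]) (simp add: dilates_def cblinear_scaleC)
next
  case (coord k)
  show ?case by (intro exI[of _ "B k"]) (simp add: dilates_def hadj_mult_op_coord)
next
  case (add r q)
  obtain A1 A2 where A: "\<And>K i x. dilates K \<Longrightarrow> K i (A1 x) = hadj (mult_op r) (K i x)"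
    "\<And>K i x. dilates K \<Longrightarrow> K i (A2 x) = hadj (mult_op q) (K i x)"
    using add.IH by metis
  have "K i (A1 x + A2 x) = K i (A1 x) + K i (A2 x)" if "dilates K" for K i x
    using that by (intro cblinear_add) (simp add: dilates_def)
  then show ?case
    unfolding hadj_mult_op_add[OF add.hyps[THEN polys_multipliers]]
    by (intro exI[of _ "\<lambda>x. A1 x + A2 x"]) (simp add: A)
next
  case (times r q)
  obtain A1 A2 where A: "\<And>K i x. dilates K \<Longrightarrow> K i (A1 x) = hadj (mult_op r) (K i x)"
    "\<And>K i x. dilates K \<Longrightarrow> K i (A2 x) = hadj (mult_op q) (K i x)"
    using times.IH by metis
  then show ?case
    unfolding hadj_mult_op_times[OF times.hyps[THEN polys_multipliers]]
    by (intro exI[of _ "\<lambda>x. A1 (A2 x)"]) (simp add: A)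
qed

section \<open>Existence of the calculus for a pure commuting row contraction\<close>

locale pure_commuting_row =
  fixes T :: "'d::finite \<Rightarrow> 'a::complex_hilbert \<Rightarrow> 'a"
  assumes row_contraction: "row_contraction UNIV T" and commuting: "commuting UNIV T"
    and pure: "pure UNIV T"
begin

lemma cblinear_T: "cblinear (T k)"
  using row_contraction by (simp add: row_contraction_def bounded_ops_UNIV_iff)

lemma T_commute: "T i (T j x) = T j (T i x)"
proof -
  have "compose UNIV (T i) (T j) x = compose UNIV (T j) (T i) x"
    using commuting unfolding commuting_def by metis
  then show ?thesis by (simp add: compose_def)
qed

lemma cblinear_word_op: "cblinear (word_op UNIV T w)"
  by (induction w) (auto simp: compose_def cblinear_id intro: cblinear_compose cblinear_T)

text \<open>The adjoint of T_w applies the adjoint of the first letter first, which is the order in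
  which \<open>back_word\<close> acts.\<close>

lemma adj_word_op: "adj UNIV (word_op UNIV T w) x = back_word (\<lambda>k. hadj (T k)) w x"
proof (induction w arbitrary: x)
  case Nil
  show ?case unfolding adj_UNIV by (simp add: hadj_eqI)
next
  case (Cons k w)
  have "hadj (word_op UNIV T (k # w)) x = hadj (word_op UNIV T w) (hadj (T k) x)"
    by (simp add: compose_def restrict_UNIV hadj_compose cblinear_T cblinear_word_op)
  then show ?case using Cons by (simp add: adj_UNIV)
qed

lemma psd_form_cinner: "psd_form (cinner :: 'a \<Rightarrow> 'a \<Rightarrow> complex)"
  unfolding psd_form_def using cinner_commute
  by (auto simp: cinner_add_left cinner_scaleC_left cinner_self)

sublocale pure_row "\<lambda>k. hadj (T k)" cinner
proof
  show "cblinear (hadj (T k))" for k by (intro cblinear_hadj cblinear_T)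
  show "hadj (T i) (hadj (T j) x) = hadj (T j) (hadj (T i) x)" for i j x
    using hadj_compose[OF cblinear_T cblinear_T, of j i x] hadj_compose[OF cblinear_T cblinear_T,
        of i j x]
    by (simp add: T_commute[of i j])
  show "psd_form (cinner :: 'a \<Rightarrow> 'a \<Rightarrow> complex)" by (rule psd_form_cinner)
  show "Re (cinner x x) \<le> (norm x)\<^sup>2" for x :: 'a by (simp add: cinner_self)
  show "(\<Sum>k\<in>UNIV. Re (cinner (hadj (T k) x) (hadj (T k) x))) \<le> Re (cinner x x)" for x
  proof -
    have "cinner (x - (\<Sum>k\<in>UNIV. T k (hadj (T k) x))) x \<in> \<real>\<^sub>\<ge>\<^sub>0"
      using row_contraction by (simp add: row_contraction_def op_le_def adj_UNIV)
    then have "Re (cinner (x - (\<Sum>k\<in>UNIV. T k (hadj (T k) x))) x) \<ge> 0"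
      by (simp add: complex_nonneg_Reals_iff)
    then show ?thesis
      by (simp add: cinner_diff_left cinner_sum_left hadj_right[OF cblinear_T])
  qed
  show "(\<lambda>n. \<Sum>w | length w = n. Re (cinner (back_word (\<lambda>k. hadj (T k)) w x)
      (back_word (\<lambda>k. hadj (T k)) w x))) \<longlonglongrightarrow> 0" for x
    using pure by (simp add: pure_def adj_word_op cinner_self)
qed

text \<open>Exactness at one vector: the sum of K_i^* K_i fixes x, in the weak sense. One family can
  be made exact on any prescribed countable set.\<close>

definition dilates_at :: "(nat \<Rightarrow> 'a \<Rightarrow> 'd drury_arveson) \<Rightarrow> 'a \<Rightarrow> bool" where
  "dilates_at K x \<longleftrightarrow> dilates K \<and> (\<forall>y. (\<lambda>i. cinner (K i x) (K i y)) sums cinner x y)"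

lemma ex_dilates_at:
  assumes "countable C" obtains K where "\<And>x. x \<in> C \<Longrightarrow> dilates_at K x"
  using dilation[OF assms] unfolding dilates_at_def by metis

lemma dilates_norm:
  assumes "dilates K"
  shows "summable (\<lambda>i. (norm (K i x))\<^sup>2)" "(\<Sum>i. (norm (K i x))\<^sup>2) \<le> (norm x)\<^sup>2"
  using dilates_summable[OF assms, of x] by (simp_all add: cinner_self)

text \<open>The expected value of <\<phi>(T) x, y>: the compression of copies of M_\<phi> along the
  family \<open>K\<close>.\<close>

definition comp_form ::
    "(nat \<Rightarrow> 'a \<Rightarrow> 'd drury_arveson) \<Rightarrow> (complex^'d \<Rightarrow> complex) \<Rightarrow> 'a \<Rightarrow> 'a \<Rightarrow> complex" where
  "comp_form K \<phi> x y = (\<Sum>i. cinner (mult_op \<phi> (K i x)) (K i y))"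

lemma comp_form_summable:
  assumes "dilates K" "\<phi> \<in> multipliers"
  shows "summable (\<lambda>i. cinner (mult_op \<phi> (K i x)) (K i y))"
  by (intro summable_cinner summable_mult_op_sq dilates_norm assms)

lemma comp_form_bound:
  assumes K: "dilates K" and \<phi>: "\<phi> \<in> multipliers"
    and C: "C \<ge> 0" "\<And>f. norm (mult_op \<phi> f) \<le> C * norm f"
  shows "cmod (comp_form K \<phi> x y) \<le> C * norm x * norm y"
proof -
  note s = dilates_norm(1)[OF K]
  note cs = suminf_cauchy_schwarz[OF norm_ge_zero norm_ge_zero s[of x] s[of y]]
  have le: "cmod (cinner (mult_op \<phi> (K i x)) (K i y)) \<le> C * (norm (K i x) * norm (K i y))" for i
    using order_trans[OF cinner_cauchy_schwarz mult_right_mono[OF C(2) norm_ge_zero]]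
    by (simp add: mult.assoc)
  have sn: "summable (\<lambda>i. cmod (cinner (mult_op \<phi> (K i x)) (K i y)))"
    by (rule summable_comparison_test'[OF summable_mult[OF cs(1), of C], where N=0]) (simp add: le)
  have "cmod (comp_form K \<phi> x y) \<le> (\<Sum>i. cmod (cinner (mult_op \<phi> (K i x)) (K i y)))"
    unfolding comp_form_def by (rule summable_norm[OF sn])
  also have "\<dots> \<le> (\<Sum>i. C * (norm (K i x) * norm (K i y)))"
    by (rule suminf_le[OF le sn summable_mult[OF cs(1)]])
  also have "\<dots> = C * (\<Sum>i. norm (K i x) * norm (K i y))" by (rule suminf_mult[OF cs(1)])
  also have "\<dots> \<le> C * (sqrt (\<Sum>i. (norm (K i x))\<^sup>2) * sqrt (\<Sum>i. (norm (K i y))\<^sup>2))"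
    by (intro mult_left_mono cs(2) C)
  also have "\<dots> \<le> C * (sqrt ((norm x)\<^sup>2) * sqrt ((norm y)\<^sup>2))"
    by (intro mult_left_mono mult_mono real_sqrt_le_mono dilates_norm(2)[OF K] C)
      (auto intro: suminf_nonneg s)
  finally show ?thesis by (simp add: mult.assoc)
qed

lemma comp_form_wot_conv:
  assumes "dilates K" "wot_conv q \<phi>"
  shows "(\<lambda>n. comp_form K (q n) x y) \<longlonglongrightarrow> comp_form K \<phi> x y"
  unfolding comp_form_def by (intro wot_conv_suminf assms dilates_norm)

text \<open>A polynomial factor can be moved to the second argument, because the components
  intertwine the adjoints. This holds for every dilating family; exactness at x is what evaluates
  the remaining sum in the first formula.\<close>

lemma comp_form_poly:
  assumes "p \<in> polys"
  obtains A where "\<And>K x y. dilates_at K x \<Longrightarrow> comp_form K p x y = cinner x (A y)"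
    "\<And>K \<psi> x y. dilates K \<Longrightarrow> \<psi> \<in> multipliers \<Longrightarrow>
      comp_form K (\<lambda>z\<in>ball 0 1. p z * \<psi> z) x y = comp_form K \<psi> x (A y)"
proof -
  have m: "p \<in> multipliers" by (rule polys_multipliers[OF assms])
  obtain A where A: "\<And>K i x. dilates K \<Longrightarrow> K i (A x) = hadj (mult_op p) (K i x)"
    using dilates_poly[OF assms] by metis
  show thesis
  proof (rule that[of A])
    fix K x y assume K: "dilates_at K x"
    then have "(\<lambda>i. cinner (K i x) (K i (A y))) sums cinner x (A y)" by (simp add: dilates_at_def)
    then show "comp_form K p x y = cinner x (A y)"
      using K A[of K] by (simp add: comp_form_def dilates_at_def hadj_right[OF cblinear_mult_op[OF
          m]] sums_iff)
  next
    fix K x y and \<psi> :: "complex^'d \<Rightarrow> complex"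
    assume "dilates K" "\<psi> \<in> multipliers"
    then show "comp_form K (\<lambda>z\<in>ball 0 1. p z * \<psi> z) x y = comp_form K \<psi> x (A y)"
      using A[of K] by (simp add: comp_form_def mult_op_times[OF m] hadj_right[OF
          cblinear_mult_op[OF m]])
  qed
qed

text \<open>For polynomials both sides equal <x, A y> with the same \<open>A\<close>; the Fejer sums
  give the general case.\<close>

lemma comp_form_unique:
  assumes \<phi>: "\<phi> \<in> multipliers" and K: "dilates_at K x" "dilates_at K' x"
  shows "comp_form K \<phi> x y = comp_form K' \<phi> x y"
proof (rule LIMSEQ_unique)
  have eq: "comp_form K (fejer n \<phi>) x y = comp_form K' (fejer n \<phi>) x y" for n
    using comp_form_poly[OF fejer_polys[of n \<phi>]] K by metis
  show "(\<lambda>n. comp_form K (fejer (Suc n) \<phi>) x y) \<longlonglongrightarrow> comp_form K \<phi> x y"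
    using K by (intro comp_form_wot_conv fejer_wot_conv \<phi>) (simp add: dilates_at_def)
  show "(\<lambda>n. comp_form K (fejer (Suc n) \<phi>) x y) \<longlonglongrightarrow> comp_form K' \<phi> x y"
    unfolding eq using K by (intro comp_form_wot_conv fejer_wot_conv \<phi>) (simp add: dilates_at_def)
qed

text \<open>The vector \<phi>(T) x. Quantifying over all families exact at x lets later proofs
  choose a family exact at several vectors at once.\<close>

definition calc :: "(complex^'d \<Rightarrow> complex) \<Rightarrow> 'a \<Rightarrow> 'a" where
  "calc \<phi> x = (SOME v. \<forall>K. dilates_at K x \<longrightarrow> (\<forall>y. cinner v y = comp_form K \<phi> x y))"

lemma cinner_calc:
  assumes \<phi>: "\<phi> \<in> multipliers" and K: "dilates_at K x"
  shows "cinner (calc \<phi> x) y = comp_form K \<phi> x y"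
proof -
  have dK: "dilates K" using K by (simp add: dilates_at_def)
  have cb: "cblinear (K i)" for i using dK by (simp add: dilates_def)
  obtain C where C: "C \<ge> 0" "\<And>f. norm (mult_op \<phi> f) \<le> C * norm f"
    using mult_op_bound[OF \<phi>] by metis
  note s = comp_form_summable[OF dK \<phi>]
  \<comment> \<open>Conjugated because the form is antilinear in y, while the Riesz representation
    needs a linear functional.\<close>
  define l where "l y = cnj (comp_form K \<phi> x y)" for y
  have "l (y + z) = l y + l z" for y z
    by (simp add: l_def comp_form_def cblinear_add[OF cb] cinner_add_right suminf_add[OF s s,
        symmetric])
  moreover have "l (c *\<^sub>C y) = c * l y" for c y
    by (simp add: l_def comp_form_def cblinear_scaleC[OF cb] cinner_scaleC_right suminf_mult[OF s])
  moreover have "cmod (l y) \<le> (C * norm x) * norm y" for y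
    using comp_form_bound[OF dK \<phi> C] by (simp add: l_def)
  ultimately obtain v where v: "\<And>y. l y = cinner y v"
    using riesz_representation[of l] by metis
  have "cinner v y = comp_form K \<phi> x y" for y
    using v[of y] cinner_commute[of v y] by (simp add: l_def) (metis complex_cnj_cnj)
  then have "\<forall>K. dilates_at K x \<longrightarrow> (\<forall>y. cinner v y = comp_form K \<phi> x y)"
    using comp_form_unique[OF \<phi> K] by metis
  then have "\<forall>K. dilates_at K x \<longrightarrow> (\<forall>y. cinner (calc \<phi> x) y = comp_form K \<phi> x y)"
    unfolding calc_def by (rule someI)
  then show ?thesis using K by blast
qed

lemma norm_calc_le:
  assumes \<phi>: "\<phi> \<in> multipliers" and C: "C \<ge> 0" "\<And>f. norm (mult_op \<phi> f) \<le> C * norm f"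
  shows "norm (calc \<phi> x) \<le> C * norm x"
proof -
  obtain K where K: "dilates_at K x" using ex_dilates_at[of "{x}"] by auto
  have "cmod (cinner (calc \<phi> x) (calc \<phi> x)) \<le> C * norm x * norm (calc \<phi> x)"
    unfolding cinner_calc[OF \<phi> K]
    by (rule comp_form_bound[OF _ \<phi> C]) (use K in \<open>simp add: dilates_at_def\<close>)
  then show ?thesis
    using C(1) by (cases "calc \<phi> x = 0") (auto simp: cinner_self norm_mult power2_eq_square)
qed

lemma cblinear_calc:
  assumes \<phi>: "\<phi> \<in> multipliers" shows "cblinear (calc \<phi>)"
proof -
  obtain C where C: "C \<ge> 0" "\<And>f. norm (mult_op \<phi> f) \<le> C * norm f"
    using mult_op_bound[OF \<phi>] by metis
  note cm = cblinear_mult_op[OF \<phi>]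
  show ?thesis
  proof (rule cblinearI[OF _ _ norm_calc_le[OF \<phi> C]])
    fix x y
    obtain K where "\<And>u. u \<in> {x, y, x + y} \<Longrightarrow> dilates_at K u" using ex_dilates_at[of "{x, y, x + y}"]
      by auto
    then have K: "dilates_at K x" "dilates_at K y" "dilates_at K (x + y)" by auto
    then have dK: "dilates K" and cb: "\<And>i. cblinear (K i)"
      by (auto simp: dilates_at_def dilates_def)
    note s = comp_form_summable[OF dK \<phi>]
    show "calc \<phi> (x + y) = calc \<phi> x + calc \<phi> y"
      by (rule cinner_eqI)
        (simp add: cinner_calc[OF \<phi> K(1)] cinner_calc[OF \<phi> K(2)] cinner_calc[OF \<phi> K(3)]
            cinner_add_left
          comp_form_def cblinear_add[OF cb] cblinear_add[OF cm] suminf_add[OF s s, symmetric])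
  next
    fix c x
    obtain K where "\<And>u. u \<in> {x, c *\<^sub>C x} \<Longrightarrow> dilates_at K u" using ex_dilates_at[of "{x, c *\<^sub>C x}"]
      by auto
    then have K: "dilates_at K x" "dilates_at K (c *\<^sub>C x)" by auto
    then have dK: "dilates K" and cb: "\<And>i. cblinear (K i)"
      by (auto simp: dilates_at_def dilates_def)
    show "calc \<phi> (c *\<^sub>C x) = c *\<^sub>C calc \<phi> x"
      by (rule cinner_eqI)
        (simp add: cinner_calc[OF \<phi> K(1)] cinner_calc[OF \<phi> K(2)] cinner_scaleC_left
          comp_form_def cblinear_scaleC[OF cb] cblinear_scaleC[OF cm] suminf_mult[OF
              comp_form_summable[OF dK \<phi>]])
  qed
qed

section \<open>Algebraic rules of the calculus\<close>

lemma calc_const: "calc (\<lambda>z\<in>ball 0 1. c) x = c *\<^sub>C x"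
proof (rule cinner_eqI)
  fix y
  obtain K where K: "dilates_at K x" using ex_dilates_at[of "{x}"] by auto
  then have "(\<lambda>i. cinner (K i x) (K i y)) sums cinner x y" by (simp add: dilates_at_def)
  then show "cinner (calc (\<lambda>z\<in>ball 0 1. c) x) y = cinner (c *\<^sub>C x) y"
    unfolding cinner_calc[OF const_multiplier K] comp_form_def mult_op_const cinner_scaleC_left
    by (simp add: sums_iff suminf_mult)
qed

lemma calc_add:
  assumes m: "\<phi> \<in> multipliers" "\<psi> \<in> multipliers"
  shows "calc (\<lambda>z\<in>ball 0 1. \<phi> z + \<psi> z) x = calc \<phi> x + calc \<psi> x"
proof (rule cinner_eqI)
  fix y
  obtain K where K: "dilates_at K x" using ex_dilates_at[of "{x}"] by auto
  then have dK: "dilates K" by (simp add: dilates_at_def)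
  show "cinner (calc (\<lambda>z\<in>ball 0 1. \<phi> z + \<psi> z) x) y = cinner (calc \<phi> x + calc \<psi> x) y"
    unfolding cinner_calc[OF add_multiplier[OF m] K] cinner_add_left cinner_calc[OF m(1) K]
      cinner_calc[OF m(2) K] comp_form_def mult_op_add[OF m]
    by (rule suminf_add[symmetric]) (intro comp_form_summable dK m)+
qed

lemma calc_wot_conv:
  assumes q: "\<And>n. q n \<in> multipliers" and \<phi>: "\<phi> \<in> multipliers" and conv: "wot_conv q \<phi>"
  shows "(\<lambda>n. cinner (calc (q n) x) y) \<longlonglongrightarrow> cinner (calc \<phi> x) y"
proof -
  obtain K where K: "dilates_at K x" using ex_dilates_at[of "{x}"] by auto
  show ?thesis
    unfolding cinner_calc[OF q K] cinner_calc[OF \<phi> K] using K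
    by (intro comp_form_wot_conv conv) (simp add: dilates_at_def)
qed

text \<open>One family is taken exact at both x and \<psi>(T) x. For a polynomial first factor,
  moving it to the second argument gives the product rule; the limit over Fejer sums is allowed
  since the vectors M_\<psi> K_i x are again square summable.\<close>

lemma calc_times:
  assumes m: "\<phi> \<in> multipliers" "\<psi> \<in> multipliers"
  shows "calc (\<lambda>z\<in>ball 0 1. \<phi> z * \<psi> z) x = calc \<phi> (calc \<psi> x)"
proof (rule cinner_eqI)
  fix y
  let ?u = "calc \<psi> x"
  obtain K where "\<And>u. u \<in> {x, ?u} \<Longrightarrow> dilates_at K u" using ex_dilates_at[of "{x, ?u}"] by auto
  then have K: "dilates_at K x" "dilates_at K ?u" by auto
  then have dK: "dilates K" by (simp add: dilates_at_def)
  let ?q = "\<lambda>n. fejer (Suc n) \<phi>"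
  have q: "?q n \<in> multipliers" for n by (rule polys_multipliers[OF fejer_polys])
  have eq: "cinner (calc (?q n) ?u) y = (\<Sum>i. cinner (mult_op (?q n) (mult_op \<psi> (K i x))) (K i y))"
    for n
  proof (rule comp_form_poly[OF fejer_polys[of "Suc n" \<phi>]])
    fix A assume A: "\<And>K x y. dilates_at K x \<Longrightarrow> comp_form K (?q n) x y = cinner x (A y)"
      "\<And>K \<psi> x y. dilates K \<Longrightarrow> \<psi> \<in> multipliers \<Longrightarrow>
        comp_form K (\<lambda>z\<in>ball 0 1. ?q n z * \<psi> z) x y = comp_form K \<psi> x (A y)"
    have "cinner (calc (?q n) ?u) y = cinner ?u (A y)"
      unfolding cinner_calc[OF q K(2)] by (rule A(1)[OF K(2)])
    also have "\<dots> = comp_form K (\<lambda>z\<in>ball 0 1. ?q n z * \<psi> z) x y"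
      unfolding cinner_calc[OF m(2) K(1)] by (rule A(2)[OF dK m(2), symmetric])
    finally show ?thesis by (simp add: comp_form_def mult_op_times[OF q m(2)])
  qed
  show "cinner (calc (\<lambda>z\<in>ball 0 1. \<phi> z * \<psi> z) x) y = cinner (calc \<phi> ?u) y"
  proof (rule LIMSEQ_unique)
    show "(\<lambda>n. cinner (calc (?q n) ?u) y) \<longlonglongrightarrow> cinner (calc \<phi> ?u) y"
      by (intro calc_wot_conv q m fejer_wot_conv)
    show "(\<lambda>n. cinner (calc (?q n) ?u) y) \<longlonglongrightarrow> cinner (calc (\<lambda>z\<in>ball 0 1. \<phi> z * \<psi> z) x) y"
      unfolding eq cinner_calc[OF times_multiplier[OF m] K(1)] comp_form_def mult_op_times[OF m]
      by (intro wot_conv_suminf fejer_wot_conv m summable_mult_op_sq dilates_norm dK)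
  qed
qed

lemma calc_coord: "calc (coord k) x = T k x"
proof (rule cinner_eqI)
  fix y
  obtain K where K: "dilates_at K x" using ex_dilates_at[of "{x}"] by auto
  then have "(\<lambda>i. cinner (K i x) (K i (hadj (T k) y))) sums cinner x (hadj (T k) y)"
    by (simp add: dilates_at_def)
  moreover have "cinner (mult_op (coord k) (K i x)) (K i y) = cinner (K i x) (K i (hadj (T k) y))"
    for i
  proof -
    have "K i (hadj (T k) y) = da_back k (K i y)" using K by (simp add: dilates_at_def dilates_def)
    then show ?thesis
      by (simp add: hadj_right[OF cblinear_mult_op[OF coord_multiplier],
          symmetric] hadj_mult_op_coord)
  qed
  ultimately show "cinner (calc (coord k) x) y = cinner (T k x) y"
    unfolding cinner_calc[OF coord_multiplier K] comp_form_def
    by (simp add: sums_iff hadj_right[OF cblinear_T])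
qed

lemma calc_scale:
  assumes "\<phi> \<in> multipliers" shows "calc (\<lambda>z\<in>ball 0 1. c * \<phi> z) x = c *\<^sub>C calc \<phi> x"
proof -
  have "(\<lambda>z\<in>ball 0 1. c * \<phi> z) = (\<lambda>z\<in>ball 0 1. (\<lambda>z\<in>ball 0 1. c) z * \<phi> z)"
    by (rule restrict_ext) simp
  then show ?thesis using calc_times[OF const_multiplier assms, of c x] by (simp only: calc_const)
qed

text \<open>Polynomials in \<open>T\<close> leave \<open>M\<close> invariant, and pairing with the
  orthogonal complement survives the weak limit.\<close>

lemma calc_invariant:
  assumes M: "closed_invariant_subspace T M" and \<phi>: "\<phi> \<in> multipliers" and x: "x \<in> M"
  shows "calc \<phi> x \<in> M"
proof -
  have sub: "cvec.subspace M" "closed M" and inv: "\<And>k x. x \<in> M \<Longrightarrow> T k x \<in> M"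
    using M by (auto simp: closed_invariant_subspace_def)
  have poly: "calc p x \<in> M" if "p \<in> polys" "x \<in> M" for p x
    using that
  proof (induction arbitrary: x rule: polys.induct)
    case (const c)
    then show ?case unfolding calc_const by (intro cvec.subspace_scale sub)
  next
    case (coord k)
    then show ?case by (simp add: calc_coord inv)
  next
    case (add p q)
    show ?case
      unfolding calc_add[OF add.hyps[THEN polys_multipliers]]
      by (intro cvec.subspace_add sub add)
  next
    case (times p q)
    show ?case
      unfolding calc_times[OF times.hyps[THEN polys_multipliers]]
      by (intro times)
  qed
  have "calc \<phi> x \<in> orth (orth M)"
    unfolding orth_def[of "orth M"]
  proof (intro CollectI ballI)
    fix y assume y: "y \<in> orth M"
    have "cinner (calc (fejer (Suc n) \<phi>) x) y = 0" for n
      using y poly[OF fejer_polys x] cinner_commute[of _ y] by (simp add: orth_def)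
    then have "(\<lambda>n. cinner (calc (fejer (Suc n) \<phi>) x) y) \<longlonglongrightarrow> 0" by simp
    moreover have "(\<lambda>n. cinner (calc (fejer (Suc n) \<phi>) x) y) \<longlonglongrightarrow> cinner (calc \<phi> x) y"
      by (intro calc_wot_conv polys_multipliers[OF fejer_polys] \<phi> fejer_wot_conv)
    ultimately show "cinner (calc \<phi> x) y = 0" by (rule LIMSEQ_unique[symmetric])
  qed
  then show ?thesis by (simp only: orth_orth[OF sub])
qed

text \<open>Complete contractivity. The output vector y is paired with itself and the pairing is
  expanded through the dilation, where the matrix of multiplication operators acts on each
  component; this gives Y^2 \<le> ?N Y for the length Y of the output.\<close>

lemma calc_matrix_bound:
  assumes \<phi>: "\<And>i j. i < n \<Longrightarrow> j < n \<Longrightarrow> \<phi> i j \<in> multipliers" and x: "(\<Sum>j<n. (norm (x j))\<^sup>2) \<le> 1"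
  shows "L2_set (\<lambda>i. norm (\<Sum>j<n. calc (\<phi> i j) (x j))) {..<n} \<le>
      matrix_op_norm UNIV n (\<lambda>i j. mult_op (\<phi> i j))"
proof -
  let ?N = "matrix_op_norm UNIV n (\<lambda>i j. mult_op (\<phi> i j))"
  define y where "y i = (\<Sum>j<n. calc (\<phi> i j) (x j))" for i
  define Y where "Y = L2_set (\<lambda>i. norm (y i)) {..<n}"
  \<comment> \<open>Exactness is required at the inputs \<open>x j\<close>; for the outputs
    \<open>y i\<close> the Bessel inequality is enough.\<close>
  obtain K where "\<And>u. u \<in> x ` {..<n} \<Longrightarrow> dilates_at K u" using ex_dilates_at[of "x ` {..<n}"] by auto
  then have K: "\<And>j. j < n \<Longrightarrow> dilates_at K (x j)" by auto
  show ?thesis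
  proof (cases "n = 0")
    case True
    then show ?thesis using matrix_op_norm_bound(2)[of 0] by simp
  next
    case False
    then have dK: "dilates K" using K[of 0] by (simp add: dilates_at_def)
    define a b where "a m = L2_set (\<lambda>j. norm (K m (x j))) {..<n}"
      and "b m = L2_set (\<lambda>i. norm (K m (y i))) {..<n}" for m
    have a2: "(a m)\<^sup>2 = (\<Sum>j<n. (norm (K m (x j)))\<^sup>2)" and b2:
      "(b m)\<^sup>2 = (\<Sum>j<n. (norm (K m (y j)))\<^sup>2)" for m
      by (simp_all add: a_def b_def L2_set_def sum_nonneg)
    have ss: "summable (\<lambda>m. \<Sum>j<n. (norm (K m (z j)))\<^sup>2)"
      "(\<Sum>m. \<Sum>j<n. (norm (K m (z j)))\<^sup>2) \<le> (\<Sum>j<n. (norm (z j))\<^sup>2)" for z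
    proof -
      show "summable (\<lambda>m. \<Sum>j<n. (norm (K m (z j)))\<^sup>2)" by (intro summable_sum dilates_norm dK)
      have "(\<Sum>m. \<Sum>j<n. (norm (K m (z j)))\<^sup>2) = (\<Sum>j<n. \<Sum>m. (norm (K m (z j)))\<^sup>2)"
        by (intro suminf_sum dilates_norm dK)
      also have "\<dots> \<le> (\<Sum>j<n. (norm (z j))\<^sup>2)" by (intro sum_mono dilates_norm dK)
      finally show "(\<Sum>m. \<Sum>j<n. (norm (K m (z j)))\<^sup>2) \<le> (\<Sum>j<n. (norm (z j))\<^sup>2)" .
    qed
    have ab0: "a m \<ge> 0" "b m \<ge> 0" for m by (simp_all add: a_def b_def L2_set_nonneg)
    note cs = suminf_cauchy_schwarz[of a b, OF ab0 ss(1)[of x, folded a2] ss(1)[of y, folded b2]]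
    define t where "t m = (\<Sum>i<n. cinner (\<Sum>j<n. mult_op (\<phi> i j) (K m (x j))) (K m (y i)))" for m
    have t_le: "cmod (t m) \<le> ?N * (a m * b m)" for m
    proof -
      have "cmod (t m) \<le> (\<Sum>i<n. \<bar>norm (\<Sum>j<n. mult_op (\<phi> i j) (K m (x j)))\<bar> * \<bar>norm (K m (y i))\<bar>)"
        unfolding t_def by (rule sum_norm_le) (simp add: cinner_cauchy_schwarz)
      also have "\<dots> \<le> L2_set (\<lambda>i. norm (\<Sum>j<n. mult_op (\<phi> i j) (K m (x j)))) {..<n} * b m"
        unfolding b_def by (rule L2_set_mult_ineq)
      also have "\<dots> \<le> (?N * a m) * b m"
        unfolding a_def by (intro mult_right_mono matrix_op_norm_bound cblinear_mult_op \<phi> ab0)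
      finally show ?thesis by (simp add: mult.assoc)
    qed
    have "t sums (\<Sum>i<n. \<Sum>j<n. cinner (calc (\<phi> i j) (x j)) (y i))"
      unfolding t_def cinner_sum_left
    proof (intro sums_sum)
      fix i j assume "i \<in> {..<n}" "j \<in> {..<n}"
      then have ij: "\<phi> i j \<in> multipliers" "dilates_at K (x j)" using \<phi> K by auto
      show "(\<lambda>m. cinner (mult_op (\<phi> i j) (K m (x j))) (K m (y i))) sums
          cinner (calc (\<phi> i j) (x j)) (y i)"
        unfolding cinner_calc[OF ij] comp_form_def by (intro summable_sums comp_form_summable dK ij)
    qed
    also have "(\<Sum>i<n. \<Sum>j<n. cinner (calc (\<phi> i j) (x j)) (y i)) = of_real (Y\<^sup>2)"
      unfolding cinner_sum_left[symmetric] y_def[symmetric]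
        by (simp add: Y_def L2_set_def sum_nonneg cinner_self)
    finally have t: "t sums of_real (Y\<^sup>2)" .
    have sn: "summable (\<lambda>m. cmod (t m))"
      by (rule summable_comparison_test'[OF summable_mult[OF cs(1), of ?N],
          where N=0]) (simp add: t_le)
    have "Y\<^sup>2 = cmod (suminf t)" using t by (simp add: sums_iff norm_power)
    also have "\<dots> \<le> (\<Sum>m. cmod (t m))" by (rule summable_norm[OF sn])
    also have "\<dots> \<le> (\<Sum>m. ?N * (a m * b m))" by (rule suminf_le[OF t_le sn summable_mult[OF cs(1)]])
    also have "\<dots> = ?N * (\<Sum>m. a m * b m)" by (rule suminf_mult[OF cs(1)])
    also have "\<dots> \<le> ?N * (sqrt (\<Sum>m. (a m)\<^sup>2) * sqrt (\<Sum>m. (b m)\<^sup>2))"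
      by (intro mult_left_mono cs(2) matrix_op_norm_bound cblinear_mult_op \<phi>)
    also have "\<dots> \<le> ?N * (1 * Y)"
    proof (intro mult_left_mono mult_mono)
      show "sqrt (\<Sum>m. (a m)\<^sup>2) \<le> 1" unfolding a2 using order_trans[OF ss(2) x] by simp
      show "sqrt (\<Sum>m. (b m)\<^sup>2) \<le> Y"
        unfolding b2 Y_def L2_set_def by (intro real_sqrt_le_mono ss)
      show "0 \<le> sqrt (\<Sum>m. (b m)\<^sup>2)" unfolding b2 by (simp add: suminf_nonneg ss(1) sum_nonneg)
      show "?N \<ge> 0" by (intro matrix_op_norm_bound cblinear_mult_op \<phi>)
    qed simp
    finally have "Y * Y \<le> ?N * Y" by (simp add: power2_eq_square)
    moreover have "?N \<ge> 0" by (intro matrix_op_norm_bound cblinear_mult_op \<phi>)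
    moreover have "Y \<ge> 0" by (simp add: Y_def L2_set_nonneg)
    ultimately have "Y \<le> ?N" by (cases "Y = 0") auto
    then show ?thesis by (simp add: Y_def y_def)
  qed
qed

text \<open>A trace class functional of \<phi>(T) is a trace class functional of M_\<phi>, applied
  to all K_i \<xi>_n and K_i \<eta>_n. The family must be exact along a whole sequence \<xi>, which
  is why the dilation is built for countable sets.\<close>

lemma continuous_map_calc:
  assumes M: "closed_invariant_subspace T M"
  shows "continuous_map mult_weak_star (weak_star M) (\<lambda>\<phi>\<in>multipliers. restrict (calc \<phi>) M)"
    (is "continuous_map _ _ ?\<Phi>")
proof -
  have sub: "cvec.subspace M" "0 \<in> M" using M
    by (auto simp: closed_invariant_subspace_def cvec.subspace_def)
  have bo: "restrict (calc \<phi>) M \<in> bounded_ops M M" if \<phi>: "\<phi> \<in> multipliers" for \<phi>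
  proof -
    note cb = cblinear_calc[OF \<phi>]
    obtain C where "\<And>x. norm (calc \<phi> x) \<le> C * norm x" using cblinear_bound[OF cb] by metis
    then show ?thesis
      using calc_invariant[OF M \<phi>] sub(1)
      by (auto simp: bounded_ops_def cvec.subspace_add cvec.subspace_scale cblinear_add[OF cb]
          cblinear_scaleC[OF cb])
  qed
  show ?thesis
    unfolding weak_star_def
  proof (rule continuous_on_generated_topo, goal_cases)
    case (1 W)
    then obtain \<xi> \<eta> U where W: "W = {A \<in> bounded_ops M M. (\<Sum>n. cinner (A (\<xi> n)) (\<eta> n)) \<in> U}"
      and \<xi>: "range \<xi> \<subseteq> M"
      and s: "summable (\<lambda>n. (norm (\<xi> n))\<^sup>2)" "summable (\<lambda>n. (norm (\<eta> n))\<^sup>2)" and U: "open U"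
      by blast
    obtain K where "\<And>u. u \<in> range \<xi> \<Longrightarrow> dilates_at K u" using ex_dilates_at[of "range \<xi>"] by auto
    then have K: "\<And>n. dilates_at K (\<xi> n)" by auto
    then have dK: "dilates K" by (auto simp: dilates_at_def)
    \<comment> \<open>The double families listed as single sequences, as the subbasic sets
      demand.\<close>
    define \<xi>' \<eta>' where "\<xi>' m = (case prod_decode m of (n, i) \<Rightarrow> K i (\<xi> n))"
      and "\<eta>' m = (case prod_decode m of (n, i) \<Rightarrow> K i (\<eta> n))" for m
    have outer: "summable (\<lambda>n. \<Sum>i. (norm (K i (\<zeta> n)))\<^sup>2)" if "summable (\<lambda>n. (norm (\<zeta> n))\<^sup>2)" for \<zeta>
      by (rule summable_comparison_test'[OF that, where N=0])
        (simp add: dilates_norm[OF dK] suminf_nonneg)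
    have s': "summable (\<lambda>m. (norm (\<xi>' m))\<^sup>2)" "summable (\<lambda>m. (norm (\<eta>' m))\<^sup>2)"
      using summable_prod_decode(2)[of
        "\<lambda>n i. (norm (K i (\<xi> n)))\<^sup>2", OF _ dilates_norm(1)[OF dK] outer[OF s(1)]]
        summable_prod_decode(2)[of
          "\<lambda>n i. (norm (K i (\<eta> n)))\<^sup>2", OF _ dilates_norm(1)[OF dK] outer[OF s(2)]]
      by (simp_all add: \<xi>'_def \<eta>'_def case_prod_beta)
    define V where "V = {A \<in> bounded_ops UNIV UNIV. (\<Sum>n. cinner (A (\<xi>' n)) (\<eta>' n)) \<in> U}"
    have V: "openin (weak_star UNIV) V"
      unfolding weak_star_def V_def
      by (intro topology_generated_by_Basis CollectI exI[of _ \<xi>'] exI[of _ \<eta>'] exI[of _ U])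
        (use s' U in auto)
    have eq: "(\<Sum>n. cinner (mult_op \<phi> (\<xi>' n)) (\<eta>' n)) = (\<Sum>n. cinner (calc \<phi> (\<xi> n)) (\<eta> n))"
      if \<phi>: "\<phi> \<in> multipliers" for \<phi>
    proof -
      obtain C where C: "C \<ge> 0" "\<And>f. norm (mult_op \<phi> f) \<le> C * norm f"
        using mult_op_bound[OF \<phi>] by metis
      define a where "a n i = C * ((norm (K i (\<xi> n)))\<^sup>2 + (norm (K i (\<eta> n)))\<^sup>2)" for n i
      have le: "cmod (cinner (mult_op \<phi> (K i (\<xi> n))) (K i (\<eta> n))) \<le> a n i" for n i
      proof -
        have "cmod (cinner (mult_op \<phi> (K i (\<xi> n))) (K i (\<eta> n))) \<le>
            C * norm (K i (\<xi> n)) * norm (K i (\<eta> n))"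
          by (rule order_trans[OF cinner_cauchy_schwarz mult_right_mono[OF C(2) norm_ge_zero]])
        also have "\<dots> = C * (norm (K i (\<xi> n)) * norm (K i (\<eta> n)))" by simp
        also have "\<dots> \<le> a n i"
          unfolding a_def
          using sum_squares_bound[of "norm (K i (\<xi> n))" "norm (K i (\<eta> n))"]
            mult_nonneg_nonneg[OF norm_ge_zero[of "K i (\<xi> n)"] norm_ge_zero[of "K i (\<eta> n)"]]
          by (intro mult_left_mono C) linarith
        finally show ?thesis .
      qed
      have a_s: "summable (a n)" for n
        unfolding a_def by (intro summable_mult summable_add dilates_norm dK)
      have a_eq: "suminf (a n) = C * ((\<Sum>i. (norm (K i (\<xi> n)))\<^sup>2) + (\<Sum>i. (norm (K i (\<eta> n)))\<^sup>2))"
        for n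
        unfolding a_def
        by (simp add: suminf_mult suminf_add summable_add dilates_norm[OF dK])
      have "summable (\<lambda>n. suminf (a n))"
        unfolding a_eq by (intro summable_mult summable_add outer s)
      from suminf_prod_decode[of "\<lambda>n i. cinner (mult_op \<phi> (K i (\<xi> n))) (K i (\<eta> n))", OF le a_s this]
      show ?thesis
        by (simp add: \<xi>'_def \<eta>'_def case_prod_beta cinner_calc[OF \<phi> K] comp_form_def)
    qed
    have "?\<Phi> -` W \<inter> topspace mult_weak_star = mult_op -` V \<inter> multipliers"
      using \<xi> bo cblinear_mult_op
      by (auto simp: topspace_mult_weak_star W V_def eq bounded_ops_UNIV_iff image_subset_iff)
    then show ?case using V by (auto simp: mult_weak_star_def openin_pullback_topology)
  next
    case 2
    have "?\<Phi> ` topspace mult_weak_star \<subseteq> topspace (weak_star M)"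
      using bo by (auto simp: topspace_mult_weak_star topspace_weak_star[OF sub(2)])
    then show ?case by (simp add: weak_star_def topology_generated_by_topspace)
  qed
qed

text \<open>The calculus of \<open>T\<close> restricted to \<open>M\<close> comes from restricting
  the operators \<phi>(T), so the dilation is carried out once, on the whole space.\<close>

theorem is_calculus_calc:
  assumes M: "closed_invariant_subspace T M"
  shows "is_calculus M (restrict_tuple T M) (\<lambda>\<phi>\<in>multipliers. restrict (calc \<phi>) M)"
    (is "is_calculus _ _ ?\<Phi>")
  unfolding is_calculus_def
proof (intro conjI ballI allI impI)
  have sub: "cvec.subspace M" "0 \<in> M" using M
    by (auto simp: closed_invariant_subspace_def cvec.subspace_def)
  note cont = continuous_map_calc[OF M]
  show "continuous_map mult_weak_star (weak_star M) ?\<Phi>" by (rule cont)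
  have "?\<Phi> ` multipliers \<subseteq> bounded_ops M M"
    using continuous_map_image_subset_topspace[OF cont]
    by (simp add: topspace_mult_weak_star topspace_weak_star[OF sub(2)])
  then show "?\<Phi> \<in> multipliers \<rightarrow>\<^sub>E bounded_ops M M" by auto
  show "?\<Phi> (\<lambda>z\<in>ball 0 1. 1) = (\<lambda>x\<in>M. x)"
    unfolding restrict_apply'[OF const_multiplier]
      by (rule restrict_ext) (simp only: calc_const scaleC_one)
  show "?\<Phi> (\<lambda>z\<in>ball 0 1. \<phi> z + \<psi> z) = (\<lambda>x\<in>M. ?\<Phi> \<phi> x + ?\<Phi> \<psi> x)"
    if m: "\<phi> \<in> multipliers" "\<psi> \<in> multipliers" for \<phi> \<psi>
    unfolding restrict_apply'[OF add_multiplier[OF m]] restrict_apply'[OF m(1)] restrict_apply'[OF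
        m(2)]
    by (rule restrict_ext) (simp only: calc_add[OF m] restrict_apply')
  show "?\<Phi> (\<lambda>z\<in>ball 0 1. \<phi> z * \<psi> z) = compose M (?\<Phi> \<phi>) (?\<Phi> \<psi>)"
    if m: "\<phi> \<in> multipliers" "\<psi> \<in> multipliers" for \<phi> \<psi>
    unfolding restrict_apply'[OF times_multiplier[OF m]] restrict_apply'[OF m(1)] restrict_apply'[OF
        m(2)] compose_def
    by (rule restrict_ext) (simp only: calc_times[OF m] restrict_apply' calc_invariant[OF M m(2)])
  show "?\<Phi> (\<lambda>z\<in>ball 0 1. c * \<phi> z) = (\<lambda>x\<in>M. c *\<^sub>C ?\<Phi> \<phi> x)" if m: "\<phi> \<in> multipliers" for c \<phi>
    unfolding restrict_apply'[OF scale_multiplier[OF m]] restrict_apply'[OF m]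
    by (rule restrict_ext) (simp only: calc_scale[OF m] restrict_apply')
  show "?\<Phi> (coord k) = restrict_tuple T M k" for k
    unfolding restrict_apply'[OF coord_multiplier] restrict_tuple_def
    by (rule restrict_ext) (simp only: calc_coord)
  show "matrix_op_norm M n (\<lambda>i j. ?\<Phi> (\<phi> i j)) \<le> matrix_op_norm UNIV n (\<lambda>i j. mult_op (\<phi> i j))"
    if \<phi>: "\<forall>i<n. \<forall>j<n. \<phi> i j \<in> multipliers" for n \<phi>
    unfolding matrix_op_norm_def[of M]
  proof (rule cSup_least)
    show "{sqrt (\<Sum>i<n. (norm (\<Sum>j<n. ?\<Phi> (\<phi> i j) (x j)))\<^sup>2) | x.
        (\<forall>j<n. x j \<in> M) \<and> (\<Sum>j<n. (norm (x j))\<^sup>2) \<le> 1} \<noteq> {}"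
      using sub(2) by (auto intro!: exI[of _ "\<lambda>_. 0"])
    fix r assume "r \<in> {sqrt (\<Sum>i<n. (norm (\<Sum>j<n. ?\<Phi> (\<phi> i j) (x j)))\<^sup>2) | x.
        (\<forall>j<n. x j \<in> M) \<and> (\<Sum>j<n. (norm (x j))\<^sup>2) \<le> 1}"
    then obtain x where r: "r = sqrt (\<Sum>i<n. (norm (\<Sum>j<n. ?\<Phi> (\<phi> i j) (x j)))\<^sup>2)"
      and x: "\<forall>j<n. x j \<in> M" "(\<Sum>j<n. (norm (x j))\<^sup>2) \<le> 1" by blast
    have "r = L2_set (\<lambda>i. norm (\<Sum>j<n. calc (\<phi> i j) (x j))) {..<n}"
      unfolding r L2_set_def using \<phi> x(1) by (auto intro!: sum.cong arg_cong[where f=norm])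
    also have "\<dots> \<le> matrix_op_norm UNIV n (\<lambda>i j. mult_op (\<phi> i j))"
      by (rule calc_matrix_bound) (use \<phi> x(2) in auto)
    finally show "r \<le> matrix_op_norm UNIV n (\<lambda>i j. mult_op (\<phi> i j))" .
  qed
qed

lemma calculus_eq_calc:
  assumes M: "closed_invariant_subspace T M"
  shows "calculus M (restrict_tuple T M) = (\<lambda>\<phi>\<in>multipliers. restrict (calc \<phi>) M)"
  unfolding calculus_def using is_calculus_calc[OF M] is_calculus_unique M
  by (intro the_equality) (auto simp: closed_invariant_subspace_def)

lemma Ann_iff:
  assumes M: "closed_invariant_subspace T M"
  shows "\<phi> \<in> Ann\<^sub>c M (restrict_tuple T M) \<longleftrightarrow> \<phi> \<in> multipliers \<and> (\<forall>x\<in>M. calc \<phi> x = 0)"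
  unfolding Ann\<^sub>c_def calculus_eq_calc[OF M]
  by (auto simp: fun_eq_iff restrict_def split: if_splits)

end

section \<open>Invariant subspaces of the Drury--Arveson space\<close>

lemma da_mono_counts_Cons: "da_mono (counts (k # w)) = mult_op (coord k) (da_mono (counts w))"
  by (simp add: mult_op_coord_mono)

lemma da_mono_counts_symbol: "da_mono (counts w) = symbol (\<lambda>z\<in>ball 0 1. zpow (counts w) z)"
  unfolding symbol_def
  by (rule mult_op_eqI[symmetric]) (simp add: da_eval_mono zpow_def)

lemma cinner_mult_op_coord: "cinner (mult_op (coord k) f) g = cinner f (da_back k g)"
  using hadj_right[OF cblinear_mult_op[OF coord_multiplier], of f k g]
    by (simp add: hadj_mult_op_coord)

text \<open>The coordinate multiplications form a row contraction. Pairing the sum h with itself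
  moves the shifts onto h, and the backward shifts of h have total squared norm at most that of
  h.\<close>

lemma norm_sum_mult_op_coord_le:
  fixes g :: "'d::finite \<Rightarrow> 'd drury_arveson"
  shows "(norm (\<Sum>k\<in>UNIV. mult_op (coord k) (g k)))\<^sup>2 \<le> (\<Sum>k\<in>UNIV. (norm (g k))\<^sup>2)"
proof -
  let ?h = "\<Sum>k\<in>UNIV. mult_op (coord k) (g k)"
  let ?S = "L2_set (\<lambda>k. norm (g k)) UNIV"
  have "(norm ?h)\<^sup>2 = cmod (\<Sum>k\<in>UNIV. cinner (g k) (da_back k ?h))"
    unfolding cinner_mult_op_coord[symmetric] cinner_sum_left[symmetric] cinner_self
      by (simp add: norm_power)
  also have "\<dots> \<le> (\<Sum>k\<in>UNIV. \<bar>norm (g k)\<bar> * \<bar>norm (da_back k ?h)\<bar>)"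
    by (rule sum_norm_le) (simp add: cinner_cauchy_schwarz)
  also have "\<dots> \<le> ?S * L2_set (\<lambda>k. norm (da_back k ?h)) UNIV" by (rule L2_set_mult_ineq)
  also have "\<dots> \<le> ?S * norm ?h"
    unfolding L2_set_def[of "\<lambda>k. norm (da_back k ?h)"] sum_norm_back
    by (intro mult_left_mono real_le_lsqrt L2_set_nonneg) (auto simp: level_nonneg)
  finally have "norm ?h \<le> ?S" by (cases "?h = 0") (auto simp: power2_eq_square L2_set_nonneg)
  then have "(norm ?h)\<^sup>2 \<le> ?S\<^sup>2" by (intro power_mono) auto
  then show ?thesis by (simp add: L2_set_def sum_nonneg)
qed

text \<open>Purity is inherited because the projection is contractive. The row inequality says that
  the compressed shifts form a row contraction: with S its left side and h the sum of z_k P B_k f,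
  invariance puts h in \<open>L\<close>, so S = <h, P f>, and the norm of h is at most the square
  root of S.\<close>

lemma pure_row_projection:
  fixes L :: "'d::finite drury_arveson set"
  assumes L: "cvec.subspace L" "closed L" and inv: "\<And>k f. f \<in> L \<Longrightarrow> mult_op (coord k) f \<in> L"
  shows "pure_row da_back (\<lambda>f g. cinner (orth_proj L f) g)"
proof
  let ?P = "orth_proj L"
  note cbP = cblinear_orth_proj[OF L]
  have PP: "cinner (?P f) g = cinner (?P f) (?P g)" for f g by (simp add: orth_proj_cinner[OF L])
  have re: "Re (cinner (?P f) f) = (norm (?P f))\<^sup>2" for f by (simp add: PP[of f f] cinner_self)
  show "cblinear (da_back k)" for k :: 'd by (rule cblinear_da_back)
  show "da_back i (da_back j f) = da_back j (da_back i f)" for i j :: 'd and f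
    by (rule da_back_commute)
  show "psd_form (\<lambda>f g. cinner (?P f) g)"
    unfolding psd_form_def
  proof (intro conjI allI)
    show "cinner (?P f) g = cnj (cinner (?P g) f)" for f g
      unfolding PP[of f g] PP[of g f] by (rule cinner_commute)
  qed (simp_all add: cblinear_add[OF cbP] cblinear_scaleC[OF cbP] cinner_add_left cinner_scaleC_left
      re)
  show "Re (cinner (?P f) f) \<le> (norm f)\<^sup>2" for f
    unfolding re by (intro power_mono norm_orth_proj_le[OF L]) simp
  show "(\<Sum>k\<in>UNIV. Re (cinner (?P (da_back k f)) (da_back k f))) \<le> Re (cinner (?P f) f)" for f
  proof -
    let ?g = "\<lambda>k. ?P (da_back k f)"
    let ?h = "\<Sum>k\<in>UNIV. mult_op (coord k) (?g k)"
    let ?S = "\<Sum>k\<in>UNIV. (norm (?g k))\<^sup>2"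
    have "?h \<in> L" by (intro cvec.subspace_sum L inv orth_proj_in)
    then have "cinner ?h f = cinner ?h (?P f)" using orth_proj_cinner[OF L, of ?h f]
      by (simp add: orth_proj_self[OF L])
    moreover have "cinner ?h f = of_real ?S"
      unfolding cinner_sum_left cinner_mult_op_coord by (simp add: PP[of "da_back _ f"] cinner_self)
    ultimately have *: "cinner ?h (?P f) = of_real ?S" by (simp only:)
    have S0: "?S \<ge> 0" by (intro sum_nonneg) simp
    have "?S = cmod (cinner ?h (?P f))" unfolding * norm_of_real abs_of_nonneg[OF S0] ..
    also have "\<dots> \<le> norm ?h * norm (?P f)" by (rule cinner_cauchy_schwarz)
    finally have "?S\<^sup>2 \<le> (norm ?h * norm (?P f))\<^sup>2" by (intro power_mono) (auto intro: sum_nonneg)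
    also have "\<dots> \<le> ?S * (norm (?P f))\<^sup>2"
      unfolding power_mult_distrib by (intro mult_right_mono norm_sum_mult_op_coord_le) simp
    finally have le: "?S * ?S \<le> ?S * (norm (?P f))\<^sup>2" by (simp only: power2_eq_square)
    have "?S \<le> (norm (?P f))\<^sup>2"
    proof (cases "?S = 0")
      case True
      then show ?thesis by (simp only: zero_le_power2)
    next
      case False
      with S0 have "?S > 0" by linarith
      from mult_left_le_imp_le[OF le this] show ?thesis .
    qed
    then show ?thesis by (simp add: re)
  qed
  show "(\<lambda>n. \<Sum>w | length w = n. Re (cinner (?P (back_word da_back w f)) (back_word da_back w f))) \<longlonglongrightarrow>
      0" for f
  proof (rule tendsto_sandwich[OF _ _ tendsto_const pure_da_back[of f]])
    show "\<forall>\<^sub>F n in sequentially. (\<Sum>w | length w =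
        n. Re (cinner (?P (back_word da_back w f)) (back_word da_back w f)))
        \<le> (\<Sum>w | length w = n. (norm (back_word da_back w f))\<^sup>2)"
      unfolding re by (intro always_eventually allI sum_mono power_mono norm_orth_proj_le[OF L])
          simp
  qed (auto simp: re sum_nonneg)
qed

text \<open>That is, multipliers are dense in \<open>L\<close>. The adjoints of the components of the Poisson kernel of
  the restriction of \<open>M\<^sub>x\<close> to \<open>L\<close> commute with the coordinate shifts, hence are multiplications by
  functions in \<open>L\<close>.\<close>

lemma invariant_subspace_subset:
  fixes L G :: "'d::finite drury_arveson set"
  assumes L: "cvec.subspace L" "closed L" and inv: "\<And>k f. f \<in> L \<Longrightarrow> mult_op (coord k) f \<in> L"
    and G: "cvec.subspace G" "closed G"
    and sym: "\<And>\<theta>. \<theta> \<in> multipliers \<Longrightarrow> symbol \<theta> \<in> L \<Longrightarrow> symbol \<theta> \<in> G"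
  shows "L \<subseteq> G"
proof
  interpret pure_row da_back "\<lambda>f g. cinner (orth_proj L f) g"
    by (rule pure_row_projection[OF L inv])
  fix f assume f: "f \<in> L"
  have LG: "cvec.subspace (L \<inter> G)" "closed (L \<inter> G)"
    using L G by (auto intro: cvec.subspace_inter)
  \<comment> \<open>The component of f orthogonal to \<open>L \<inter> G\<close>, still in
    \<open>L\<close>. Since the family below is exact at e, it suffices that every
    \<open>K i e\<close> vanishes.\<close>
  define e where "e = f - orth_proj (L \<inter> G) f"
  have eL: "e \<in> L" using f orth_proj_in[OF LG] L unfolding e_def by (auto intro: cvec.subspace_diff)
  have e_orth: "cinner e g = 0" if "g \<in> L" "g \<in> G" for g
    unfolding e_def using orth_proj_diff[OF LG, of g f] that by auto
  obtain K where K: "dilates K" "\<And>y. (\<lambda>i. cinner (K i e) (K i y)) sums cinner (orth_proj L e) y"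
    using dilation[of "{e}"] by (metis countable_empty countable_insert singletonI)
  have "K i e = 0" for i
  proof -
    let ?A = "hadj (K i)"
    have cb: "cblinear (K i)" and KB: "\<And>k x. K i (da_back k x) = da_back k (K i x)"
      using K(1) by (auto simp: dilates_def)
    \<comment> \<open>The form \<open>p\<close> is zero on \<open>orth L\<close>, so by the Bessel
      bound \<open>K i\<close> vanishes there, and its adjoint maps into the double complement of
      \<open>L\<close>.\<close>
    have A_L: "?A g \<in> L" for g
    proof -
      have "?A g \<in> orth (orth L)"
        unfolding orth_def[of "orth L"]
      proof (intro CollectI ballI)
        fix y assume y: "y \<in> orth L"
        have "orth_proj L y = 0"
          using y L by (intro orth_proj_eqI) (auto simp: orth_def cvec.subspace_0)
        moreover have "(\<Sum>j<Suc i. (norm (K j y))\<^sup>2) \<le> Re (cinner (orth_proj L y) y)"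
          using K(1) unfolding dilates_def by blast
        ultimately have "(\<Sum>j<Suc i. (norm (K j y))\<^sup>2) \<le> 0"
          by (simp only: cinner_zero_left zero_complex.sel)
        moreover have "(norm (K i y))\<^sup>2 \<le> (\<Sum>j<Suc i. (norm (K j y))\<^sup>2)" by (rule member_le_sum) auto
        ultimately have "(norm (K i y))\<^sup>2 \<le> 0" by linarith
        then have "K i y = 0" by simp
        then show "cinner (?A g) y = 0" by (simp add: hadj_left[OF cb])
      qed
      then show ?thesis by (simp only: orth_orth[OF L])
    qed
    have comm: "?A (mult_op (coord k) g) = mult_op (coord k) (?A g)" for k g
      by (rule hadj_eqI) (simp add: cinner_commute[of _
        "mult_op (coord k) _"] cinner_mult_op_coord hadj_left[OF cb]
          KB flip: cinner_commute)
    \<comment> \<open>The image of the constant 1 under the adjoint; commutation with the shifts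
      makes the adjoint act on monomials as multiplication by \<theta>.\<close>
    define \<theta> where "\<theta> = (\<lambda>z\<in>ball 0 1. da_eval (?A (da_mono (\<lambda>_. 0))) z)"
    have mono: "da_eval (?A (da_mono (counts w))) z = \<theta> z * zpow (counts w) z"
      if "z \<in> ball 0 1" for w z
    proof (induction w)
      case Nil
      then show ?case using that by (simp add: \<theta>_def zpow_def)
    next
      case (Cons k w)
      have "da_eval (?A (da_mono (counts (k # w)))) z = z $ k * da_eval (?A (da_mono (counts w))) z"
        unfolding da_mono_counts_Cons comm da_eval_mult_op[OF coord_multiplier that]
        using that by (simp add: coord_def)
      then show ?case by (simp add: Cons zpow_inc)
    qed
    \<comment> \<open>The pairings with monomials determine \<open>K i\<close> at the kernel
      functions, and through these the action of the adjoint on every g, so \<theta> is a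
      multiplier.\<close>
    have kernel: "K i (da_kernel z) = cnj (\<theta> z) *\<^sub>C da_kernel z" if z: "z \<in> ball 0 1" for z
    proof (rule da_hat_eqI)
      fix w
      have "cinner (da_mono (counts w)) (K i (da_kernel z)) = \<theta> z * zpow (counts w) z"
        using mono[OF z, of w] by (simp add: da_eval_kernel[OF z] hadj_left[OF cb])
      then have "da_hat (K i (da_kernel z)) w = cnj (\<theta> z * zpow (counts w) z)"
        using cinner_commute[of "K i (da_kernel z)" "da_mono (counts w)"] by (simp add: da_hat_def)
      then show "da_hat (K i (da_kernel z)) w = da_hat (cnj (\<theta> z) *\<^sub>C da_kernel z) w"
        by (simp add: da_hat_linear da_hat_kernel[OF z])
    qed
    have ev: "da_eval (?A g) z = \<theta> z * da_eval g z" if z: "z \<in> ball 0 1" for g z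
      by (simp add: da_eval_kernel[OF z] hadj_left[OF cb] kernel[OF z] cinner_scaleC_right)
    have ext: "\<theta> \<in> extensional (ball 0 1)" unfolding \<theta>_def by (rule restrict_extensional)
    have \<theta>: "\<theta> \<in> multipliers" by (rule multipliersI(1)[OF ext ev])
    have \<theta>_op: "mult_op \<theta> g = ?A g" for g by (rule multipliersI(2)[OF ext ev])
    \<comment> \<open>The product of \<theta> with a monomial is a multiplier whose symbol lies in
      \<open>L\<close>, hence in \<open>G\<close> by \<open>sym\<close>, hence is orthogonal to e.
      These pairings are the coordinates of \<open>K i e\<close>.\<close>
    have "cinner e (?A (da_mono (counts w))) = 0" for w
    proof -
      let ?z = "\<lambda>z\<in>ball 0 1. zpow (counts w) z :: complex"
      have m: "?z \<in> multipliers" by (rule polys_multipliers[OF zpow_polys])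
      have eq: "symbol (\<lambda>z\<in>ball 0 1. \<theta> z * ?z z) = ?A (da_mono (counts w))"
        unfolding da_mono_counts_symbol symbol_def mult_op_times[OF \<theta> m] \<theta>_op ..
      have "?A (da_mono (counts w)) \<in> G"
        unfolding eq[symmetric] by (rule sym[OF times_multiplier[OF \<theta> m]]) (simp only: eq A_L)
      then show ?thesis by (intro e_orth A_L)
    qed
    then show ?thesis
      by (intro da_hat_eqI) (simp add: da_hat_def hadj_right[OF cb])
  qed
  then have "(\<lambda>i. 0) sums cinner (orth_proj L e) e" using K(2)[of e] by simp
  then have "cinner e e = 0" using sums_unique2[OF sums_zero] by (metis orth_proj_self[OF L eL])
  then have "f = orth_proj (L \<inter> G) f" by (simp add: e_def)
  then show "f \<in> G" using orth_proj_in[OF LG, of f] by simp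
qed

section \<open>Intertwiners from backward shifts\<close>

lemma hadj_mult_op_cnj:
  assumes "\<phi> \<in> multipliers"
  shows "hadj (mult_op (mult_cnj \<phi>)) f = da_cnj (hadj (mult_op \<phi>) (da_cnj f))"
proof (rule hadj_eqI)
  fix x
  show "cinner (mult_op (mult_cnj \<phi>) x) f = cinner x (da_cnj (hadj (mult_op \<phi>) (da_cnj f)))"
    using cinner_da_cnj[of x "hadj (mult_op \<phi>) (da_cnj f)"]
    by (simp add: mult_op_cnj[OF assms] cinner_da_cnj hadj_right[OF cblinear_mult_op[OF assms]])
qed

lemma da_cnj_linear: "da_cnj (f + g) = da_cnj f + da_cnj g" "da_cnj (c *\<^sub>C f) = cnj c *\<^sub>C da_cnj f"
  by (rule da_eqI; simp add: da_cnj.rep_eq da_coeff_simps)+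

lemma da_back_cnj: "da_back k (da_cnj f) = da_cnj (da_back k f)"
proof (rule da_hat_eqI)
  have "da_hat (da_cnj f) w = cnj (da_hat f w)" for f :: "'a drury_arveson" and w
    by (simp add: da_hat_coeff da_cnj.rep_eq)
  then show "da_hat (da_back k (da_cnj f)) w = da_hat (da_cnj (da_back k f)) w" for w
    by (simp add: da_hat_back)
qed

text \<open>\<open>H\<close> stands for the model space. Its invariance is assumed under adjoints of
  all multipliers, because limits of polynomials are taken in \<open>calc_X\<close>.\<close>

locale backshift_intertwiner = pure_commuting_row T
  for T :: "'d::finite \<Rightarrow> 'a::complex_hilbert \<Rightarrow> 'a" +
  fixes H :: "'d drury_arveson set" and X :: "'d drury_arveson \<Rightarrow> 'a"
  assumes H: "cvec.subspace H" "closed H"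
    and H_inv: "\<phi> \<in> multipliers \<Longrightarrow> f \<in> H \<Longrightarrow> hadj (mult_op \<phi>) f \<in> H"
    and X: "X \<in> bounded_ops H UNIV" and X_inj: "inj_on X H"
    and X_back: "f \<in> H \<Longrightarrow> X (da_back k f) = T k (X f)"
begin

lemma X_linear: "f \<in> H \<Longrightarrow> g \<in> H \<Longrightarrow> X (f + g) = X f + X g" "f \<in> H \<Longrightarrow> X (c *\<^sub>C f) = c *\<^sub>C X f"
  using X by (auto simp: bounded_ops_def)

lemma X_zero: "X 0 = 0"
  using X_linear(2)[of 0 0] H by (simp add: cvec.subspace_0)

text \<open>Composition with the projection extends \<open>X\<close> from \<open>H\<close> to a
  total operator, which then has an adjoint and continuous preimages.\<close>

lemma cblinear_X_proj: "cblinear (\<lambda>f. X (orth_proj H f))"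
proof -
  note P = orth_proj_in[OF H] cblinear_orth_proj[OF H]
  have "\<exists>C. \<forall>f\<in>H. norm (X f) \<le> C * norm f" using X by (simp add: bounded_ops_def)
  then obtain C where C: "\<forall>f\<in>H. norm (X f) \<le> C * norm f" ..
  show ?thesis
  proof (rule cblinearI[where K="\<bar>C\<bar>"])
    fix f
    have "norm (X (orth_proj H f)) \<le> C * norm (orth_proj H f)" by (rule bspec[OF C P(1)])
    also have "\<dots> \<le> \<bar>C\<bar> * norm f"
      by (intro mult_mono norm_orth_proj_le[OF H]) auto
    finally show "norm (X (orth_proj H f)) \<le> \<bar>C\<bar> * norm f" .
  qed (simp_all add: cblinear_add[OF P(2)] cblinear_scaleC[OF P(2)] X_linear P(1))
qed

text \<open>Both the adjoint and \<phi> \<mapsto> \<phi>* are antilinear in the multiplier, so the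
  right side is linear and multiplicative in p and the induction can follow the construction of
  polynomials.\<close>

lemma calc_X_poly:
  assumes "p \<in> polys" "f \<in> H"
  shows "calc p (X f) = X (hadj (mult_op (mult_cnj p)) f)"
  using assms
proof (induction arbitrary: f rule: polys.induct)
  case (const c)
  then show ?case
    unfolding hadj_mult_op_cnj[OF const_multiplier] hadj_mult_op_const calc_const
    by (simp only: da_cnj_linear da_cnj_da_cnj X_linear complex_cnj_cnj)
next
  case (coord k)
  then show ?case
    by (simp add: hadj_mult_op_cnj coord_multiplier calc_coord hadj_mult_op_coord da_back_cnj
        X_back)
next
  case (add p q)
  note m = add.hyps[THEN polys_multipliers]
  show ?case
    unfolding hadj_mult_op_cnj[OF add_multiplier[OF m]] hadj_mult_op_add[OF m] da_cnj_linear
    using add.prems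
    by (simp only: hadj_mult_op_cnj[OF m(1), symmetric] hadj_mult_op_cnj[OF m(2), symmetric]
        calc_add[OF m] X_linear H_inv cnj_multiplier m add.IH)
next
  case (times p q)
  note m = times.hyps[THEN polys_multipliers]
  have "hadj (mult_op (mult_cnj (\<lambda>z\<in>ball 0 1. p z * q z))) f =
      hadj (mult_op (mult_cnj p)) (hadj (mult_op (mult_cnj q)) f)"
    by (simp only: hadj_mult_op_cnj times_multiplier m hadj_mult_op_times da_cnj_da_cnj)
  then show ?case
    using times by (simp only: calc_times[OF m] H_inv cnj_multiplier m)
qed

lemma calc_X:
  assumes \<phi>: "\<phi> \<in> multipliers" and f: "f \<in> H"
  shows "calc \<phi> (X f) = X (hadj (mult_op (mult_cnj \<phi>)) f)"
proof (rule cinner_eqI)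
  fix y
  let ?q = "\<lambda>n. fejer (Suc n) \<phi>"
  have q: "?q n \<in> multipliers" for n by (rule polys_multipliers[OF fejer_polys])
  define u where "u = hadj (\<lambda>f. X (orth_proj H f)) y"
  \<comment> \<open>Rewritten as a matrix coefficient of M_\<psi> at fixed vectors, the right side
    also converges along the Fejer sums.\<close>
  have eq: "cinner (X (hadj (mult_op (mult_cnj \<psi>)) f)) y = cinner (mult_op \<psi> (da_cnj u)) (da_cnj f)"
    if \<psi>: "\<psi> \<in> multipliers" for \<psi>
  proof -
    let ?g = "hadj (mult_op (mult_cnj \<psi>)) f"
    have "cinner (X ?g) y = cinner ?g u"
      using hadj_right[OF cblinear_X_proj, of ?g y] H_inv[OF cnj_multiplier[OF \<psi>] f]
      by (simp add: u_def orth_proj_self[OF H])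
    also have "\<dots> = cnj (cinner (hadj (mult_op \<psi>) (da_cnj f)) (da_cnj u))"
      by (simp add: hadj_mult_op_cnj[OF \<psi>] cinner_da_cnj)
    also have "\<dots> = cinner (mult_op \<psi> (da_cnj u)) (da_cnj f)"
      by (simp add: hadj_left[OF cblinear_mult_op[OF \<psi>]] flip: cinner_commute)
    finally show ?thesis .
  qed
  show "cinner (calc \<phi> (X f)) y = cinner (X (hadj (mult_op (mult_cnj \<phi>)) f)) y"
  proof (rule LIMSEQ_unique)
    show "(\<lambda>n. cinner (calc (?q n) (X f)) y) \<longlonglongrightarrow> cinner (calc \<phi> (X f)) y"
      by (intro calc_wot_conv q \<phi> fejer_wot_conv)
    show "(\<lambda>n. cinner (calc (?q n) (X f)) y) \<longlonglongrightarrow> cinner (X (hadj (mult_op (mult_cnj \<phi>)) f)) y"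
      unfolding calc_X_poly[OF fejer_polys f] eq[OF q] eq[OF \<phi>]
      using fejer_wot_conv[OF \<phi>] by (simp add: wot_conv_def)
  qed
qed

section \<open>Preimages of invariant subspaces\<close>

definition preimage :: "'a set \<Rightarrow> 'd drury_arveson set" where
  "preimage M = {f \<in> H. X f \<in> M}"

lemma preimage_subspace:
  assumes M: "closed_invariant_subspace T M"
  shows "cvec.subspace (preimage M)" "closed (preimage M)"
    "f \<in> preimage M \<Longrightarrow> da_back k f \<in> preimage M"
proof -
  have sub: "cvec.subspace M" "closed M" and inv: "\<And>k x. x \<in> M \<Longrightarrow> T k x \<in> M"
    using M by (auto simp: closed_invariant_subspace_def)
  show "cvec.subspace (preimage M)"
    using H(1) sub(1) by (auto simp: preimage_def cvec.subspace_def X_linear X_zero)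
  have "preimage M = H \<inter> (\<lambda>f. X (orth_proj H f)) -` M"
    by (auto simp: preimage_def orth_proj_self[OF H])
  then show "closed (preimage M)"
    by (simp only:) (intro closed_Int H closed_vimage sub linear_continuous_on
        cblinear_bounded_linear cblinear_X_proj)
  show "da_back k f \<in> preimage M" if "f \<in> preimage M"
    using that H_inv[OF coord_multiplier, of f k]
      by (simp add: preimage_def X_back inv hadj_mult_op_coord)
qed

text \<open>By injectivity of \<open>X\<close> the left side says that the adjoint of M_\<theta>
  kills the preimage. Pairing with the constant 1 gives the right side. Conversely, the orthogonal
  complement is invariant under the coordinate multiplications, so it contains \<theta> times every
  monomial.\<close>

lemma Ann_preimage:
  assumes M: "closed_invariant_subspace T M" "M \<subseteq> X ` H" and \<theta>: "\<theta> \<in> multipliers"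
  shows "mult_cnj \<theta> \<in> Ann\<^sub>c M (restrict_tuple T M) \<longleftrightarrow> symbol \<theta> \<in> orth (preimage M)"
proof -
  note m = cnj_multiplier[OF \<theta>]
  note cb = cblinear_mult_op[OF \<theta>]
  have "calc (mult_cnj \<theta>) (X f) = 0 \<longleftrightarrow> hadj (mult_op \<theta>) f = 0" if f: "f \<in> H" for f
  proof -
    have "calc (mult_cnj \<theta>) (X f) = X (hadj (mult_op \<theta>) f)"
      using calc_X[OF m f] by (simp add: mult_cnj_mult_cnj[OF \<theta>])
    then show ?thesis
      using inj_onD[OF X_inj, of "hadj (mult_op \<theta>) f" 0] H_inv[OF \<theta> f] H(1)
        by (auto simp: X_zero cvec.subspace_0)
  qed
  then have "mult_cnj \<theta> \<in> Ann\<^sub>c M (restrict_tuple T M) \<longleftrightarrow> (\<forall>f\<in>preimage M. hadj (mult_op \<theta>) f = 0)"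
    unfolding Ann_iff[OF M(1)] using M(2) m by (auto simp: preimage_def)
  also have "\<dots> \<longleftrightarrow> symbol \<theta> \<in> orth (preimage M)"
  proof
    assume "\<forall>f\<in>preimage M. hadj (mult_op \<theta>) f = 0"
    then show "symbol \<theta> \<in> orth (preimage M)"
      by (simp add: orth_def symbol_def hadj_right[OF cb, symmetric])
  next
    assume s: "symbol \<theta> \<in> orth (preimage M)"
    have mono: "mult_op \<theta> (da_mono (counts w)) \<in> orth (preimage M)" for w
    proof (induction w)
      case Nil
      then show ?case using s by (simp add: symbol_def)
    next
      case (Cons k w)
      have "cinner (mult_op (coord k) (mult_op \<theta> (da_mono (counts w)))) f = 0"
        if "f \<in> preimage M" for f
        using Cons preimage_subspace(3)[OF M(1) that, of k]
          by (simp add: cinner_mult_op_coord orth_def)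
      then show ?case
        unfolding da_mono_counts_Cons mult_op_commute[OF \<theta> coord_multiplier] by (simp add: orth_def)
    qed
    show "\<forall>f\<in>preimage M. hadj (mult_op \<theta>) f = 0"
    proof (intro ballI da_hat_eqI)
      fix f w assume "f \<in> preimage M"
      then show "da_hat (hadj (mult_op \<theta>) f) w = da_hat 0 w"
        using mono[of w] cinner_commute[of f] by (simp add: da_hat_def hadj_left[OF cb] orth_def)
    qed
  qed
  finally show ?thesis .
qed

theorem eq_of_Ann_eq:
  assumes M: "closed_invariant_subspace T M" "M \<subseteq> X ` H"
    and N: "closed_invariant_subspace T N" "N \<subseteq> X ` H"
    and Ann: "Ann\<^sub>c M (restrict_tuple T M) = Ann\<^sub>c N (restrict_tuple T N)"
  shows "M = N"
proof -
  have inv: "mult_op (coord k) f \<in> orth (preimage M)"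
    if "f \<in> orth (preimage M)" "closed_invariant_subspace T M" for k f M
    using that preimage_subspace(3)[OF that(2)] by (simp add: orth_def cinner_mult_op_coord)
  have "orth (preimage M) \<subseteq> orth (preimage N)"
    using Ann Ann_preimage[OF M] Ann_preimage[OF N]
    by (intro invariant_subspace_subset orth_subspace orth_closed) (auto intro: inv M)
  moreover have "orth (preimage N) \<subseteq> orth (preimage M)"
    using Ann Ann_preimage[OF M] Ann_preimage[OF N]
    by (intro invariant_subspace_subset orth_subspace orth_closed) (auto intro: inv N)
  ultimately have "orth (orth (preimage M)) = orth (orth (preimage N))" by simp
  then have "preimage M = preimage N"
    by (simp only: orth_orth preimage_subspace[OF M(1)] preimage_subspace[OF N(1)])
  moreover have "X ` preimage M = M" "X ` preimage N = N" using M(2) N(2)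
    by (auto simp: preimage_def)
  ultimately show ?thesis by metis
qed

end

section \<open>Model spaces\<close>

lemma model_space_iff: "f \<in> model_space J \<longleftrightarrow> (\<forall>\<theta>\<in>J. \<forall>g. cinner f (mult_op \<theta> g) = 0)"
proof
  assume f: "f \<in> model_space J"
  show "\<forall>\<theta>\<in>J. \<forall>g. cinner f (mult_op \<theta> g) = 0"
  proof (intro ballI allI)
    fix \<theta> g assume "\<theta> \<in> J"
    then have "mult_op \<theta> g \<in> cvec.span {mult_op \<theta> f | \<theta> f. \<theta> \<in> J}" by (intro cvec.span_base) auto
    then have "mult_op \<theta> g \<in> ideal_space J" unfolding ideal_space_def using closure_subset by blast
    then show "cinner f (mult_op \<theta> g) = 0" using f by (simp add: model_space_def orth_def)
  qed
next
  assume f: "\<forall>\<theta>\<in>J. \<forall>g. cinner f (mult_op \<theta> g) = 0"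
  have sub: "cvec.subspace {g. cinner f g = 0}" "closed {g. cinner f g = 0}"
    by (auto simp: cvec.subspace_def cinner_add_right cinner_scaleC_right
        intro!: closed_Collect_eq continuous_on_const linear_continuous_on
            bounded_linear_cinner_right)
  have "ideal_space J \<subseteq> {g. cinner f g = 0}"
    unfolding ideal_space_def by (intro closure_minimal sub cvec.span_minimal) (use f in auto)
  then show "f \<in> model_space J" by (auto simp: model_space_def orth_def)
qed

lemma model_space_closed: "cvec.subspace (model_space J)" "closed (model_space J)"
  by (simp_all add: model_space_def orth_subspace orth_closed)

text \<open>Multiplication by \<phi> commutes with multiplication by elements of \<open>J\<close>,
  so it preserves the vectors to which the model space is orthogonal.\<close>

lemma model_space_inv:
  assumes J: "J \<subseteq> multipliers" and \<phi>: "\<phi> \<in> multipliers" and f: "f \<in> model_space J"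
  shows "hadj (mult_op \<phi>) f \<in> model_space J"
  unfolding model_space_iff
proof (intro ballI allI)
  fix \<theta> g assume \<theta>: "\<theta> \<in> J"
  then have "\<theta> \<in> multipliers" using J by blast
  then show "cinner (hadj (mult_op \<phi>) f) (mult_op \<theta> g) = 0"
    using f \<theta> by (simp add: hadj_left[OF cblinear_mult_op[OF \<phi>]] mult_op_commute[OF \<phi>]
        model_space_iff)
qed

text \<open>The model space is invariant under the backward shifts, so the adjoint of the
  compression is their restriction and the projection disappears.\<close>

lemma model_tuple_adj_eq:
  assumes J: "J \<subseteq> multipliers" and f: "f \<in> model_space J"
  shows "model_tuple_adj J k f = da_back k f"
proof -
  let ?H = "model_space J"
  note cb = cblinear_mult_op[OF coord_multiplier]
  have inH: "da_back k f \<in> ?H" using model_space_inv[OF J coord_multiplier f, of k]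
    by (simp add: hadj_mult_op_coord)
  have comp: "cinner (model_tuple J k g) f = cinner g (da_back k f)" if "g \<in> ?H" for g
    using orth_proj_diff[OF model_space_closed f, of "mult_op (coord k) g"] that
    by (simp add: model_tuple_def cinner_diff_left cinner_mult_op_coord)
  have "(THE z. z \<in> ?H \<and> (\<forall>x\<in>?H. cinner (model_tuple J k x) f = cinner x z)) = da_back k f"
  proof (rule the_equality)
    show "da_back k f \<in> ?H \<and> (\<forall>x\<in>?H. cinner (model_tuple J k x) f = cinner x (da_back k f))"
      using inH comp by blast
    fix z assume z: "z \<in> ?H \<and> (\<forall>x\<in>?H. cinner (model_tuple J k x) f = cinner x z)"
    then have "z - da_back k f \<in> ?H" using inH
      by (auto intro: cvec.subspace_diff model_space_closed)
    then have "cinner (z - da_back k f) (z - da_back k f) = 0"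
      using z comp by (simp add: cinner_diff_right)
    then show "z = da_back k f" by simp
  qed
  then show ?thesis using f by (simp add: model_tuple_adj_def adj_def)
qed

theorem theorem4p5:
  fixes T :: "'d::finite \<Rightarrow> 'a::complex_hilbert \<Rightarrow> 'a"
    and J :: "(complex^'d \<Rightarrow> complex) set"
    and X :: "'d drury_arveson \<Rightarrow> 'a"
    and M N :: "'a set"
  assumes "row_contraction UNIV T" and "commuting UNIV T" and "pure UNIV T"
    and "weak_star_closed_ideal J"
    and "X \<in> quasi_intertwiners (model_space J) (model_tuple_adj J) UNIV T"
    and "closed_invariant_subspace T M" and "closed_invariant_subspace T N"
    and "Ann\<^sub>c M (restrict_tuple T M) = Ann\<^sub>c N (restrict_tuple T N)"
    and "M \<subseteq> X ` model_space J" and "N \<subseteq> X ` model_space J"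
  shows "M = N"
proof -
  \<comment> \<open>This inclusion is encoded in \<open>closedin\<close>: closed sets lie in the
    topspace, which is \<open>multipliers\<close>.\<close>
  have J: "J \<subseteq> multipliers"
    using assms(4) closedin_subset
      by (fastforce simp: weak_star_closed_ideal_def topspace_mult_weak_star)
  have X: "X \<in> bounded_ops (model_space J) UNIV" "inj_on X (model_space J)"
    "compose (model_space J) X (model_tuple_adj J k) = compose (model_space J) (T k) X" for k
    using assms(5) by (auto simp: quasi_intertwiners_def)
  have "X (da_back k f) = T k (X f)" if "f \<in> model_space J" for f k
    using fun_cong[OF X(3)[of k], of f] that by (simp add: compose_def model_tuple_adj_eq[OF J])
  then interpret backshift_intertwiner T "model_space J" X
    using assms(1-3) X(1,2) model_space_closed model_space_inv[OF J]
    by unfold_locales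
  show ?thesis by (rule eq_of_Ann_eq) (use assms in auto)
qed

end
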